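(* In $\mathrm{HYP}$, the Borel Dual Ramsey Theorem fails; in fact, for $k=\ell=2$ there are sets $C_0,C_1$, Borel in $\mathrm{HYP}$, with $(\omega)^2\cap\mathrm{HYP}=C_0\cup C_1$, such that for no $p\in(\omega)^\omega\cap\mathrm{HYP}$ and no $i<2$ do we have $(p)^2\cap\mathrm{HYP}\subseteq C_i$.
   Context: For $k\in\mathbb N\cup\{\omega\}$, $(\omega)^k$ is the set of partitions of $\omega$ into exactly $k$ nonempty pieces (coded as reals in a standard way); for $p\in(\omega)^\omega$, $(p)^k$ is the set of coarsenings of $p$ into exactly $k$ blocks. The Borel Dual Ramsey Theorem states: for all finite $k,\ell\ge1$, if $(\omega)^k=C_0\cup\dots\cup C_{\ell-1}$ with each $C_i$ Borel, then there are $p\in(\omega)^\omega$ and $i<\ell$ with $(p)^k\subseteq C_i$. $\mathrm{HYP}$ is the $\omega$-model of second-order arithmetic whose sets are the hyperarithmetic sets. A labeled Borel code in $\mathrm{HYP}$ is a hyperarithmetic tree $T\subseteq\omega^{<\omega}$ with no hyperarithmetic infinite path, with a hyperarithmetic labeling assigning $\bigcup$ or $\bigcap$ to interior nodes and codes of clopen subsets of $2^\omega$ to leaves. An evaluation map for $X$ in $T$ is $f:T\to\{0,1\}$ with $f(\eta)=1$ iff $X$ lies in the leaf's clopen set, $f(\sigma)=1$ iff some child is 1 at $\bigcup$-nodes, and iff all children are 1 at $\bigcap$-nodes. $T$ is completely determined in $\mathrm{HYP}$ if every $X\in\mathrm{HYP}$ has a hyperarithmetic evaluation map. A set of reals is Borel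 in $\mathrm{HYP}$ if it equals $\{X\in\mathrm{HYP}:$ the evaluation map for $X$ gives the root value 1$\}$ for some completely determined code in $\mathrm{HYP}$. *)

theory Defs
  imports
    "HOL-Library.Nat_Bijection"
    "HOL-Library.Disjoint_Sets"
    "HOL-Library.Extended_Nat"
    "HOL-Library.Sublist"
begin

section \<open>Oracle computability\<close>

text \<open>Programs for unary partial functions on the naturals; several arguments are passed through
  the pairing function \<^const>\<open>prod_encode\<close>. These are the schemes for the partial
  recursive functions, with \<open>Query\<close> asking the oracle.\<close>

datatype prog =
    Zero
  | Succ
  | LeftP
  | RightP
  | Query
  | PairP prog prog
  | CompP prog prog
  | PrimRec prog prog
  | Mu prog

primrec run :: "nat set \<Rightarrow> prog \<Rightarrow> nat \<Rightarrow> nat option" where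
  "run A Zero x = Some 0"
| "run A Succ x = Some (Suc x)"
| "run A LeftP x = Some (fst (prod_decode x))"
| "run A RightP x = Some (snd (prod_decode x))"
| "run A Query x = Some (of_bool (x \<in> A))"
| "run A (PairP p q) x =
     Option.bind (run A p x) (\<lambda>y. Option.bind (run A q x) (\<lambda>z. Some (prod_encode (y, z))))"
| "run A (CompP p q) x = Option.bind (run A q x) (run A p)"
| "run A (PrimRec p q) x =
     rec_nat (run A p (fst (prod_decode x)))
       (\<lambda>i r. Option.bind r (\<lambda>v. run A q (prod_encode (fst (prod_decode x), prod_encode (i, v)))))
       (snd (prod_decode x))"
| "run A (Mu p) x =
     (if \<exists>n. run A p (prod_encode (x, n)) = Some 0 \<and> (\<forall>m<n. run A p (prod_encode (x, m)) \<noteq> None)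
      then Some (LEAST n. run A p (prod_encode (x, n)) = Some 0)
      else None)"

primrec prog_code :: "prog \<Rightarrow> nat" where
  "prog_code Zero = prod_encode (0, 0)"
| "prog_code Succ = prod_encode (1, 0)"
| "prog_code LeftP = prod_encode (2, 0)"
| "prog_code RightP = prod_encode (3, 0)"
| "prog_code Query = prod_encode (4, 0)"
| "prog_code (PairP p q) = prod_encode (5, prod_encode (prog_code p, prog_code q))"
| "prog_code (CompP p q) = prod_encode (6, prod_encode (prog_code p, prog_code q))"
| "prog_code (PrimRec p q) = prod_encode (7, prod_encode (prog_code p, prog_code q))"
| "prog_code (Mu p) = prod_encode (8, prog_code p)"

lemma inj_prog_code: "inj prog_code"
proof (rule injI)
  fix p q
  assume "prog_code p = prog_code q"
  then show "p = q"
    by (induction p arbitrary: q) (case_tac q; simp add: prod_encode_eq)+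
qed

text \<open>\<open>phi A e\<close> is the \<open>e\<close>-th partial function computable with oracle \<open>A\<close>;
  numbers that are not codes of programs index the nowhere defined function.\<close>

definition phi :: "nat set \<Rightarrow> nat \<Rightarrow> nat \<Rightarrow> nat option" where
  "phi A e x = (if e \<in> range prog_code then run A (inv prog_code e) x else None)"

definition turing_le :: "nat set \<Rightarrow> nat set \<Rightarrow> bool"  (infix \<open>\<le>\<^sub>T\<close> 50) where
  "X \<le>\<^sub>T Y \<longleftrightarrow> (\<exists>e. \<forall>n. phi Y e n = Some (of_bool (n \<in> X)))"

definition turing_jump :: "nat set \<Rightarrow> nat set" where
  "turing_jump A = {e. phi A e e \<noteq> None}"

section \<open>Hyperarithmetic sets\<close>

text \<open>Kleene's system of notations for the computable ordinals, with its order.\<close>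

inductive kleene_O :: "nat \<Rightarrow> bool" and kleene_less :: "nat \<Rightarrow> nat \<Rightarrow> bool"  (infix \<open><\<^sub>O\<close> 50) where
  O_zero: "kleene_O 1"
| O_succ: "kleene_O a \<Longrightarrow> kleene_O (2 ^ a)"
| O_lim: "(\<And>n. phi {} e n = Some (s n)) \<Longrightarrow> (\<And>n. kleene_O (s n)) \<Longrightarrow> (\<And>n. s n <\<^sub>O s (Suc n))
    \<Longrightarrow> kleene_O (3 * 5 ^ e)"
| kless_succ: "kleene_O a \<Longrightarrow> a <\<^sub>O 2 ^ a"
| kless_lim: "(\<And>n. phi {} e n = Some (s n)) \<Longrightarrow> (\<And>n. kleene_O (s n)) \<Longrightarrow> (\<And>n. s n <\<^sub>O s (Suc n))
    \<Longrightarrow> s m <\<^sub>O 3 * 5 ^ e"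
| kless_trans: "a <\<^sub>O b \<Longrightarrow> b <\<^sub>O c \<Longrightarrow> a <\<^sub>O c"

text \<open>\<open>H_set a X\<close> means that \<open>a\<close> is a notation and \<open>X\<close> is the set \<open>H\<^sub>a\<close> of the
  hyperarithmetic hierarchy: jumps at successors and effective joins at limits.\<close>

inductive H_set :: "nat \<Rightarrow> nat set \<Rightarrow> bool" where
  H_zero: "H_set 1 {}"
| H_succ: "H_set a X \<Longrightarrow> H_set (2 ^ a) (turing_jump X)"
| H_lim: "kleene_O (3 * 5 ^ e) \<Longrightarrow> (\<And>n. phi {} e n = Some (s n)) \<Longrightarrow> (\<And>n. H_set (s n) (Y n))
    \<Longrightarrow> H_set (3 * 5 ^ e) {prod_encode (m, n) | m n. m \<in> Y n}"

definition HYP :: "nat set set" where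
  "HYP = {X. \<exists>a H. kleene_O a \<and> H_set a H \<and> X \<le>\<^sub>T H}"

definition hyp_fun_on :: "'a set \<Rightarrow> ('a \<Rightarrow> nat) \<Rightarrow> ('b \<Rightarrow> nat) \<Rightarrow> ('a \<Rightarrow> 'b) \<Rightarrow> bool" where
  "hyp_fun_on D enc enc' f \<longleftrightarrow> {prod_encode (enc x, enc' (f x)) | x. x \<in> D} \<in> HYP"

section \<open>Borel codes in HYP\<close>

text \<open>A clopen subset of Cantor space is coded by a finite list of binary strings, standing for the
  union of the corresponding basic clopen sets.\<close>

definition cone :: "bool list \<Rightarrow> nat set set" where
  "cone s = {X. \<forall>i<length s. s ! i \<longleftrightarrow> i \<in> X}"

definition clopen_of :: "bool list list \<Rightarrow> nat set set" where
  "clopen_of ss = (\<Union>s\<in>set ss. cone s)"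

datatype node_label = Cup | Cap | Clopen "bool list list"

primrec label_code :: "node_label \<Rightarrow> nat" where
  "label_code Cup = 0"
| "label_code Cap = 1"
| "label_code (Clopen ss) = 2 + list_encode (map (\<lambda>s. list_encode (map of_bool s)) ss)"

definition is_tree :: "nat list set \<Rightarrow> bool" where
  "is_tree T \<longleftrightarrow> [] \<in> T \<and> (\<forall>\<sigma>\<in>T. \<forall>\<tau>. prefix \<tau> \<sigma> \<longrightarrow> \<tau> \<in> T)"

definition is_leaf :: "nat list set \<Rightarrow> nat list \<Rightarrow> bool" where
  "is_leaf T \<sigma> \<longleftrightarrow> \<sigma> \<in> T \<and> (\<forall>n. \<sigma> @ [n] \<notin> T)"

definition is_path :: "nat list set \<Rightarrow> (nat \<Rightarrow> nat) \<Rightarrow> bool" where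
  "is_path T g \<longleftrightarrow> (\<forall>n. map g [0..<n] \<in> T)"

text \<open>The labeling \<open>L\<close> is only meaningful on \<open>T\<close>.\<close>

definition borel_code_HYP :: "nat list set \<Rightarrow> (nat list \<Rightarrow> node_label) \<Rightarrow> bool" where
  "borel_code_HYP T L \<longleftrightarrow>
     is_tree T \<and>
     list_encode ` T \<in> HYP \<and>
     (\<nexists>g. is_path T g \<and> hyp_fun_on UNIV id id g) \<and>
     hyp_fun_on T list_encode label_code L \<and>
     (\<forall>\<sigma>\<in>T. if is_leaf T \<sigma> then \<exists>ss. L \<sigma> = Clopen ss else L \<sigma> \<in> {Cup, Cap})"

definition eval_map ::
    "nat list set \<Rightarrow> (nat list \<Rightarrow> node_label) \<Rightarrow> nat set \<Rightarrow> (nat list \<Rightarrow> bool) \<Rightarrow> bool" where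
  "eval_map T L X f \<longleftrightarrow>
     (\<forall>\<sigma>\<in>T. f \<sigma> \<longleftrightarrow>
        (case L \<sigma> of
           Clopen ss \<Rightarrow> X \<in> clopen_of ss
         | Cup \<Rightarrow> (\<exists>n. \<sigma> @ [n] \<in> T \<and> f (\<sigma> @ [n]))
         | Cap \<Rightarrow> (\<forall>n. \<sigma> @ [n] \<in> T \<longrightarrow> f (\<sigma> @ [n]))))"

definition hyp_eval_map ::
    "nat list set \<Rightarrow> (nat list \<Rightarrow> node_label) \<Rightarrow> nat set \<Rightarrow> (nat list \<Rightarrow> bool) \<Rightarrow> bool" where
  "hyp_eval_map T L X f \<longleftrightarrow> eval_map T L X f \<and> hyp_fun_on T list_encode of_bool f"

definition completely_determined_HYP :: "nat list set \<Rightarrow> (nat list \<Rightarrow> node_label) \<Rightarrow> bool" where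
  "completely_determined_HYP T L \<longleftrightarrow> (\<forall>X\<in>HYP. \<exists>f. hyp_eval_map T L X f)"

text \<open>Only hyperarithmetic evaluation maps count: these agree on \<open>T\<close>, because \<open>T\<close> has no
  hyperarithmetic path, whereas \<open>T\<close> may be ill-founded and admit other evaluation maps.\<close>

definition borel_in_HYP :: "nat set set \<Rightarrow> bool" where
  "borel_in_HYP C \<longleftrightarrow>
     (\<exists>T L. borel_code_HYP T L \<and> completely_determined_HYP T L \<and>
        C = {X \<in> HYP. \<exists>f. hyp_eval_map T L X f \<and> f []})"

section \<open>Partitions of the natural numbers\<close>

text \<open>A partition is coded by the real of (codes of) pairs of numbers lying in the same block.\<close>

definition partition_code :: "nat set set \<Rightarrow> nat set" where
  "partition_code P = {prod_encode (m, n) | m n. \<exists>B\<in>P. m \<in> B \<and> n \<in> B}"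

definition block_count :: "nat set set \<Rightarrow> enat" where
  "block_count P = (if finite P then enat (card P) else \<infinity>)"

definition partitions :: "enat \<Rightarrow> nat set set" where
  "partitions k = {partition_code P | P. partition_on UNIV P \<and> block_count P = k}"

definition coarsenings :: "nat set \<Rightarrow> enat \<Rightarrow> nat set set" where
  "coarsenings p k =
     {partition_code Q | P Q. partition_code P = p \<and> refines UNIV P Q \<and> block_count Q = k}"

definition Borel_Dual_Ramsey_in_HYP :: bool where
  "Borel_Dual_Ramsey_in_HYP \<longleftrightarrow>
     (\<forall>(k::nat) (l::nat) (C :: nat \<Rightarrow> nat set set).
        1 \<le> k \<longrightarrow> 1 \<le> l \<longrightarrow>
        (\<forall>i<l. borel_in_HYP (C i)) \<longrightarrow>
        partitions (enat k) \<inter> HYP = (\<Union>i<l. C i) \<longrightarrow>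
        (\<exists>p \<in> partitions \<infinity> \<inter> HYP. \<exists>i<l. coarsenings p (enat k) \<inter> HYP \<subseteq> C i))"

end

theory Submission
  imports Defs
begin

text \<open>Call a function arithmetical if it is computable in a fixed finite jump of the oracle, uniformly in
  the oracle. Monotone stages \<open>K\<close> collect ever more notations \<open>a\<close> together with the sets \<open>H\<^sub>a\<close>, and with
  every stage \<open>K\<close> come countable families \<open>U0 K \<subseteq> U1 K \<subseteq> U2 K\<close> of sets, all of which are absorbed into
  \<open>U0\<close> of every later stage. Each hyperarithmetic \<open>X\<close> lies in \<open>U2 K\<close> for a least stage \<open>K\<close>, its level,
  and a two-block partition \<open>X\<close> gets its colour according to whether it lies in \<open>U1 K\<close>. If \<open>p\<close> is a
  hyperarithmetic partition into infinitely many blocks, then \<open>p\<close> is in \<open>U0 K\<close> for some \<open>K\<close>, and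
  diagonalizing against the columns of \<open>U0 K\<close> and of \<open>U1 K\<close> gives two-block coarsenings of \<open>p\<close> of level \<open>K\<close>
  and of different colours.

  In the Borel code for a colour the stages are indexed by the nodes of a tree that has an infinite path
  but no hyperarithmetic one: the tree of attempts to build a set \<open>Z\<close>, with Skolem functions, that contains
  the hierarchy of all \<open>H\<^sub>a\<close>; by diagonalization no such \<open>Z\<close> is hyperarithmetic. The construction stops as
  soon as \<open>X\<close> is captured. Hence at the ill-founded nodes nothing but the level of \<open>X\<close> is ever needed, and
  this is hyperarithmetic by effective transfinite recursion, so every hyperarithmetic \<open>X\<close> has a
  hyperarithmetic evaluation map.\<close>

section \<open>Programs\<close>

text \<open>The index set \<open>kleene_O\<close> of the true hierarchy is not hyperarithmetic, so a
  code in HYP cannot branch over it; the nodes of the tree of attempts, the clock, stand in for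
  notations. A clock node carries the union of \<open>Next\<close> over the stages at its children,
  read as a greatest fixed point (\<open>kappa\<close>), so that the root of an infinite path
  carries every stage. No hyperarithmetic description of \<open>kappa\<close> is ever needed: the
  stopping rule mentions only \<open>X\<close> and the current stage, so it can be written into the
  code, and for the level \<open>S\<close> of \<open>X\<close> the sets
  \<open>kappa t \<inter> S\<close> obey a recursion along a notation of \<open>S\<close>. The
  prenex form \<open>sat\<close> serves twice. Its Skolem values turn the arithmetical closure
  condition on \<open>Z\<close> into a condition that is refuted by finitely many values, as a tree
  requires; and its quantifiers become the alternating unions and intersections of the code between
  two moves of the clock. Three families are needed because capture is tested with \<open>U2\<close>
  and the colour with \<open>U1\<close>, while \<open>U0\<close> already contains all that was
  captured before: a set outside \<open>U0 S\<close> cannot have a level below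
  \<open>S\<close>.\<close>

abbreviation pp :: "nat \<Rightarrow> nat \<Rightarrow> nat" where "pp x y \<equiv> prod_encode (x, y)"
abbreviation p1 :: "nat \<Rightarrow> nat" where "p1 z \<equiv> fst (prod_decode z)"
abbreviation p2 :: "nat \<Rightarrow> nat" where "p2 z \<equiv> snd (prod_decode z)"

lemma pp_p1_p2 [simp]: "pp (p1 z) (p2 z) = z"
  by (metis prod.collapse prod_decode_inverse)

definition id_prog :: prog where "id_prog = PairP LeftP RightP"

primrec const_prog :: "nat \<Rightarrow> prog" where
  "const_prog 0 = Zero"
| "const_prog (Suc n) = CompP Succ (const_prog n)"

definition fix_prog :: "prog \<Rightarrow> nat \<Rightarrow> prog" where
  "fix_prog p x = CompP p (PairP (const_prog x) id_prog)"

lemma run_id_prog [simp]: "run A id_prog x = Some x"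
  by (simp add: id_prog_def)

lemma run_const_prog [simp]: "run A (const_prog n) x = Some n"
  by (induction n) auto

lemma run_fix_prog [simp]: "run A (fix_prog p x) y = run A p (pp x y)"
  by (simp add: fix_prog_def)

lemma phi_prog_code [simp]: "phi A (prog_code p) x = run A p x"
  by (simp add: phi_def inv_f_f inj_prog_code)

lemma phi_SomeE:
  assumes "phi A e x = Some y"
  obtains p where "e = prog_code p" "run A p x = Some y"
  using assms by (auto simp: phi_def inj_prog_code split: if_splits)

lemma turing_jump_iff: "e \<in> turing_jump A \<longleftrightarrow> (\<exists>p. e = prog_code p \<and> run A p e \<noteq> None)"
  by (auto simp: turing_jump_def phi_def inj_prog_code)

lemma prog_code_in_turing_jump [simp]:
  "prog_code p \<in> turing_jump A \<longleftrightarrow> run A p (prog_code p) \<noteq> None"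
  using inj_prog_code by (auto simp: turing_jump_iff dest: injD)

primrec subst_query :: "prog \<Rightarrow> prog \<Rightarrow> prog" where
  "subst_query r Zero = Zero"
| "subst_query r Succ = Succ"
| "subst_query r LeftP = LeftP"
| "subst_query r RightP = RightP"
| "subst_query r Query = r"
| "subst_query r (PairP p q) = PairP (subst_query r p) (subst_query r q)"
| "subst_query r (CompP p q) = CompP (subst_query r p) (subst_query r q)"
| "subst_query r (PrimRec p q) = PrimRec (subst_query r p) (subst_query r q)"
| "subst_query r (Mu p) = Mu (subst_query r p)"

lemma run_subst_query:
  assumes "\<And>n. run B r n = Some (of_bool (n \<in> A))"
  shows "run B (subst_query r p) x = run A p x"
proof -
  have "run B (subst_query r p) = run A p"
    using assms by (induction p) (simp_all add: fun_eq_iff cong: Option.bind_cong)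
  then show ?thesis by simp
qed

lemma subst_query_Query [simp]: "subst_query Query p = p"
  by (induction p) auto

section \<open>Uniformly arithmetical functions\<close>

abbreviation jumps :: "nat \<Rightarrow> nat set \<Rightarrow> nat set" where "jumps k \<equiv> turing_jump ^^ k"

definition rc :: "nat \<Rightarrow> (nat set \<Rightarrow> nat \<Rightarrow> nat) \<Rightarrow> bool" where
  "rc k f \<longleftrightarrow> (\<exists>p. \<forall>A x. run (jumps k A) p x = Some (f A x))"

lemma rc_const [intro!]: "rc k (\<lambda>A x. c)"
  unfolding rc_def by (rule exI[of _ "const_prog c"]) simp

lemma rc_id [intro!]: "rc k (\<lambda>A x. x)"
  unfolding rc_def by (rule exI[of _ id_prog]) simp

lemma rc_comp:
  assumes "rc k f" "rc k g"
  shows "rc k (\<lambda>A x. f A (g A x))"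
proof -
  obtain p q where "\<And>A x. run (jumps k A) p x = Some (f A x)" "\<And>A x. run (jumps k A) q x = Some (g A x)"
    using assms unfolding rc_def by blast
  then show ?thesis unfolding rc_def by (intro exI[of _ "CompP p q"]) simp
qed

lemma rc_pair [intro!]:
  assumes "rc k f" "rc k g"
  shows "rc k (\<lambda>A x. pp (f A x) (g A x))"
proof -
  obtain p q where "\<And>A x. run (jumps k A) p x = Some (f A x)" "\<And>A x. run (jumps k A) q x = Some (g A x)"
    using assms unfolding rc_def by blast
  then show ?thesis unfolding rc_def by (intro exI[of _ "PairP p q"]) simp
qed

lemma rc_prog:
  assumes "\<And>A x. run (jumps k A) p x = Some (h A x)" "rc k f"
  shows "rc k (\<lambda>A x. h A (f A x))"
  using assms(1) by (intro rc_comp[OF _ assms(2)]) (auto simp: rc_def)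

lemma rc_Suc [intro!]: "rc k f \<Longrightarrow> rc k (\<lambda>A x. Suc (f A x))"
  by (rule rc_prog[of _ Succ]) auto

lemma rc_p1 [intro!]: "rc k f \<Longrightarrow> rc k (\<lambda>A x. p1 (f A x))"
  by (rule rc_prog[of _ LeftP]) auto

lemma rc_p2 [intro!]: "rc k f \<Longrightarrow> rc k (\<lambda>A x. p2 (f A x))"
  by (rule rc_prog[of _ RightP]) auto

lemma rc_query: "rc k f \<Longrightarrow> rc k (\<lambda>A x. of_bool (f A x \<in> jumps k A))"
  by (rule rc_prog[of _ Query]) auto

lemma rc_rec:
  assumes "rc k g" "rc k (\<lambda>A z. h A (p1 z) (p1 (p2 z)) (p2 (p2 z)))" "rc k c"
  shows "rc k (\<lambda>A x. rec_nat (g A x) (h A x) (c A x))"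
proof -
  obtain p q r where p: "\<And>A x. run (jumps k A) p x = Some (g A x)"
    and q: "\<And>A z. run (jumps k A) q z = Some (h A (p1 z) (p1 (p2 z)) (p2 (p2 z)))"
    and r: "\<And>A x. run (jumps k A) r x = Some (c A x)"
    using assms unfolding rc_def by blast
  have *: "rec_nat (Some (g A x)) (\<lambda>i r. Option.bind r (\<lambda>v. Some (h A x i v))) n =
      Some (rec_nat (g A x) (h A x) n)" for A x n
    by (induction n) auto
  have "run (jumps k A) (CompP (PrimRec p q) (PairP id_prog r)) x =
      Some (rec_nat (g A x) (h A x) (c A x))" for A x
    by (simp add: p q r *)
  then show ?thesis unfolding rc_def by blast
qed

lemma rc_Least:
  assumes "rc k (\<lambda>A z. of_bool (P A (p1 z) (p2 z)))" "\<And>A x. \<exists>n. P A x n"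
  shows "rc k (\<lambda>A x. LEAST n. P A x n)"
proof -
  \<comment> \<open>\<open>Mu\<close> searches for the value 0, so truth values are inverted first,
    by a recursion of length 0 or 1.\<close>
  have "rc k (\<lambda>A z. rec_nat 1 (\<lambda>i v. 0) (of_bool (P A (p1 z) (p2 z))))"
    by (rule rc_rec) (use assms in auto)
  then obtain p where p: "\<And>A z. run (jumps k A) p z = Some (rec_nat 1 (\<lambda>i v. 0) (of_bool (P A (p1 z) (p2 z))))"
    unfolding rc_def by blast
  have "run (jumps k A) p (pp x n) = Some 0 \<longleftrightarrow> P A x n" for A x n
    by (auto simp: p)
  moreover have "run (jumps k A) p z \<noteq> None" for A z by (simp add: p)
  ultimately have "run (jumps k A) (Mu p) x = Some (LEAST n. P A x n)" for A x
    using assms(2)[of A x] by simp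
  then show ?thesis unfolding rc_def by blast
qed

lemma rc_if:
  assumes "rc k (\<lambda>A x. of_bool (P A x))" "rc k f" "rc k g"
  shows "rc k (\<lambda>A x. if P A x then f A x else g A x)"
proof -
  have "rc k (\<lambda>A x. rec_nat (g A x) (\<lambda>i v. f A x) (of_bool (P A x)))"
    by (rule rc_rec[OF assms(3) _ assms(1)], rule rc_comp[OF assms(2)]) auto
  moreover have "rec_nat (g A x) (\<lambda>i v. f A x) (of_bool (P A x)) = (if P A x then f A x else g A x)" for A x
    by auto
  ultimately show ?thesis by simp
qed

lemma rc_zero:
  assumes "rc k f"
  shows "rc k (\<lambda>A x. of_bool (f A x = 0))"
proof -
  have "rc k (\<lambda>A x. rec_nat 1 (\<lambda>i v. 0) (f A x))"
    by (rule rc_rec) (use assms in auto)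
  moreover have "rec_nat (1::nat) (\<lambda>i v. 0) n = of_bool (n = 0)" for n :: nat
    by (cases n) auto
  ultimately show ?thesis by (simp del: One_nat_def)
qed

lemma rc_not:
  assumes "rc k (\<lambda>A x. of_bool (P A x))"
  shows "rc k (\<lambda>A x. of_bool (\<not> P A x))"
  using rc_zero[OF assms] by simp

lemma rc_conj:
  assumes "rc k (\<lambda>A x. of_bool (P A x))" "rc k (\<lambda>A x. of_bool (Q A x))"
  shows "rc k (\<lambda>A x. of_bool (P A x \<and> Q A x))"
proof -
  have "rc k (\<lambda>A x. if P A x then of_bool (Q A x) else 0)"
    using assms by (intro rc_if) auto
  moreover have "(if P A x then of_bool (Q A x) else 0) = (of_bool (P A x \<and> Q A x) :: nat)" for A x
    by auto
  ultimately show ?thesis by simp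
qed

lemma rc_pred:
  assumes "rc k f"
  shows "rc k (\<lambda>A x. f A x - 1)"
proof -
  have "rc k (\<lambda>A x. rec_nat 0 (\<lambda>i v. i) (f A x))"
    by (rule rc_rec) (use assms in auto)
  moreover have "rec_nat 0 (\<lambda>i v. i) n = n - 1" for n :: nat
    by (cases n) auto
  ultimately show ?thesis by simp
qed

lemma rc_diff:
  assumes "rc k f" "rc k g"
  shows "rc k (\<lambda>A x. f A x - g A x)"
proof -
  have "rc k (\<lambda>A x. rec_nat (f A x) (\<lambda>i v. v - 1) (g A x))"
    by (rule rc_rec) (use assms in \<open>auto intro: rc_pred simp del: One_nat_def\<close>)
  moreover have "rec_nat m (\<lambda>i v. v - 1) n = m - n" for m n :: nat
    by (induction n) auto
  ultimately show ?thesis by simp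
qed

lemma rc_add:
  assumes "rc k f" "rc k g"
  shows "rc k (\<lambda>A x. f A x + g A x)"
proof -
  have "rc k (\<lambda>A x. rec_nat (f A x) (\<lambda>i v. Suc v) (g A x))"
    by (rule rc_rec) (use assms in auto)
  moreover have "rec_nat m (\<lambda>i v. Suc v) n = m + n" for m n :: nat
    by (induction n) auto
  ultimately show ?thesis by simp
qed

lemma rc_mult:
  assumes "rc k f" "rc k g"
  shows "rc k (\<lambda>A x. f A x * g A x)"
proof -
  have "rc k (\<lambda>A x. rec_nat 0 (\<lambda>i v. v + f A x) (g A x))"
    by (rule rc_rec) (use assms in \<open>auto intro!: rc_add intro: rc_comp[of _ f]\<close>)
  moreover have "rec_nat 0 (\<lambda>i v. v + m) n = m * n" for m n :: nat
    by (induction n) auto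
  ultimately show ?thesis by simp
qed

lemma rc_power:
  assumes "rc k f" "rc k g"
  shows "rc k (\<lambda>A x. f A x ^ g A x)"
proof -
  have "rc k (\<lambda>A x. rec_nat 1 (\<lambda>i v. v * f A x) (g A x))"
    by (rule rc_rec) (use assms in \<open>auto intro!: rc_mult intro: rc_comp[of _ f]\<close>)
  moreover have "rec_nat 1 (\<lambda>i v. v * m) n = m ^ n" for m n :: nat
    by (induction n) auto
  ultimately show ?thesis by simp
qed

lemma rc_le:
  assumes "rc k f" "rc k g"
  shows "rc k (\<lambda>A x. of_bool (f A x \<le> g A x))"
  using rc_zero[OF rc_diff[OF assms]] by simp

lemma rc_eq:
  assumes "rc k f" "rc k g"
  shows "rc k (\<lambda>A x. of_bool (f A x = g A x))"
  using rc_conj[OF rc_le[OF assms] rc_le[OF assms(2,1)]] by (simp add: eq_iff)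

lemma rc_even:
  assumes "rc k f"
  shows "rc k (\<lambda>A x. of_bool (even (f A x)))"
proof -
  have "rc k (\<lambda>A x. rec_nat 1 (\<lambda>i v. 1 - v) (f A x))"
    by (rule rc_rec) (use assms in \<open>auto intro!: rc_diff simp del: One_nat_def\<close>)
  moreover have "rec_nat (1::nat) (\<lambda>i v. 1 - v) n = of_bool (even n)" for n :: nat
    by (induction n) auto
  ultimately show ?thesis by (simp del: One_nat_def)
qed

lemma rc_half:
  assumes "rc k f"
  shows "rc k (\<lambda>A x. f A x div 2)"
proof -
  have "rc k (\<lambda>A x. rec_nat 0 (\<lambda>i v. if even i then v else Suc v) (f A x))"
    by (rule rc_rec) (use assms in \<open>auto intro!: rc_if rc_even\<close>)
  moreover have "rec_nat 0 (\<lambda>i v. if even i then v else Suc v) n = n div 2" for n :: nat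
    by (induction n) auto
  ultimately show ?thesis by simp
qed

subsection \<open>Lists\<close>

definition tl_code :: "nat \<Rightarrow> nat" where "tl_code c = p2 (c - 1)"
definition drop_code :: "nat \<Rightarrow> nat \<Rightarrow> nat" where "drop_code c n = rec_nat c (\<lambda>i v. tl_code v) n"
definition nth_code :: "nat \<Rightarrow> nat \<Rightarrow> nat" where "nth_code c n = p1 (drop_code c n - 1)"
definition len_code :: "nat \<Rightarrow> nat" where "len_code c = (LEAST n. drop_code c n = 0)"

lemma prod_decode_0 [simp]: "prod_decode 0 = (0, 0)"
  using prod_encode_inverse[of "(0, 0)"] by (simp add: prod_encode_def)

lemma list_encode_tl: "tl_code (list_encode xs) = list_encode (tl xs)"
  by (cases xs) (auto simp: tl_code_def)

lemma list_encode_drop: "drop_code (list_encode xs) n = list_encode (drop n xs)"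
  by (induction n) (auto simp: drop_code_def list_encode_tl drop_Suc tl_drop)

lemma list_encode_eq_0 [simp]: "list_encode xs = 0 \<longleftrightarrow> xs = []"
  by (cases xs) auto

lemma nth_code [simp]: "n < length xs \<Longrightarrow> nth_code (list_encode xs) n = xs ! n"
  by (simp add: nth_code_def list_encode_drop Cons_nth_drop_Suc[symmetric])

lemma len_code [simp]: "len_code (list_encode xs) = length xs"
  unfolding len_code_def list_encode_drop by (auto intro!: Least_equality)

lemma rc_tl_code:
  assumes "rc k f" shows "rc k (\<lambda>A x. tl_code (f A x))"
  unfolding tl_code_def using assms by (auto intro: rc_pred simp del: One_nat_def)

lemma rc_drop_code:
  assumes "rc k f" "rc k g"
  shows "rc k (\<lambda>A x. drop_code (f A x) (g A x))"
  unfolding drop_code_def by (rule rc_rec) (use assms in \<open>auto intro!: rc_tl_code\<close>)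

lemma rc_nth_code:
  assumes "rc k f" "rc k g"
  shows "rc k (\<lambda>A x. nth_code (f A x) (g A x))"
  unfolding nth_code_def using assms by (auto intro!: rc_drop_code rc_pred simp del: One_nat_def)

lemma rc_len_code:
  assumes "rc k f" shows "rc k (\<lambda>A x. len_code (f A x))"
proof -
  have "\<exists>n. drop_code x n = 0" for x
    by (metis drop_all list_decode_inverse list_encode_drop list_encode.simps(1) order_refl)
  then have "rc k (\<lambda>A. len_code)"
    unfolding len_code_def by (intro rc_Least rc_zero rc_drop_code) auto
  then show ?thesis using assms by (rule rc_comp)
qed

text \<open>The list of the previous values is stored last value first.\<close>

lemma rc_course_of_values:
  assumes rec: "\<And>x n. f x n = h x n (\<lambda>m. if m < n then f x m else 0)"
    and rc: "rc k (\<lambda>A z. h (p1 z) (p1 (p2 z)) (\<lambda>m. if m < p1 (p2 z)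
          then nth_code (p2 (p2 z)) (p1 (p2 z) - Suc m) else 0))"
    and a: "rc k a" and b: "rc k b"
  shows "rc k (\<lambda>A x. f (a A x) (b A x))"
proof -
  \<comment> \<open>\<open>Suc (pp v c)\<close> is the code of the list with head \<open>v\<close>
    and tail coded by \<open>c\<close>.\<close>
  define F where "F x = rec_nat 0 (\<lambda>i v. Suc (pp (h x i (\<lambda>m. if m < i then nth_code v (i - Suc m) else 0)) v))" for x
  have F: "F x n = list_encode (map (f x) (rev [0..<n]))" for x n
  proof (induction n)
    case (Suc n)
    have "(\<lambda>m. if m < n then nth_code (F x n) (n - Suc m) else 0) = (\<lambda>m. if m < n then f x m else 0)"
      by (auto simp: Suc rev_map rev_nth fun_eq_iff)
    moreover have "F x (Suc n) =
        Suc (pp (h x n (\<lambda>m. if m < n then nth_code (F x n) (n - Suc m) else 0)) (F x n))"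
      unfolding F_def by simp
    ultimately have "F x (Suc n) = Suc (pp (f x n) (F x n))"
      using rec[of x n, symmetric] by simp
    then show ?case by (simp add: Suc)
  qed (simp add: F_def)
  have "rc k (\<lambda>A z. F (p1 z) (p2 z))" unfolding F_def
  proof (rule rc_rec)
    have "rc k (\<lambda>A z. pp (p1 (p1 z)) (p2 z))"
      by (intro rc_pair rc_p1 rc_p2 rc_id)
    from rc_comp[OF rc this]
    show "rc k (\<lambda>A z. Suc (pp (h (p1 (p1 z)) (p1 (p2 z)) (\<lambda>m. if m < p1 (p2 z)
        then nth_code (p2 (p2 z)) (p1 (p2 z) - Suc m) else 0)) (p2 (p2 z))))"
      by (intro rc_Suc rc_pair rc_p2 rc_id) (simp cong del: if_weak_cong)
  qed (auto intro: rc_const rc_p2 rc_id)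
  from rc_comp[OF this, where g="\<lambda>A x. pp (a A x) (Suc (b A x))"] rc_pair[OF a rc_Suc[OF b]]
  have "rc k (\<lambda>A x. F (a A x) (Suc (b A x)))" by simp
  then have "rc k (\<lambda>A x. p1 (F (a A x) (Suc (b A x)) - 1))"
    by (rule rc_p1[OF rc_pred])
  moreover have "p1 (F x (Suc n) - 1) = f x n" for x n
    by (simp add: F)
  ultimately show ?thesis by simp
qed


section \<open>Program transformations on codes\<close>

definition cf :: "(nat \<Rightarrow> nat) \<Rightarrow> bool" where "cf f \<longleftrightarrow> (\<exists>p. \<forall>A x. run A p x = Some (f x))"

lemma cf_rc0: "cf f \<longleftrightarrow> rc 0 (\<lambda>A. f)"
  by (simp add: cf_def rc_def)

lemma rc_cf: "cf f \<Longrightarrow> rc k g \<Longrightarrow> rc k (\<lambda>A x. f (g A x))"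
  unfolding cf_def by (auto intro: rc_prog[where h="\<lambda>A. f"])

definition comp_code :: "nat \<Rightarrow> nat \<Rightarrow> nat" where "comp_code a b = pp 6 (pp a b)"
definition pair_code :: "nat \<Rightarrow> nat \<Rightarrow> nat" where "pair_code a b = pp 5 (pp a b)"
definition const_code :: "nat \<Rightarrow> nat" where "const_code n = prog_code (const_prog n)"
definition fix_code :: "nat \<Rightarrow> nat \<Rightarrow> nat" where
  "fix_code c x = comp_code c (pair_code (const_code x) (prog_code id_prog))"

lemma prog_code_eq_codes:
  "comp_code (prog_code p) (prog_code q) = prog_code (CompP p q)"
  "pair_code (prog_code p) (prog_code q) = prog_code (PairP p q)"
  "const_code n = prog_code (const_prog n)"
  "fix_code (prog_code p) x = prog_code (fix_prog p x)"
  by (auto simp: comp_code_def pair_code_def const_code_def fix_code_def fix_prog_def)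

lemma comp_code_eq_prog_codeD:
  "comp_code a b = prog_code p \<Longrightarrow> \<exists>q r. p = CompP q r \<and> a = prog_code q \<and> b = prog_code r"
  by (cases p) (auto simp: comp_code_def prod_encode_eq)

lemma pair_code_eq_prog_codeD:
  "pair_code a b = prog_code p \<Longrightarrow> \<exists>q r. p = PairP q r \<and> a = prog_code q \<and> b = prog_code r"
  by (cases p) (auto simp: pair_code_def prod_encode_eq)

lemma rc_comp_code: "rc k f \<Longrightarrow> rc k g \<Longrightarrow> rc k (\<lambda>A x. comp_code (f A x) (g A x))"
  unfolding comp_code_def by (intro rc_pair rc_const)

lemma rc_pair_code: "rc k f \<Longrightarrow> rc k g \<Longrightarrow> rc k (\<lambda>A x. pair_code (f A x) (g A x))"
  unfolding pair_code_def by (intro rc_pair rc_const)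

lemma rc_const_code: 
  assumes "rc k f"
  shows "rc k (\<lambda>A x. const_code (f A x))"
proof -
  have "rc k (\<lambda>A x. rec_nat (prog_code Zero) (\<lambda>i v. comp_code (prog_code Succ) v) (f A x))"
    by (rule rc_rec) (use assms in \<open>auto intro: rc_comp_code\<close>)
  moreover have "rec_nat (prog_code Zero) (\<lambda>i v. comp_code (prog_code Succ) v) n = const_code n" for n
    by (induction n) (auto simp: const_code_def comp_code_def)
  ultimately show ?thesis by simp
qed

lemma rc_fix_code: "rc k f \<Longrightarrow> rc k g \<Longrightarrow> rc k (\<lambda>A x. fix_code (f A x) (g A x))"
  unfolding fix_code_def by (intro rc_comp_code rc_pair_code rc_const_code rc_const)

lemma less_prod_encode: "0 < a \<Longrightarrow> b < pp a b"
  by (cases a) (auto simp: prod_encode_def triangle_def algebra_simps intro!: le_imp_less_Suc div_le_mono)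

lemma p2_less: "p1 e \<noteq> 0 \<Longrightarrow> p2 e < e"
  using less_prod_encode[of "p1 e" "p2 e"] by simp

lemma p1_le: "p1 e \<le> e" and p2_le: "p2 e \<le> e"
  using le_prod_encode_1[of "p1 e" "p2 e"] le_prod_encode_2[of "p2 e" "p1 e"] by auto

text \<open>The tags are those of \<open>prog_code\<close>: \<open>pp 4 0\<close> is
  \<open>Query\<close>, 5 to 7 are the constructors with two subprograms, 8 is \<open>Mu\<close>.
  Numbers that code no program are also treated, to have a total computable function.\<close>

function subst_code :: "nat \<Rightarrow> nat \<Rightarrow> nat" where
  "subst_code r e =
     (if e = pp 4 0 then r
      else if 5 \<le> p1 e \<and> p1 e \<le> 7 then pp (p1 e) (pp (subst_code r (p1 (p2 e))) (subst_code r (p2 (p2 e))))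
      else if p1 e = 8 then pp 8 (subst_code r (p2 e))
      else e)"
  by auto
termination
  by (relation "measure snd") (auto intro: le_less_trans[OF p1_le p2_less] le_less_trans[OF p2_le p2_less] p2_less)

declare subst_code.simps [simp del]

lemma subst_code: "subst_code (prog_code r) (prog_code p) = prog_code (subst_query r p)"
  by (induction p) (auto simp: subst_code.simps[of _ "pp _ _"] prod_encode_eq)

text \<open>Numbers that code no program are outside every jump; a reduction between jumps must
  therefore not send them to codes.\<close>

lemma subst_code_eq_prog_codeD:
  "subst_code (prog_code r) e = prog_code p \<Longrightarrow> e \<in> range prog_code"
proof (induction e arbitrary: p rule: less_induct)
  case (less e)
  show ?case
  proof (cases "e = pp 4 0")
    case True
    then have "e = prog_code Query" by simp
    then show ?thesis by blast
  next
    case ne: False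
    show ?thesis
    proof (cases "5 \<le> p1 e \<and> p1 e \<le> 7")
      case True
      with ne less.prems have eq: "pp (p1 e) (pp (subst_code (prog_code r) (p1 (p2 e)))
          (subst_code (prog_code r) (p2 (p2 e)))) = prog_code p"
        by (simp add: subst_code.simps[of _ e])
      have lt: "p1 (p2 e) < e" "p2 (p2 e) < e"
        using True by (auto intro: le_less_trans[OF p1_le p2_less] le_less_trans[OF p2_le p2_less])
      obtain q q' where "subst_code (prog_code r) (p1 (p2 e)) = prog_code q"
        "subst_code (prog_code r) (p2 (p2 e)) = prog_code q'"
        using eq True by (cases p) (auto simp: prod_encode_eq)
      with less.IH lt obtain s s' where "p1 (p2 e) = prog_code s" "p2 (p2 e) = prog_code s'"
        by blast
      then have e: "e = pp (p1 e) (pp (prog_code s) (prog_code s'))"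
        by (metis pp_p1_p2)
      consider "p1 e = 5" | "p1 e = 6" | "p1 e = 7" using True by linarith
      then show ?thesis
        using e by cases (metis prog_code.simps(6) rangeI, metis prog_code.simps(7) rangeI,
            metis prog_code.simps(8) rangeI)
    next
      case F: False
      show ?thesis
      proof (cases "p1 e = 8")
        case True
        with ne F less.prems have eq: "pp 8 (subst_code (prog_code r) (p2 e)) = prog_code p"
          by (simp add: subst_code.simps[of _ e])
        obtain q where "subst_code (prog_code r) (p2 e) = prog_code q"
          using eq by (cases p) (auto simp: prod_encode_eq)
        with less.IH[of "p2 e"] p2_less[of e] True obtain s where "p2 e = prog_code s"
          by auto
        then have "e = prog_code (Mu s)" using True by (metis pp_p1_p2 prog_code.simps(9))
        then show ?thesis by blast
      next
        case False
        with ne F less.prems show ?thesis by (auto simp add: subst_code.simps[of _ e])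
      qed
    qed
  qed
qed

declare prog_code.simps [simp del]

lemma rc_subst_code:
  assumes "rc k a" "rc k b"
  shows "rc k (\<lambda>A x. subst_code (a A x) (b A x))"
proof -
  define h where "h r e v = (if e = pp 4 0 then r
      else if 5 \<le> p1 e \<and> p1 e \<le> 7 then pp (p1 e) (pp (v (p1 (p2 e))) (v (p2 (p2 e))))
      else if p1 e = 8 then pp 8 (v (p2 e))
      else e)" for r e and v :: "nat \<Rightarrow> nat"
  have "subst_code r e = h r e (\<lambda>m. if m < e then subst_code r m else 0)" for r e
    by (subst subst_code.simps)
      (auto simp: h_def p2_less le_less_trans[OF p1_le p2_less] le_less_trans[OF p2_le p2_less])
  moreover have less: "rc k (\<lambda>A z. of_bool (f A z < g A z))" if "rc k f" "rc k g" for f g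
    using rc_le[OF rc_Suc[OF that(1)] that(2)] by (simp add: Suc_le_eq)
  have "rc k (\<lambda>A z. h (p1 z) (p1 (p2 z)) (\<lambda>m. if m < p1 (p2 z)
          then nth_code (p2 (p2 z)) (p1 (p2 z) - Suc m) else 0))"
    unfolding h_def
    by (intro rc_if rc_eq rc_conj rc_le less rc_pair rc_p1 rc_p2 rc_id rc_const rc_nth_code rc_diff rc_Suc)
  ultimately show ?thesis using assms by (rule rc_course_of_values)
qed

text \<open>Replacing each query by a run of \<open>r\<close> simulates oracle \<open>A\<close> with
  oracle \<open>B\<close>. The jump runs a program on its own code, which changes under the
  replacement, so the old input \<open>e\<close> is hard-wired by
  \<open>const_code e\<close>.\<close>

lemma jump_reduction:
  assumes "\<And>n. run B r n = Some (of_bool (n \<in> A))"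
  shows "e \<in> turing_jump A \<longleftrightarrow>
    comp_code (subst_code (prog_code r) e) (const_code e) \<in> turing_jump B"
proof (cases "e \<in> range prog_code")
  case True
  then obtain p where e: "e = prog_code p" by blast
  have "comp_code (subst_code (prog_code r) e) (const_code e) = prog_code (CompP (subst_query r p) (const_prog e))"
    unfolding e by (simp add: subst_code prog_code_eq_codes)
  then show ?thesis using run_subst_query[OF assms] by (simp add: e)
next
  case False
  then have "comp_code (subst_code (prog_code r) e) (const_code e) \<notin> range prog_code"
    by (metis (no_types, lifting) comp_code_eq_prog_codeD rangeE subst_code_eq_prog_codeD)
  with False show ?thesis by (auto simp: turing_jump_iff)
qed

text \<open>An equality test that diverges on failure; it expresses
  \<open>phi A e x = Some y\<close> as a single membership in the jump of \<open>A\<close>.\<close>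

definition halt_eq_prog :: prog where
  "halt_eq_prog = (SOME p. \<forall>A z. run A p z = (if p1 z = p2 z then Some 0 else None))"

lemma run_halt_eq_prog: "run A halt_eq_prog z = (if p1 z = p2 z then Some 0 else None)"
proof -
  have "rc 0 (\<lambda>A z. of_bool (\<not> p1 (p1 z) = p2 (p1 z)))"
    by (intro rc_not rc_eq rc_p1 rc_p2 rc_id)
  then obtain p where "\<And>A z. run A p z = Some (of_bool (p1 (p1 z) \<noteq> p2 (p1 z)))"
    unfolding rc_def by auto
  \<comment> \<open>\<open>p\<close> ignores the search variable, so \<open>Mu p\<close> stops at 0
    or never.\<close>
  then have "\<forall>A z. run A (Mu p) z = (if p1 z = p2 z then Some 0 else None)" by auto
  then have "\<forall>A z. run A halt_eq_prog z = (if p1 z = p2 z then Some 0 else None)"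
    unfolding halt_eq_prog_def by (rule someI)
  then show ?thesis by blast
qed

definition halt_eq_code :: "nat \<Rightarrow> nat \<Rightarrow> nat \<Rightarrow> nat" where
  "halt_eq_code e x y = comp_code (prog_code halt_eq_prog)
     (pair_code (comp_code e (const_code x)) (const_code y))"

lemma halt_eq_code: "halt_eq_code e x y \<in> turing_jump A \<longleftrightarrow> phi A e x = Some y"
proof -
  show ?thesis
  proof (cases "e \<in> range prog_code")
    case True
    then obtain p where e: "e = prog_code p" by blast
    have "halt_eq_code e x y = prog_code (CompP halt_eq_prog (PairP (CompP p (const_prog x)) (const_prog y)))"
      by (simp add: halt_eq_code_def e prog_code_eq_codes)
    then show ?thesis by (cases "run A p x") (auto simp: e run_halt_eq_prog)
  next
    case False
    then have "halt_eq_code e x y \<notin> range prog_code" unfolding halt_eq_code_def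
      by (auto dest!: sym[THEN comp_code_eq_prog_codeD] sym[THEN pair_code_eq_prog_codeD]
          comp_code_eq_prog_codeD pair_code_eq_prog_codeD)
    with False show ?thesis by (auto simp: turing_jump_iff phi_def)
  qed
qed

lemma rc_halt_eq_code: "rc k e \<Longrightarrow> rc k f \<Longrightarrow> rc k g \<Longrightarrow> rc k (\<lambda>A x. halt_eq_code (e A x) (f A x) (g A x))"
  unfolding halt_eq_code_def by (intro rc_comp_code rc_pair_code rc_const_code rc_const)

text \<open>Every set is many-one reducible to its own jump by a function that does not depend on
  the set; answering each query through this reduction raises the oracle.\<close>

lemma rc_raise: 
  assumes "rc k f"
  shows "rc (Suc k) f"
proof -
  have "cf (\<lambda>n. halt_eq_code (prog_code Query) n 1)"
    unfolding cf_rc0 by (intro rc_halt_eq_code rc_const rc_id)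
  then obtain p where p: "\<And>A x. run A p x = Some (halt_eq_code (prog_code Query) x 1)"
    unfolding cf_def by blast
  obtain q where q: "\<And>A x. run (jumps k A) q x = Some (f A x)"
    using assms unfolding rc_def by blast
  have "run (jumps (Suc k) A) (subst_query (CompP Query p) q) x = run (jumps k A) q x" for A x
    by (rule run_subst_query) (simp add: p halt_eq_code)
  then show ?thesis unfolding rc_def q by blast
qed

lemma rc_mono: "rc k f \<Longrightarrow> k \<le> l \<Longrightarrow> rc l f"
  by (rotate_tac 1, induction l rule: dec_induct) (auto intro: rc_raise)

text \<open>\<open>fix_prog p x\<close> decides \<open>{q. Q A x q}\<close> from
  \<open>jumps k A\<close>, and its code depends computably on \<open>x\<close>. Hence
  \<open>jump_reduction\<close> handles all parameters at once and costs exactly one more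
  jump.\<close>

lemma rc_jump:
  assumes "rc k (\<lambda>A z. of_bool (Q A (p1 z) (p2 z)))" "rc (Suc k) f"
  shows "rc (Suc k) (\<lambda>A x. of_bool (f A x \<in> turing_jump {q. Q A x q}))"
proof -
  obtain p where p: "\<And>A z. run (jumps k A) p z = Some (of_bool (Q A (p1 z) (p2 z)))"
    using assms unfolding rc_def by blast
  have "f A x \<in> turing_jump {q. Q A x q} \<longleftrightarrow>
    comp_code (subst_code (fix_code (prog_code p) x) (f A x)) (const_code (f A x)) \<in> jumps (Suc k) A" for A x
    by (simp add: jump_reduction[of "jumps k A" "fix_prog p x"] p prog_code_eq_codes(4))
  moreover have "rc (Suc k) (\<lambda>A x. of_bool (comp_code (subst_code (fix_code (prog_code p) x) (f A x)) (const_code (f A x)) \<in> jumps (Suc k) A))"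
    by (intro rc_query rc_comp_code rc_subst_code rc_fix_code rc_const_code rc_const rc_id assms)
  ultimately show ?thesis by simp
qed

text \<open>Kleene's self-application: \<open>q\<close> evaluates \<open>F\<close> at the code that
  arises when its first argument is applied to itself, and is then applied to its own code.\<close>

theorem recursion_theorem:
  assumes "cf F"
  obtains p where "\<And>A x. run A p x = Some (F (pp (prog_code p) x))"
proof -
  have "rc 0 (\<lambda>A z. F (pp (fix_code (p1 z) (p1 z)) (p2 z)))"
    by (intro rc_cf[OF assms] rc_pair rc_fix_code rc_p1 rc_p2 rc_id)
  then obtain q where "\<And>A z. run A q z = Some (F (pp (fix_code (p1 z) (p1 z)) (p2 z)))"
    unfolding rc_def by auto
  then have "run A (fix_prog q (prog_code q)) x = Some (F (pp (prog_code (fix_prog q (prog_code q))) x))" for A x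
    by (simp add: prog_code_eq_codes)
  then show ?thesis using that by blast
qed

section \<open>Closure properties\<close>

definition ar :: "(nat set \<Rightarrow> nat \<Rightarrow> nat) \<Rightarrow> bool" where "ar f \<longleftrightarrow> (\<exists>k. rc k f)"

abbreviation arp :: "(nat set \<Rightarrow> nat \<Rightarrow> bool) \<Rightarrow> bool" where "arp P \<equiv> ar (\<lambda>A x. of_bool (P A x))"

lemma ar_lift1: "ar f \<Longrightarrow> (\<And>k. rc k f \<Longrightarrow> rc k h) \<Longrightarrow> ar h"
  unfolding ar_def by blast

lemma ar_lift2:
  assumes "ar f" "ar g" "\<And>k. rc k f \<Longrightarrow> rc k g \<Longrightarrow> rc k h"
  shows "ar h"
proof -
  obtain k l where "rc k f" "rc l g" using assms unfolding ar_def by blast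
  then have "rc (max k l) h" by (intro assms) (auto intro: rc_mono)
  then show ?thesis unfolding ar_def by blast
qed

lemma ar_lift3:
  assumes "ar f" "ar g" "ar g'" "\<And>k. rc k f \<Longrightarrow> rc k g \<Longrightarrow> rc k g' \<Longrightarrow> rc k h"
  shows "ar h"
proof -
  obtain k l m where "rc k f" "rc l g" "rc m g'" using assms unfolding ar_def by blast
  then have "rc (max k (max l m)) h" by (intro assms) (auto elim: rc_mono)
  then show ?thesis unfolding ar_def by blast
qed

lemma ar_const: "ar (\<lambda>A x. c)" unfolding ar_def by auto
lemma ar_id: "ar (\<lambda>A x. x)" unfolding ar_def by auto
lemma ar_comp: "ar f \<Longrightarrow> ar g \<Longrightarrow> ar (\<lambda>A x. f A (g A x))"
  by (erule (1) ar_lift2, rule rc_comp)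
lemma ar_pair: "ar f \<Longrightarrow> ar g \<Longrightarrow> ar (\<lambda>A x. pp (f A x) (g A x))"
  by (erule (1) ar_lift2, rule rc_pair)
lemma ar_Suc: "ar f \<Longrightarrow> ar (\<lambda>A x. Suc (f A x))"
  by (erule ar_lift1, rule rc_Suc)
lemma ar_p1: "ar f \<Longrightarrow> ar (\<lambda>A x. p1 (f A x))"
  by (erule ar_lift1, rule rc_p1)
lemma ar_p2: "ar f \<Longrightarrow> ar (\<lambda>A x. p2 (f A x))"
  by (erule ar_lift1, rule rc_p2)
lemma ar_if: "arp P \<Longrightarrow> ar f \<Longrightarrow> ar g \<Longrightarrow> ar (\<lambda>A x. if P A x then f A x else g A x)"
  by (erule (2) ar_lift3, rule rc_if)
lemma ar_diff: "ar f \<Longrightarrow> ar g \<Longrightarrow> ar (\<lambda>A x. f A x - g A x)"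
  by (erule (1) ar_lift2, rule rc_diff)
lemma ar_add: "ar f \<Longrightarrow> ar g \<Longrightarrow> ar (\<lambda>A x. f A x + g A x)"
  by (erule (1) ar_lift2, rule rc_add)
lemma ar_mult: "ar f \<Longrightarrow> ar g \<Longrightarrow> ar (\<lambda>A x. f A x * g A x)"
  by (erule (1) ar_lift2, rule rc_mult)
lemma ar_power: "ar f \<Longrightarrow> ar g \<Longrightarrow> ar (\<lambda>A x. f A x ^ g A x)"
  by (erule (1) ar_lift2, rule rc_power)
lemma ar_half: "ar f \<Longrightarrow> ar (\<lambda>A x. f A x div 2)"
  by (erule ar_lift1, rule rc_half)
lemma ar_nth_code: "ar f \<Longrightarrow> ar g \<Longrightarrow> ar (\<lambda>A x. nth_code (f A x) (g A x))"
  by (erule (1) ar_lift2, rule rc_nth_code)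
lemma ar_len_code: "ar f \<Longrightarrow> ar (\<lambda>A x. len_code (f A x))"
  by (erule ar_lift1, rule rc_len_code)
lemma ar_comp_code: "ar f \<Longrightarrow> ar g \<Longrightarrow> ar (\<lambda>A x. comp_code (f A x) (g A x))"
  by (erule (1) ar_lift2, rule rc_comp_code)
lemma ar_const_code: "ar f \<Longrightarrow> ar (\<lambda>A x. const_code (f A x))"
  by (erule ar_lift1, rule rc_const_code)
lemma ar_fix_code: "ar f \<Longrightarrow> ar g \<Longrightarrow> ar (\<lambda>A x. fix_code (f A x) (g A x))"
  by (erule (1) ar_lift2, rule rc_fix_code)
lemma ar_subst_code: "ar f \<Longrightarrow> ar g \<Longrightarrow> ar (\<lambda>A x. subst_code (f A x) (g A x))"
  by (erule (1) ar_lift2, rule rc_subst_code)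
lemma ar_halt_eq_code: "ar f \<Longrightarrow> ar g \<Longrightarrow> ar g' \<Longrightarrow> ar (\<lambda>A x. halt_eq_code (f A x) (g A x) (g' A x))"
  by (erule (2) ar_lift3, rule rc_halt_eq_code)
lemma arp_not: "arp P \<Longrightarrow> arp (\<lambda>A x. \<not> P A x)"
  by (erule ar_lift1, rule rc_not)
lemma arp_conj: "arp P \<Longrightarrow> arp Q \<Longrightarrow> arp (\<lambda>A x. P A x \<and> Q A x)"
  by (erule (1) ar_lift2, rule rc_conj)
lemma arp_le: "ar f \<Longrightarrow> ar g \<Longrightarrow> arp (\<lambda>A x. f A x \<le> g A x)"
  by (erule (1) ar_lift2, rule rc_le)
lemma arp_eq: "ar f \<Longrightarrow> ar g \<Longrightarrow> arp (\<lambda>A x. f A x = g A x)"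
  by (erule (1) ar_lift2, rule rc_eq)
lemma arp_even: "ar f \<Longrightarrow> arp (\<lambda>A x. even (f A x))"
  by (erule ar_lift1, rule rc_even)
lemma ar_rec: "ar g \<Longrightarrow> ar (\<lambda>A z. h A (p1 z) (p1 (p2 z)) (p2 (p2 z))) \<Longrightarrow> ar c \<Longrightarrow>
    ar (\<lambda>A x. rec_nat (g A x) (h A x) (c A x))"
  by (erule (2) ar_lift3, rule rc_rec)

lemma ar_cf: "cf f \<Longrightarrow> ar g \<Longrightarrow> ar (\<lambda>A x. f (g A x))"
  by (auto simp: ar_def intro: rc_cf)

lemma arp_disj:
  assumes "arp P" "arp Q" shows "arp (\<lambda>A x. P A x \<or> Q A x)"
  using arp_not[OF arp_conj[OF arp_not[OF assms(1)] arp_not[OF assms(2)]]] by simp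

lemma arp_imp:
  assumes "arp P" "arp Q" shows "arp (\<lambda>A x. P A x \<longrightarrow> Q A x)"
  using arp_disj[OF arp_not[OF assms(1)] assms(2)] by simp

lemma arp_iff:
  assumes "arp P" "arp Q" shows "arp (\<lambda>A x. P A x \<longleftrightarrow> Q A x)"
  using arp_conj[OF arp_imp[OF assms] arp_imp[OF assms(2,1)]] by (simp only: iff_conv_conj_imp[symmetric])

lemma arp_less:
  assumes "ar f" "ar g" shows "arp (\<lambda>A x. f A x < g A x)"
  using arp_le[OF ar_Suc[OF assms(1)] assms(2)] by (simp add: Suc_le_eq)

lemma arp_if:
  assumes "arp P" "arp Q" "arp R" shows "arp (\<lambda>A x. if P A x then Q A x else R A x)"
  using arp_conj[OF arp_imp[OF assms(1,2)] arp_imp[OF arp_not[OF assms(1)] assms(3)]]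
  by (simp only: if_bool_eq_conj[symmetric])

lemma arp_mem: 
  assumes "ar f"
  shows "arp (\<lambda>A x. f A x \<in> A)"
proof -
  have "rc 0 (\<lambda>A x. of_bool (x \<in> A))" using rc_query[of 0 "\<lambda>A x. x"] by auto
  then have "arp (\<lambda>A x. x \<in> A)" unfolding ar_def by blast
  then show ?thesis using assms by (rule ar_comp)
qed

lemma arp_jump:
  assumes "arp (\<lambda>A z. Q A (p1 z) (p2 z))" "ar f"
  shows "arp (\<lambda>A x. f A x \<in> turing_jump {q. Q A x q})"
proof -
  obtain k l where "rc k (\<lambda>A z. of_bool (Q A (p1 z) (p2 z)))" "rc l f"
    using assms unfolding ar_def by blast
  then have "rc (Suc (max k l)) (\<lambda>A x. of_bool (f A x \<in> turing_jump {q. Q A x q}))"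
    by (intro rc_jump) (auto elim: rc_mono)
  then show ?thesis unfolding ar_def by blast
qed

lemma arp_phi:
  assumes "arp (\<lambda>A z. Q A (p1 z) (p2 z))" "ar e" "ar f" "ar g"
  shows "arp (\<lambda>A x. phi {q. Q A x q} (e A x) (f A x) = Some (g A x))"
  unfolding halt_eq_code[symmetric] by (intro arp_jump ar_halt_eq_code assms)

text \<open>A single program that searches its oracle for an element halts iff the oracle is
  nonempty, so a quantifier is one halting question about \<open>{q. P A x q}\<close>.\<close>

lemma arp_ex:
  assumes "arp (\<lambda>A z. P A (p1 z) (p2 z))"
  shows "arp (\<lambda>A x. \<exists>n. P A x n)"
proof -
  have "rc 0 (\<lambda>A z. of_bool (\<not> p2 z \<in> A))"
    using rc_not[OF rc_query[OF rc_p2[OF rc_id], of 0]] by simp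
  then obtain p where "\<And>A z. run A p z = Some (of_bool (p2 z \<notin> A))"
    unfolding rc_def by auto
  then have "prog_code (Mu p) \<in> turing_jump A \<longleftrightarrow> (\<exists>n. n \<in> A)" for A
    by auto
  then have "(\<exists>n. P A x n) \<longleftrightarrow> prog_code (Mu p) \<in> turing_jump {q. P A x q}" for A x by auto
  then show ?thesis using arp_jump[OF assms ar_const, of "prog_code (Mu p)"] by simp
qed

lemma arp_all:
  assumes "arp (\<lambda>A z. P A (p1 z) (p2 z))"
  shows "arp (\<lambda>A x. \<forall>n. P A x n)"
proof -
  have "arp (\<lambda>A x. \<exists>n. \<not> P A x n)" using arp_not[OF assms] by (rule arp_ex)
  from arp_not[OF this] show ?thesis by simp
qed

lemma ar_Least:
  assumes "arp (\<lambda>A z. P A (p1 z) (p2 z))"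
  shows "ar (\<lambda>A x. if \<exists>n. P A x n then LEAST n. P A x n else 0)"
proof -
  have "arp (\<lambda>A z. \<exists>m. P A (p1 z) m)"
    using ar_comp[OF arp_ex[OF assms] ar_p1[OF ar_id]] by simp
  from arp_imp[OF this assms] obtain k
    where "rc k (\<lambda>A z. of_bool ((\<exists>m. P A (p1 z) m) \<longrightarrow> P A (p1 z) (p2 z)))"
    unfolding ar_def by blast
  \<comment> \<open>The implication makes the search total: without a witness every number qualifies
    and the result is 0.\<close>
  then have "rc k (\<lambda>A x. LEAST n. (\<exists>m. P A x m) \<longrightarrow> P A x n)"
    by (rule rc_Least) blast
  moreover have "(LEAST n. (\<exists>m. P A x m) \<longrightarrow> P A x n) = (if \<exists>n. P A x n then LEAST n. P A x n else 0)" for A x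
    by (auto intro: Least_equality)
  ultimately show ?thesis unfolding ar_def by auto
qed

lemma ar_card:
  assumes "arp (\<lambda>A z. P A (p1 z) (p2 z))" "ar f"
  shows "ar (\<lambda>A x. card {q. q < f A x \<and> P A x q})"
proof -
  have *: "arp (\<lambda>A z. P A (p1 z) (p1 (p2 z)))"
    using ar_comp[OF assms(1) ar_pair[OF ar_p1[OF ar_id] ar_p1[OF ar_p2[OF ar_id]]]] by simp
  have "ar (\<lambda>A x. rec_nat 0 (\<lambda>i v. if P A x i then Suc v else v) (f A x))"
    by (intro ar_rec ar_if ar_Suc ar_p2 ar_id ar_const assms *)
  moreover have "rec_nat 0 (\<lambda>i v. if P A x i then Suc v else v) n = card {q. q < n \<and> P A x q}" for A x n
  proof (induction n)
    case (Suc n)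
    have "{q. q < Suc n \<and> P A x q} = (if P A x n then insert n {q. q < n \<and> P A x q} else {q. q < n \<and> P A x q})"
      by (auto simp: less_Suc_eq)
    then show ?case using Suc by simp
  qed simp
  ultimately show ?thesis by simp
qed

lemmas ar_intros = ar_id ar_pair ar_Suc ar_p1 ar_p2 ar_if ar_diff ar_add ar_mult ar_power ar_half
  ar_nth_code ar_len_code ar_comp_code ar_const_code ar_fix_code ar_subst_code ar_halt_eq_code
  arp_not arp_conj arp_disj arp_imp arp_iff arp_if arp_le arp_less arp_eq arp_even arp_ex arp_all
  arp_jump arp_phi ar_card ar_const

text \<open>The curried form for families of sets: \<open>Q A x\<close> is the set with index
  \<open>x\<close>, to which operations on sets such as \<open>Next\<close> are applied.\<close>

definition ar2 :: "(nat set \<Rightarrow> nat \<Rightarrow> nat \<Rightarrow> bool) \<Rightarrow> bool" where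
  "ar2 Q \<longleftrightarrow> arp (\<lambda>A z. Q A (p1 z) (p2 z))"

lemma ar2_app:
  assumes "ar2 Q" "ar f" "ar g" shows "arp (\<lambda>A x. Q A (f A x) (g A x))"
  using ar_comp[OF assms(1)[unfolded ar2_def] ar_pair[OF assms(2,3)]] by simp

text \<open>One additional jump turns decidability from \<open>jumps k A\<close> into a many-one
  reduction.\<close>

lemma ar_normal_form:
  assumes "arp P"
  obtains c k where "cf c" "\<And>A x. P A x \<longleftrightarrow> c x \<in> jumps k A"
proof -
  obtain k p where "\<And>A x. run (jumps k A) p x = Some (of_bool (P A x))"
    using assms unfolding ar_def rc_def by blast
  then have "P A x \<longleftrightarrow> halt_eq_code (prog_code p) x 1 \<in> jumps (Suc k) A" for A x
    by (simp add: halt_eq_code)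
  moreover have "cf (\<lambda>x. halt_eq_code (prog_code p) x 1)"
    unfolding cf_rc0 by (intro rc_halt_eq_code rc_const rc_id)
  ultimately show ?thesis using that by blast
qed


section \<open>Quantifier normal form\<close>

lemma run_Mu_eq_Some:
  "run A (Mu p) x = Some n \<longleftrightarrow>
     run A p (pp x n) = Some 0 \<and> (\<forall>m<n. \<exists>v. run A p (pp x m) = Some (Suc v))" (is "?L \<longleftrightarrow> ?R")
proof
  assume L: ?L
  then obtain k where k: "run A p (pp x k) = Some 0" "\<forall>m<k. run A p (pp x m) \<noteq> None"
    and n: "n = (LEAST n. run A p (pp x n) = Some 0)"
    by (auto split: if_splits)
  have 0: "run A p (pp x n) = Some 0" and "n \<le> k"
    unfolding n using k(1) by (auto intro: LeastI Least_le)
  have "\<exists>v. run A p (pp x m) = Some (Suc v)" if "m < n" for m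
  proof -
    have "run A p (pp x m) \<noteq> Some 0" using that not_less_Least n by blast
    moreover have "run A p (pp x m) \<noteq> None" using that k(2) \<open>n \<le> k\<close> by simp
    ultimately show ?thesis by (metis not0_implies_Suc option.exhaust)
  qed
  with 0 show ?R by blast
next
  assume R: ?R
  then have "(LEAST n. run A p (pp x n) = Some 0) = n"
    by (intro Least_equality) (auto, metis leI nat.distinct(1) option.inject)
  moreover have "\<forall>m<n. run A p (pp x m) \<noteq> None" using R by fastforce
  ultimately show ?L using R by auto
qed

declare run.simps(9) [simp del]

text \<open>The program answering the queries may diverge, so it acts as a partial oracle; extending
  a partial oracle preserves all halting computations.\<close>

lemma subst_query_mono:
  assumes "\<And>n v. run B r n = Some v \<Longrightarrow> run B' r' n = Some v"
  shows "run B (subst_query r p) x = Some y \<Longrightarrow> run B' (subst_query r' p) x = Some y"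
proof (induction p arbitrary: x y)
  case (PrimRec p q)
  have "rec_nat (run B (subst_query r p) z) (\<lambda>i r'. Option.bind r' (\<lambda>v. run B (subst_query r q) (pp z (pp i v)))) n = Some v \<Longrightarrow>
    rec_nat (run B' (subst_query r' p) z) (\<lambda>i r. Option.bind r (\<lambda>v. run B' (subst_query r' q) (pp z (pp i v)))) n = Some v" for z n v
    by (induction n arbitrary: v) (auto simp: bind_eq_Some_conv PrimRec.IH)
  then show ?case using PrimRec.prems by simp
next
  case (Mu p)
  then show ?case by (auto simp: run_Mu_eq_Some)
qed (auto simp: bind_eq_Some_conv assms)

section \<open>The use principle: a halting computation depends on finitely many oracle
  answers\<close>

lemma uniform_bound:
  fixes P :: "nat \<Rightarrow> nat \<Rightarrow> bool"
  assumes "\<And>m. m \<le> n \<Longrightarrow> \<exists>u. P u m" "\<And>u u' m. P u m \<Longrightarrow> u \<le> u' \<Longrightarrow> P u' m"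
  shows "\<exists>u. \<forall>m\<le>n. P u m"
  using assms(1)
proof (induction n)
  case (Suc n)
  then obtain u v where "\<forall>m\<le>n. P u m" "P v (Suc n)" by (metis le_Suc_eq)
  then have "\<forall>m\<le>Suc n. P (max u v) m" using assms(2) by (metis le_Suc_eq max.cobounded1 max.cobounded2)
  then show ?case by blast
qed auto

text \<open>Only finitely many queries are asked, and \<open>u\<close> bounds them. For
  \<open>Mu\<close> the bounds of the finitely many tests up to the result are combined by
  \<open>uniform_bound\<close>.\<close>

lemma finite_use:
  assumes "run A p x = Some y"
  shows "\<exists>u. \<forall>B r. (\<forall>q<u. run B r q = Some (of_bool (q \<in> A))) \<longrightarrow> run B (subst_query r p) x = Some y"
  using assms
proof (induction p arbitrary: x y)
  case Query
  then show ?case by (auto intro!: exI[of _ "Suc x"])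
next
  case (PairP p q)
  then obtain a b where ab: "run A p x = Some a" "run A q x = Some b" "y = pp a b"
    by (auto simp: bind_eq_Some_conv)
  obtain u v where "\<forall>B r. (\<forall>q<u. run B r q = Some (of_bool (q \<in> A))) \<longrightarrow> run B (subst_query r p) x = Some a"
     "\<forall>B r. (\<forall>q<v. run B r q = Some (of_bool (q \<in> A))) \<longrightarrow> run B (subst_query r q) x = Some b"
    using PairP.IH ab by meson
  then show ?case using ab by (intro exI[of _ "max u v"]) auto
next
  case (CompP p q)
  then obtain a where ab: "run A q x = Some a" "run A p a = Some y"
    by (auto simp: bind_eq_Some_conv)
  obtain u v where "\<forall>B r. (\<forall>q<u. run B r q = Some (of_bool (q \<in> A))) \<longrightarrow> run B (subst_query r q) x = Some a"
     "\<forall>B r. (\<forall>q<v. run B r q = Some (of_bool (q \<in> A))) \<longrightarrow> run B (subst_query r p) a = Some y"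
    using CompP.IH ab by meson
  then show ?case by (intro exI[of _ "max u v"]) auto
next
  case (PrimRec p q)
  have "\<exists>u. \<forall>B r. (\<forall>q<u. run B r q = Some (of_bool (q \<in> A))) \<longrightarrow>
     rec_nat (run B (subst_query r p) z) (\<lambda>i r'. Option.bind r' (\<lambda>v. run B (subst_query r q) (pp z (pp i v)))) n = Some v"
    if "rec_nat (run A p z) (\<lambda>i r. Option.bind r (\<lambda>v. run A q (pp z (pp i v)))) n = Some v" for z n v
    using that
  proof (induction n arbitrary: v)
    case 0
    then show ?case using PrimRec.IH(1) by simp
  next
    case (Suc n)
    then obtain a where a: "rec_nat (run A p z) (\<lambda>i r. Option.bind r (\<lambda>v. run A q (pp z (pp i v)))) n = Some a"
      "run A q (pp z (pp n a)) = Some v" by (auto simp: bind_eq_Some_conv)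
    obtain u w where "\<forall>B r. (\<forall>q<u. run B r q = Some (of_bool (q \<in> A))) \<longrightarrow> 
       rec_nat (run B (subst_query r p) z) (\<lambda>i r'. Option.bind r' (\<lambda>v. run B (subst_query r q) (pp z (pp i v)))) n = Some a"
       "\<forall>B r. (\<forall>q<w. run B r q = Some (of_bool (q \<in> A))) \<longrightarrow> run B (subst_query r q) (pp z (pp n a)) = Some v"
      using Suc.IH[OF a(1)] PrimRec.IH(2)[OF a(2)] by blast
    then show ?case by (intro exI[of _ "max u w"]) auto
  qed
  then show ?case using PrimRec.prems by simp
next
  case (Mu p)
  have "\<exists>u. \<forall>m\<le>y. \<forall>B r. (\<forall>q<u. run B r q = Some (of_bool (q \<in> A))) \<longrightarrow>
      run B (subst_query r p) (pp x m) = run A p (pp x m)"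
  proof (rule uniform_bound)
    fix m assume "m \<le> y"
    then obtain v where "run A p (pp x m) = Some v"
      using Mu.prems by (auto simp: run_Mu_eq_Some le_less)
    then show "\<exists>u. \<forall>B r. (\<forall>q<u. run B r q = Some (of_bool (q \<in> A))) \<longrightarrow> run B (subst_query r p) (pp x m) = run A p (pp x m)"
      using Mu.IH by metis
  qed auto
  then obtain u where "\<And>m B r. m \<le> y \<Longrightarrow> \<forall>q<u. run B r q = Some (of_bool (q \<in> A)) \<Longrightarrow>
      run B (subst_query r p) (pp x m) = run A p (pp x m)" by blast
  then show ?case using Mu.prems by (intro exI[of _ u]) (auto simp: run_Mu_eq_Some)
qed auto

text \<open>Divergence beyond the end of \<open>w\<close> guarantees that a halting computation
  asked only questions answered by \<open>w\<close>.\<close>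

definition finite_oracle_prog :: prog where
  "finite_oracle_prog = (SOME p. \<forall>A w q. run A p (pp w q) =
     (if q < len_code w then Some (of_bool (nth_code w q \<noteq> 0)) else None))"

lemma run_finite_oracle_prog:
  "run A finite_oracle_prog (pp w q) =
     (if q < len_code w then Some (of_bool (nth_code w q \<noteq> 0)) else None)"
proof -
  have "rc 0 (\<lambda>A z. of_bool (len_code (p1 (p1 z)) \<le> p2 (p1 z)))"
    by (intro rc_le rc_len_code rc_p1 rc_p2 rc_id)
  then obtain d where d: "\<And>A z. run A d z = Some (of_bool (len_code (p1 (p1 z)) \<le> p2 (p1 z)))"
    unfolding rc_def by auto
  have "rc 0 (\<lambda>A z. of_bool (\<not> nth_code (p1 z) (p2 z) = 0))"
    by (intro rc_not rc_eq rc_nth_code rc_p1 rc_p2 rc_id rc_const)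
  then obtain v where v: "\<And>A z. run A v z = Some (of_bool (nth_code (p1 z) (p2 z) \<noteq> 0))"
    unfolding rc_def by auto
  \<comment> \<open>\<open>Mu d\<close> ignores its search variable and halts iff \<open>q\<close>
    is below the length of \<open>w\<close>; it only guards the answer computed by \<open>v\<close>,
    which \<open>RightP\<close> returns.\<close>
  have "\<forall>A w q. run A (CompP RightP (PairP (Mu d) v)) (pp w q) =
     (if q < len_code w then Some (of_bool (nth_code w q \<noteq> 0)) else None)"
    by (auto simp: d v run.simps(9))
  then have "\<forall>A w q. run A finite_oracle_prog (pp w q) =
     (if q < len_code w then Some (of_bool (nth_code w q \<noteq> 0)) else None)"
    unfolding finite_oracle_prog_def by (rule someI)
  then show ?thesis by blast
qed

text \<open>Halting relative to a finite oracle, phrased as membership in the jump of the empty set,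
  so that it is arithmetical independently of any oracle.\<close>

definition halts_with :: "nat \<Rightarrow> nat \<Rightarrow> bool" where
  "halts_with w e \<longleftrightarrow>
     comp_code (subst_code (fix_code (prog_code finite_oracle_prog) w) e) (const_code e) \<in> turing_jump {q. False}"

lemma halts_with_iff:
  "halts_with w e \<longleftrightarrow> (\<exists>p. e = prog_code p \<and> run {} (subst_query (fix_prog finite_oracle_prog w) p) e \<noteq> None)"
proof (cases "e \<in> range prog_code")
  case True
  then obtain p where e: "e = prog_code p" by blast
  have "comp_code (subst_code (fix_code (prog_code finite_oracle_prog) w) e) (const_code e) =
      prog_code (CompP (subst_query (fix_prog finite_oracle_prog w) p) (const_prog e))"
    unfolding e by (simp add: subst_code prog_code_eq_codes)
  then show ?thesis using inj_prog_code by (auto simp: halts_with_def e dest: injD)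
next
  case False
  then have "comp_code (subst_code (fix_code (prog_code finite_oracle_prog) w) e) (const_code e) \<notin> range prog_code"
    unfolding prog_code_eq_codes
    by (metis (no_types, lifting) comp_code_eq_prog_codeD rangeE subst_code_eq_prog_codeD)
  with False show ?thesis by (auto simp: turing_jump_iff halts_with_def)
qed

text \<open>This trades a jump for quantifiers over numbers: \<open>A\<close> itself is only asked
  for agreement with the finite list \<open>w\<close>.\<close>

lemma turing_jump_use:
  "e \<in> turing_jump A \<longleftrightarrow> (\<exists>w. (\<forall>q. q < len_code w \<longrightarrow> (nth_code w q \<noteq> 0 \<longleftrightarrow> q \<in> A)) \<and> halts_with w e)"
  (is "?L \<longleftrightarrow> ?R")
proof
  assume ?L
  then obtain p y where e: "e = prog_code p" and "run A p e = Some y"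
    by (auto simp: turing_jump_iff)
  then obtain u where u: "\<And>B r. \<forall>q<u. run B r q = Some (of_bool (q \<in> A)) \<Longrightarrow> run B (subst_query r p) e = Some y"
    using finite_use by blast
  define w where "w = list_encode (map (\<lambda>q. of_bool (q \<in> A)) [0..<u])"
  have w: "len_code w = u" "\<And>q. q < u \<Longrightarrow> nth_code w q = of_bool (q \<in> A)"
    by (simp_all add: w_def)
  have "run {} (subst_query (fix_prog finite_oracle_prog w) p) e = Some y"
    by (rule u) (simp add: run_finite_oracle_prog w)
  then have "halts_with w e" using e by (auto simp: halts_with_iff)
  then show ?R using w by (intro exI[of _ w]) auto
next
  assume ?R
  then obtain w p y where w: "\<And>q. q < len_code w \<Longrightarrow> nth_code w q \<noteq> 0 \<longleftrightarrow> q \<in> A" and e: "e = prog_code p"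
    and "run {} (subst_query (fix_prog finite_oracle_prog w) p) e = Some y"
    by (auto simp: halts_with_iff)
  then have "run A (subst_query Query p) e = Some y"
    by (elim subst_query_mono[rotated]) (auto simp: run_finite_oracle_prog split: if_splits)
  then show ?L using e by simp
qed

text \<open>Literals coded by numbers: 0 is false, 1 is true, \<open>2 * q + 2\<close> stands for
  membership of \<open>q\<close> in \<open>A\<close>, and \<open>2 * q + 3\<close> for its
  negation.\<close>

definition lit :: "nat set \<Rightarrow> nat \<Rightarrow> bool" where
  "lit A z \<longleftrightarrow> (if z = 0 then False else if z = 1 then True
     else if even z then z div 2 - 1 \<in> A else z div 2 - 1 \<notin> A)"

definition neg_lit :: "nat \<Rightarrow> nat" where "neg_lit z = (if even z then z + 1 else z - 1)"

lemma lit_neg_lit: "lit A (neg_lit z) \<longleftrightarrow> \<not> lit A z"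
  unfolding lit_def neg_lit_def by (cases "z = 0"; cases "z = 1"; cases "even z") (auto elim!: oddE)

text \<open>Repeating "exists, not" yields an alternating prenex prefix of length \<open>k\<close>
  in one uniform shape. The matrix \<open>l\<close> chooses a literal without looking at
  \<open>A\<close>.\<close>

primrec sat :: "nat set \<Rightarrow> (nat \<Rightarrow> nat) \<Rightarrow> nat \<Rightarrow> nat \<Rightarrow> bool" where
  "sat A l 0 x \<longleftrightarrow> lit A (l x)"
| "sat A l (Suc k) x \<longleftrightarrow> (\<exists>n. \<not> sat A l k (pp x n))"

definition qf_at :: "nat \<Rightarrow> (nat set \<Rightarrow> nat \<Rightarrow> bool) \<Rightarrow> bool" where
  "qf_at k P \<longleftrightarrow> (\<exists>l. ar (\<lambda>A. l) \<and> (\<forall>A x. P A x \<longleftrightarrow> sat A l k x))"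

definition qf :: "(nat set \<Rightarrow> nat \<Rightarrow> bool) \<Rightarrow> bool" where "qf P \<longleftrightarrow> (\<exists>k. qf_at k P)"

lemma qf_at_comp:
  assumes "ar (\<lambda>A. g)" "qf_at k P"
  shows "qf_at k (\<lambda>A x. P A (g x))"
proof -
  have "\<exists>l'. ar (\<lambda>A. l') \<and> (\<forall>A x. sat A l k (g x) \<longleftrightarrow> sat A l' k x)" if "ar (\<lambda>A. l)" "ar (\<lambda>A. g)" for l g
    using that(2)
  proof (induction k arbitrary: g)
    case 0
    then show ?case using ar_comp[OF that(1) 0] by auto
  next
    case (Suc k)
    have "ar (\<lambda>A z. pp (g (p1 z)) (p2 z))"
      using ar_pair[OF ar_comp[OF Suc.prems ar_p1[OF ar_id]] ar_p2[OF ar_id]] by simp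
    from Suc.IH[OF this] obtain l' where l': "ar (\<lambda>A. l')" "\<And>A x. sat A l k (pp (g (p1 x)) (p2 x)) \<longleftrightarrow> sat A l' k x"
      by blast
    have "sat A l (Suc k) (g x) \<longleftrightarrow> sat A l' (Suc k) x" for A x
      using l'(2)[of A "pp x _"] by simp
    then show ?case using l'(1) by blast
  qed
  then show ?thesis using assms unfolding qf_at_def by meson
qed

lemma qf_at_Suc_neg: "qf_at k P \<Longrightarrow> qf_at (Suc k) (\<lambda>A x. \<exists>n. \<not> P A (pp x n))"
  unfolding qf_at_def by auto

text \<open>A dummy quantifier is added innermost, where the negation that comes with it is undone
  by \<open>neg_lit\<close>.\<close>

lemma qf_at_Suc:
  assumes "qf_at k P"
  shows "qf_at (Suc k) P"
proof -
  obtain l where l: "ar (\<lambda>A. l)" "\<And>A x. P A x \<longleftrightarrow> sat A l k x"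
    using assms unfolding qf_at_def by blast
  define l' where "l' z = neg_lit (l (p1 z))" for z
  have "ar (\<lambda>A z. neg_lit (l (p1 z)))" unfolding neg_lit_def
    by (intro ar_intros ar_comp[OF l(1)])
  then have "ar (\<lambda>A. l')" by (simp add: l'_def[abs_def])
  moreover have "sat A l k x \<longleftrightarrow> sat A l' (Suc k) x" for A x
    by (induction k arbitrary: x) (auto simp: l'_def lit_neg_lit)
  ultimately show ?thesis using l(2) unfolding qf_at_def by blast
qed

lemma qf_at_mono: "qf_at k P \<Longrightarrow> k \<le> m \<Longrightarrow> qf_at m P"
  by (rotate_tac 1, induction m rule: dec_induct) (auto intro: qf_at_Suc)

lemma qf_at_if:
  assumes "qf_at k P" "qf_at k Q" "arp (\<lambda>A. c)"
  shows "qf_at k (\<lambda>A x. if c x then P A x else Q A x)"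
proof -
  have "\<exists>l'. ar (\<lambda>A. l') \<and> (\<forall>A x. (if c x then sat A l k x else sat A m k x) \<longleftrightarrow> sat A l' k x)"
    if "ar (\<lambda>A. l)" "ar (\<lambda>A. m)" "arp (\<lambda>A. c)" for l m c
    using that(3)
  proof (induction k arbitrary: c)
    case 0
    then show ?case using ar_if[OF 0 that(1,2)] by (intro exI[of _ "\<lambda>x. if c x then l x else m x"]) auto
  next
    case (Suc k)
    have "arp (\<lambda>A z. c (p1 z))"
      using ar_comp[OF Suc.prems ar_p1[OF ar_id]] by simp
    from Suc.IH[OF this] obtain l' where l': "ar (\<lambda>A. l')"
       "\<And>A x. (if c (p1 x) then sat A l k x else sat A m k x) \<longleftrightarrow> sat A l' k x"
      by blast
    have "(if c x then sat A l (Suc k) x else sat A m (Suc k) x) \<longleftrightarrow> sat A l' (Suc k) x" for A x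
      by (simp add: l'(2)[symmetric])
    then show ?case using l'(1) by blast
  qed
  then obtain l' where "ar (\<lambda>A. l')" "\<And>A x. (if c x then P A x else Q A x) \<longleftrightarrow> sat A l' k x"
    using assms unfolding qf_at_def by metis
  then show ?thesis unfolding qf_at_def by blast
qed

lemma qf_comp: "qf P \<Longrightarrow> ar (\<lambda>A. g) \<Longrightarrow> qf (\<lambda>A x. P A (g x))"
  unfolding qf_def using qf_at_comp by blast

lemma qf_not: 
  assumes "qf P"
  shows "qf (\<lambda>A x. \<not> P A x)"
proof -
  have "qf (\<lambda>A z. P A (p1 z))" by (rule qf_comp[OF assms ar_p1[OF ar_id]])
  then obtain k where "qf_at k (\<lambda>A z. P A (p1 z))" unfolding qf_def by blast
  from qf_at_Suc_neg[OF this] show ?thesis unfolding qf_def by auto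
qed

lemma qf_ex: 
  assumes "qf (\<lambda>A z. P A (p1 z) (p2 z))"
  shows "qf (\<lambda>A x. \<exists>n. P A x n)"
proof -
  obtain k where "qf_at k (\<lambda>A z. \<not> P A (p1 z) (p2 z))" using qf_not[OF assms] unfolding qf_def by blast
  from qf_at_Suc_neg[OF this] show ?thesis unfolding qf_def by auto
qed

lemma qf_static:
  assumes "arp (\<lambda>A. c)"
  shows "qf (\<lambda>A. c)"
proof -
  have "qf_at 0 (\<lambda>A. c)" unfolding qf_at_def using assms
    by (intro exI[of _ "\<lambda>x. of_bool (c x)"]) (auto simp: lit_def)
  then show ?thesis unfolding qf_def by blast
qed

lemma qf_mem: "qf (\<lambda>A x. x \<in> A)"
proof -
  have "ar (\<lambda>A x. 2 * x + 2)" by (intro ar_intros)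
  then have "qf_at 0 (\<lambda>A x. x \<in> A)" unfolding qf_at_def
    by (intro exI[of _ "\<lambda>x. 2 * x + 2"]) (auto simp: lit_def)
  then show ?thesis unfolding qf_def by blast
qed

lemma qf_if:
  assumes "qf P" "qf Q" "arp (\<lambda>A. c)"
  shows "qf (\<lambda>A x. if c x then P A x else Q A x)"
proof -
  obtain k m where "qf_at k P" "qf_at m Q" using assms unfolding qf_def by blast
  then have "qf_at (max k m) P" "qf_at (max k m) Q" by (auto elim: qf_at_mono)
  from qf_at_if[OF this assms(3)] show ?thesis unfolding qf_def by blast
qed

text \<open>A disjunction is an existential quantifier over a case distinction on numbers, and
  \<open>qf_if\<close> pushes such a distinction into the choice of literals without lengthening the
  prefix.\<close>

lemma qf_disj:
  assumes "qf P" "qf Q"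
  shows "qf (\<lambda>A x. P A x \<or> Q A x)"
proof -
  have "arp (\<lambda>A z. p2 z = 0)" by (intro ar_intros)
  then have "qf (\<lambda>A z. if p2 z = 0 then P A (p1 z) else Q A (p1 z))"
    by (intro qf_if qf_comp[OF _ ar_p1[OF ar_id]] assms)
  then have "qf (\<lambda>A x. \<exists>n::nat. if n = 0 then P A x else Q A x)" by (rule qf_ex)
  moreover have "(\<exists>n::nat. if n = 0 then P A x else Q A x) \<longleftrightarrow> P A x \<or> Q A x" for A x
    by (auto split: if_splits)
  ultimately show ?thesis by simp
qed

lemma qf_conj:
  assumes "qf P" "qf Q"
  shows "qf (\<lambda>A x. P A x \<and> Q A x)"
  using qf_not[OF qf_disj[OF qf_not[OF assms(1)] qf_not[OF assms(2)]]] by simp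

lemma qf_jump:
  assumes "qf P"
  shows "qf (\<lambda>A x. x \<in> turing_jump {q. P A q})"
proof -
  have "arp (\<lambda>A y. \<not> p2 y < len_code (p2 (p1 y)))" "arp (\<lambda>A y. nth_code (p2 (p1 y)) (p2 y) \<noteq> 0)"
    by (intro ar_intros)+
  then have "qf (\<lambda>A y. \<not> p2 y < len_code (p2 (p1 y)) \<or> (if nth_code (p2 (p1 y)) (p2 y) \<noteq> 0 then P A (p2 y) else \<not> P A (p2 y)))"
    by (intro qf_disj qf_static qf_if qf_not qf_comp[OF assms] ar_intros)
  then have "qf (\<lambda>A y. \<not> (\<not> p2 y < len_code (p2 (p1 y)) \<or> (if nth_code (p2 (p1 y)) (p2 y) \<noteq> 0 then P A (p2 y) else \<not> P A (p2 y))))"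
    by (rule qf_not)
  from qf_not[OF qf_ex[of "\<lambda>A z q. \<not> (\<not> q < len_code (p2 z) \<or> (if nth_code (p2 z) q \<noteq> 0 then P A q else \<not> P A q))", OF this]]
  have "qf (\<lambda>A z. \<forall>q. \<not> q < len_code (p2 z) \<or> (if nth_code (p2 z) q \<noteq> 0 then P A q else \<not> P A q))"
    by simp
  moreover have "arp (\<lambda>A z. halts_with (p2 z) (p1 z))"
    unfolding halts_with_def by (intro ar_intros)
  ultimately have "qf (\<lambda>A z. (\<forall>q. \<not> q < len_code (p2 z) \<or> (if nth_code (p2 z) q \<noteq> 0 then P A q else \<not> P A q)) \<and> halts_with (p2 z) (p1 z))"
    by (intro qf_conj qf_static)
  from qf_ex[of "\<lambda>A x w. (\<forall>q. \<not> q < len_code w \<or> (if nth_code w q \<noteq> 0 then P A q else \<not> P A q)) \<and> halts_with w x", OF this]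
  have "qf (\<lambda>A x. \<exists>w. (\<forall>q. \<not> q < len_code w \<or> (if nth_code w q \<noteq> 0 then P A q else \<not> P A q)) \<and> halts_with w x)" .
  moreover have "(\<exists>w. (\<forall>q. \<not> q < len_code w \<or> (if nth_code w q \<noteq> 0 then P A q else \<not> P A q)) \<and> halts_with w x)
     \<longleftrightarrow> x \<in> turing_jump {q. P A q}" for A x
    unfolding turing_jump_use[of x] by (metis mem_Collect_eq)
  ultimately show ?thesis by simp
qed

theorem ar_imp_sat:
  assumes "arp P"
  obtains l k where "ar (\<lambda>A. l)" "\<And>A x. P A x \<longleftrightarrow> sat A l k x"
proof -
  obtain c k where c: "cf c" "\<And>A x. P A x \<longleftrightarrow> c x \<in> jumps k A"
    using ar_normal_form[OF assms] by blast
  have "qf (\<lambda>A x. x \<in> jumps k A)"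
  proof (induction k)
    case 0
    show ?case using qf_mem by simp
  next
    case (Suc k)
    from qf_jump[OF this] show ?case by simp
  qed
  from qf_comp[OF this ar_cf[OF c(1) ar_id]] have "qf P" by (simp add: c(2)[symmetric])
  then show ?thesis using that unfolding qf_def qf_at_def by blast
qed


section \<open>Effective transfinite recursion\<close>

definition join_seq :: "(nat \<Rightarrow> nat set) \<Rightarrow> nat set" where "join_seq Y = {pp m n | m n. m \<in> Y n}"

lemma join_seq_iff: "z \<in> join_seq Y \<longleftrightarrow> p1 z \<in> Y (p2 z)"
  unfolding join_seq_def by (auto, metis pp_p1_p2)

lemma pp_in_join_seq [simp]: "pp m n \<in> join_seq Y \<longleftrightarrow> m \<in> Y n"
  by (simp add: join_seq_iff)

text \<open>The limit clause asks for totality of \<open>e\<close> and for the iterates, not for an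
  increasing sequence of notations. One step of it is thus an arithmetical closure condition, which
  \<open>new_dom\<close> imitates.\<close>

inductive iter_set :: "nat set \<Rightarrow> (nat set \<Rightarrow> nat set) \<Rightarrow> (nat set \<Rightarrow> nat set) \<Rightarrow> nat \<Rightarrow> nat set \<Rightarrow> bool"
  for B Op Lp where
  iter_zero: "iter_set B Op Lp 1 B"
| iter_succ: "iter_set B Op Lp a M \<Longrightarrow> iter_set B Op Lp (2 ^ a) (Op M)"
| iter_lim: "(\<And>n. phi {} e n = Some (s n)) \<Longrightarrow> (\<And>n. iter_set B Op Lp (s n) (Y n)) \<Longrightarrow>
    iter_set B Op Lp (3 * 5 ^ e) (Lp (join_seq Y))"

lemma iter_set_not_0 [simp]: "\<not> iter_set B Op Lp 0 M"
  by (auto elim: iter_set.cases)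

lemma notation_distinct [simp]:
  "2 ^ a \<noteq> (3 * 5 ^ e :: nat)" "3 * 5 ^ e \<noteq> (2 ^ a :: nat)"
  "3 * 5 ^ e \<noteq> Suc 0" "Suc 0 \<noteq> 3 * 5 ^ e"
proof -
  show *: "2 ^ a \<noteq> (3 * 5 ^ e :: nat)"
  proof
    assume "2 ^ a = (3 * 5 ^ e :: nat)"
    moreover have "odd (3 * 5 ^ e :: nat)" by simp
    ultimately have "a = 0" by (metis even_power even_numeral not_gr_zero)
    with \<open>2 ^ a = _\<close> show False by simp
  qed
  then show "3 * 5 ^ e \<noteq> (2 ^ a :: nat)" by metis
  show "3 * 5 ^ e \<noteq> Suc 0" "Suc 0 \<noteq> 3 * 5 ^ e" by (metis mult_eq_1_iff numeral_eq_one_iff One_nat_def semiring_norm(84))+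
qed

lemma iter_set_1D: "iter_set B Op Lp (Suc 0) M \<Longrightarrow> M = B"
  by (erule iter_set.cases) (auto dest: sym)

lemma iter_set_succD: "iter_set B Op Lp (2 ^ a) M \<Longrightarrow> a \<noteq> 0 \<Longrightarrow> \<exists>M'. M = Op M' \<and> iter_set B Op Lp a M'"
  by (erule iter_set.cases) auto

lemma iter_set_limD:
  "iter_set B Op Lp (3 * 5 ^ e) M \<Longrightarrow>
    \<exists>s Y. (\<forall>n. phi {} e n = Some (s n)) \<and> (\<forall>n. iter_set B Op Lp (s n) (Y n)) \<and> M = Lp (join_seq Y)"
  by (erule iter_set.cases) auto

lemma iter_set_unique: "iter_set B Op Lp a M \<Longrightarrow> iter_set B Op Lp a M' \<Longrightarrow> M' = M"
proof (induction arbitrary: M' rule: iter_set.induct)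
  case iter_zero
  then show ?case by (simp add: iter_set_1D)
next
  case (iter_succ a M)
  then have "a \<noteq> 0" by (metis iter_set_not_0)
  with iter_succ show ?case using iter_set_succD by metis
next
  case (iter_lim e s Y)
  then obtain s' Y' where *: "\<forall>n. phi {} e n = Some (s' n)" "\<And>n. iter_set B Op Lp (s' n) (Y' n)" "M' = Lp (join_seq Y')"
    using iter_set_limD by meson
  have "s' = s" using iter_lim.hyps(1) *(1) by (simp add: fun_eq_iff)
  then have "Y' n = Y n" for n using iter_lim.IH *(2) by blast
  then have "Y' = Y" by blast
  then show ?case using * by simp
qed

lemma kleene_O_induct [consumes 1, case_names zero succ lim]:
  assumes "kleene_O a" "P 1" "\<And>a. kleene_O a \<Longrightarrow> P a \<Longrightarrow> P (2 ^ a)"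
    "\<And>e s. (\<And>n. phi {} e n = Some (s n)) \<Longrightarrow> (\<And>n. kleene_O (s n)) \<Longrightarrow> (\<And>n. s n <\<^sub>O s (Suc n)) \<Longrightarrow>
      (\<And>n. P (s n)) \<Longrightarrow> P (3 * 5 ^ e)"
  shows "P a"
  using assms(1)
  by (induction a rule: kleene_O_kleene_less.inducts(1)[of _ P "\<lambda>_ _. True"]) (auto intro: assms simp del: One_nat_def)

lemma kleene_O_not_0: "kleene_O a \<Longrightarrow> a \<noteq> 0"
  by (induction a rule: kleene_O_induct) auto

lemma iter_set_exists: "kleene_O a \<Longrightarrow> \<exists>M. iter_set B Op Lp a M"
proof (induction a rule: kleene_O_induct)
  case (lim e s)
  then obtain Y where "\<And>n. iter_set B Op Lp (s n) (Y n)" by metis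
  with lim show ?case by (meson iter_lim)
qed (auto intro: iter_set.intros simp del: One_nat_def)

lemma H_set_imp_iter_set: "H_set a X \<Longrightarrow> iter_set {} turing_jump (\<lambda>N. N) a X"
  by (induction rule: H_set.induct) (auto intro: iter_set.intros simp: join_seq_def[symmetric] simp del: One_nat_def)

section \<open>Notations for finitely many further jumps, and computing with many-one
  reductions\<close>

definition tower :: "nat \<Rightarrow> nat \<Rightarrow> nat" where "tower a n = rec_nat a (\<lambda>i v. 2 ^ v) n"

lemma tower_simps [simp]: "tower a 0 = a" "tower a (Suc n) = 2 ^ tower a n"
  by (simp_all add: tower_def)

lemma tower_O: "kleene_O a \<Longrightarrow> kleene_O (tower a k)"
  by (induction k) (auto intro: O_succ)

lemma tower_less: "kleene_O a \<Longrightarrow> tower a k <\<^sub>O tower a (Suc k)"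
  by (auto intro: kless_succ tower_O)

lemma tower_H: "H_set a H \<Longrightarrow> H_set (tower a k) (jumps k H)"
  by (induction k) (auto intro: H_succ)

lemma HYP_iff_many_one: "X \<in> HYP \<longleftrightarrow> (\<exists>a H c. kleene_O a \<and> H_set a H \<and> cf c \<and> X = {x. c x \<in> H})"
proof
  assume "X \<in> HYP"
  then obtain a H e where a: "kleene_O a" "H_set a H" "\<And>n. phi H e n = Some (of_bool (n \<in> X))"
    unfolding HYP_def turing_le_def by blast
  have "X = {x. halt_eq_code e x 1 \<in> turing_jump H}" by (auto simp: halt_eq_code a)
  moreover have "cf (\<lambda>x. halt_eq_code e x 1)" unfolding cf_rc0 by (intro rc_halt_eq_code rc_const rc_id)
  ultimately show "\<exists>a H c. kleene_O a \<and> H_set a H \<and> cf c \<and> X = {x. c x \<in> H}"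
    using a O_succ H_succ by blast
next
  assume "\<exists>a H c. kleene_O a \<and> H_set a H \<and> cf c \<and> X = {x. c x \<in> H}"
  then obtain a H c p where a: "kleene_O a" "H_set a H" "X = {x. c x \<in> H}"
    and p: "\<And>A x. run A p x = Some (c x)" unfolding cf_def by blast
  have "phi H (prog_code (CompP Query p)) n = Some (of_bool (n \<in> X))" for n
    by (simp add: p a)
  then show "X \<in> HYP" unfolding HYP_def turing_le_def using a by blast
qed

definition jred_prog :: prog where
  "jred_prog = (SOME p. \<forall>A z. run A p z =
     Some (comp_code (subst_code (comp_code (prog_code Query) (p1 z)) (p2 z)) (const_code (p2 z))))"

lemma run_jred_prog: "run A jred_prog z =
    Some (comp_code (subst_code (comp_code (prog_code Query) (p1 z)) (p2 z)) (const_code (p2 z)))"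
proof -
  have "rc 0 (\<lambda>A z. comp_code (subst_code (comp_code (prog_code Query) (p1 z)) (p2 z)) (const_code (p2 z)))"
    by (intro rc_comp_code rc_subst_code rc_const_code rc_const rc_p1 rc_p2 rc_id)
  then have "\<exists>p. \<forall>A z. run A p z =
     Some (comp_code (subst_code (comp_code (prog_code Query) (p1 z)) (p2 z)) (const_code (p2 z)))"
    unfolding rc_def by simp
  from someI_ex[OF this] show ?thesis unfolding jred_prog_def by blast
qed

text \<open>Acts on codes of many-one reductions: from the code of a reduction of \<open>M\<close>
  to \<open>A\<close> it produces one of a reduction of the jump of \<open>M\<close> to the jump of
  \<open>A\<close>.\<close>

definition jred :: "nat \<Rightarrow> nat" where "jred c = fix_code (prog_code jred_prog) c"

lemma jred_iterate:
  assumes "\<And>A y. run A u y = Some (f y)"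
  shows "\<exists>u' f'. (\<forall>A y. run A u' y = Some (f' y)) \<and> prog_code u' = (jred ^^ k) (prog_code u) \<and>
    (\<forall>A. jumps k {x. f x \<in> A} = {x. f' x \<in> jumps k A})"
proof (induction k)
  case 0
  then show ?case using assms by auto
next
  case (Suc k)
  then obtain u' f' where *: "\<And>A y. run A u' y = Some (f' y)" "prog_code u' = (jred ^^ k) (prog_code u)"
    "\<And>A. jumps k {x. f x \<in> A} = {x. f' x \<in> jumps k A}" by blast
  define f'' where "f'' y = comp_code (subst_code (comp_code (prog_code Query) (prog_code u')) y) (const_code y)" for y
  have "run A (fix_prog jred_prog (prog_code u')) y = Some (f'' y)" for A y
    by (simp add: run_jred_prog f''_def)
  moreover have "prog_code (fix_prog jred_prog (prog_code u')) = (jred ^^ Suc k) (prog_code u)"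
    by (simp add: jred_def *(2)[symmetric] prog_code_eq_codes)
  moreover have "jumps (Suc k) {x. f x \<in> A} = {x. f'' x \<in> jumps (Suc k) A}" for A
    using jump_reduction[of "jumps k A" "CompP Query u'" "{x. f' x \<in> jumps k A}"]
    by (auto simp: *(1,3) f''_def prog_code_eq_codes)
  ultimately show ?case by blast
qed

text \<open>The oracle \<open>{y. f y \<in> A}\<close> enters only through the code of
  \<open>u\<close>, and \<open>q\<close> is computable in that code. This is the form required under
  the recursion theorem, where the reduction for the previous step is known by its code
  alone.\<close>

lemma arithmetical_reduction:
  assumes "arp P"
  obtains q k where "cf q" "\<And>u f A x. (\<And>A y. run A u y = Some (f y)) \<Longrightarrow>
     P {y. f y \<in> A} x \<longleftrightarrow> q (pp (prog_code u) x) \<in> jumps k A"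
proof -
  obtain c k where c: "cf c" "\<And>A x. P A x \<longleftrightarrow> c x \<in> jumps k A"
    using ar_normal_form[OF assms] by blast
  define q where "q z = halt_eq_code (comp_code (prog_code Query) ((jred ^^ k) (p1 z))) (c (p2 z)) 1" for z
  have "rc 0 (\<lambda>A z. (jred ^^ k) (p1 z))"
  proof (induction k)
    case (Suc k)
    then show ?case by (simp add: jred_def) (intro rc_fix_code rc_const)
  qed (auto intro: rc_p1 rc_id)
  then have "rc 0 (\<lambda>A z. halt_eq_code (comp_code (prog_code Query) ((jred ^^ k) (p1 z))) (c (p2 z)) 1)"
    by (intro rc_halt_eq_code rc_comp_code rc_const rc_cf[OF c(1)] rc_p2 rc_id)
  then have "cf q" by (simp add: cf_rc0 q_def[abs_def])
  moreover have "P {y. f y \<in> A} x \<longleftrightarrow> q (pp (prog_code u) x) \<in> jumps (Suc k) A"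
    if u: "\<And>A y. run A u y = Some (f y)" for u f A x
  proof -
    obtain u' f' where *: "\<And>A y. run A u' y = Some (f' y)" "prog_code u' = (jred ^^ k) (prog_code u)"
      "\<And>A. jumps k {x. f x \<in> A} = {x. f' x \<in> jumps k A}" using jred_iterate[OF u] by blast
    have "q (pp (prog_code u) x) = halt_eq_code (prog_code (CompP Query u')) (c x) 1"
      by (simp add: q_def *(2)[symmetric] prog_code_eq_codes)
    then show ?thesis by (simp add: halt_eq_code c(2) * )
  qed
  ultimately show ?thesis using that by blast
qed

definition tower_prog :: prog where
  "tower_prog = (SOME p. \<forall>A z. run A p z = Some (tower (p1 z) (p2 z)))"

lemma run_tower_prog: "run A tower_prog z = Some (tower (p1 z) (p2 z))"
proof -
  have "rc 0 (\<lambda>A z. tower (p1 z) (p2 z))" unfolding tower_def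
    by (intro rc_rec rc_p1 rc_p2 rc_id rc_power rc_const)
  then have "\<exists>p. \<forall>A z. run A p z = Some (tower (p1 z) (p2 z))" unfolding rc_def by simp
  from someI_ex[OF this] show ?thesis unfolding tower_prog_def by blast
qed

definition tower_code :: "nat \<Rightarrow> nat" where
  "tower_code d = comp_code (prog_code tower_prog) (pair_code d (prog_code id_prog))"

text \<open>If \<open>p\<close> computes the constant \<open>b\<close>, this is a notation for \<open>|b| + \<omega>\<close>.\<close>

definition plus_omega :: "prog \<Rightarrow> nat" where "plus_omega p = 3 * 5 ^ tower_code (prog_code p)"

lemma
  assumes p: "\<And>n. run {} p n = Some b" and b: "kleene_O b"
  shows plus_omega_O: "kleene_O (plus_omega p)" and plus_omega_less: "b <\<^sub>O plus_omega p"
    and plus_omega_H: "H_set b H \<Longrightarrow> H_set (plus_omega p) (join_seq (\<lambda>n. jumps n H))"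
proof -
  have e: "phi {} (tower_code (prog_code p)) n = Some (tower b n)" for n
    by (simp add: tower_code_def prog_code_eq_codes p run_tower_prog)
  show O: "kleene_O (plus_omega p)" unfolding plus_omega_def
    using e tower_O[OF b] tower_less[OF b] by (rule O_lim)
  show "b <\<^sub>O plus_omega p" unfolding plus_omega_def
    using kless_lim[OF e tower_O[OF b] tower_less[OF b], of 0] by simp
  show "H_set (plus_omega p) (join_seq (\<lambda>n. jumps n H))" if "H_set b H"
    unfolding plus_omega_def join_seq_def using O[unfolded plus_omega_def] e tower_H[OF that] by (rule H_lim)
qed

definition log2 :: "nat \<Rightarrow> nat" where "log2 a = (LEAST b. a \<le> 2 ^ b)"
definition log35 :: "nat \<Rightarrow> nat" where "log35 a = (LEAST e. a \<le> 3 * 5 ^ e)"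

lemma log2 [simp]: "log2 (2 ^ a) = a" and log35 [simp]: "log35 (3 * 5 ^ a) = a"
  unfolding log2_def log35_def by (auto intro!: Least_equality)

lemma rc_log2: assumes "rc k f" shows "rc k (\<lambda>A x. log2 (f A x))"
proof -
  have "rc k (\<lambda>A. log2)" unfolding log2_def
  proof (rule rc_Least)
    show "\<exists>n. x \<le> 2 ^ n" for x :: nat using less_exp less_imp_le by blast
  qed (intro rc_le rc_p1 rc_p2 rc_id rc_power rc_const)
  then show ?thesis using assms by (rule rc_comp)
qed

lemma rc_log35: assumes "rc k f" shows "rc k (\<lambda>A x. log35 (f A x))"
proof -
  have "rc k (\<lambda>A. log35)" unfolding log35_def
  proof (rule rc_Least)
    fix x :: nat
    have "x \<le> 2 ^ x" by (simp add: less_imp_le)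
    also have "(2::nat) ^ x \<le> 5 ^ x" by (rule power_mono) auto
    also have "(5::nat) ^ x \<le> 3 * 5 ^ x" by simp
    finally show "\<exists>n. x \<le> 3 * 5 ^ n" by blast
  qed (intro rc_le rc_p1 rc_p2 rc_id rc_power rc_mult rc_const)
  then show ?thesis using assms by (rule rc_comp)
qed

text \<open>Each step of the recursion along \<open>a\<close> is paid for by \<open>\<omega>\<close> jumps.\<close>

lemma notation_stretch:
  assumes a0: "kleene_O a0"
  obtains h p where "\<And>A a. run A p a = Some (h a)"
    "h 1 = a0" "\<And>a. a \<noteq> 0 \<Longrightarrow> h (2 ^ a) = plus_omega (CompP p (const_prog a))"
    "\<And>e. h (3 * 5 ^ e) = plus_omega (const_prog (3 * 5 ^ comp_code (prog_code p) e))"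
    "\<And>a. kleene_O a \<Longrightarrow> kleene_O (h a)"
    "\<And>a b. a <\<^sub>O b \<Longrightarrow> h a <\<^sub>O h b"
proof -
  \<comment> \<open>\<open>p1 z\<close> is the code of the function being defined. At a limit,
    \<open>comp_code (p1 z) e\<close> enumerates the stretched notations; first their limit is
    formed, then \<open>\<omega>\<close> is added to it.\<close>
  define F where "F z = (if p2 z = 1 then a0 else if even (p2 z)
      then 3 * 5 ^ tower_code (comp_code (p1 z) (const_code (log2 (p2 z))))
      else 3 * 5 ^ tower_code (const_code (3 * 5 ^ comp_code (p1 z) (log35 (p2 z)))))" for z
  have "rc 0 (\<lambda>A z. if p2 z = 1 then a0 else if even (p2 z)
      then 3 * 5 ^ tower_code (comp_code (p1 z) (const_code (log2 (p2 z))))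
      else 3 * 5 ^ tower_code (const_code (3 * 5 ^ comp_code (p1 z) (log35 (p2 z)))))"
    unfolding tower_code_def
    by (intro rc_if rc_eq rc_even rc_mult rc_power rc_comp_code rc_pair_code rc_const_code rc_log2 rc_log35
        rc_p1 rc_p2 rc_id rc_const)
  then have "cf F" by (simp add: cf_rc0 F_def[abs_def])
  then obtain p where p: "\<And>A x. run A p x = Some (F (pp (prog_code p) x))"
    using recursion_theorem by blast
  define h where "h a = F (pp (prog_code p) a)" for a
  have run: "run A p a = Some (h a)" for A a by (simp add: p h_def)
  have h1: "h 1 = a0" by (simp add: h_def F_def)
  have h2: "h (2 ^ a) = plus_omega (CompP p (const_prog a))" if "a \<noteq> 0" for a
    using that by (simp add: h_def F_def plus_omega_def prog_code_eq_codes)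
  have h3: "h (3 * 5 ^ e) = plus_omega (const_prog (3 * 5 ^ comp_code (prog_code p) e))" for e
    by (simp add: h_def F_def plus_omega_def prog_code_eq_codes)
  have lim: "kleene_O (3 * 5 ^ comp_code (prog_code p) e)" (is ?A)
    "h (s m) <\<^sub>O 3 * 5 ^ comp_code (prog_code p) e" (is ?B)
    if s: "\<And>n. phi {} e n = Some (s n)" "\<And>n. kleene_O (h (s n))" "\<And>n. h (s n) <\<^sub>O h (s (Suc n))" for e s m
  proof -
    have "phi {} (comp_code (prog_code p) e) n = Some (h (s n))" for n
    proof -
      obtain q where "e = prog_code q" "run {} q n = Some (s n)" using phi_SomeE[OF s(1)[of n]] by blast
      then show ?thesis by (simp add: prog_code_eq_codes run)
    qed
    from O_lim[OF this s(2,3)] kless_lim[OF this s(2,3)] show ?A ?B by auto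
  qed
  have "(kleene_O a \<longrightarrow> kleene_O (h a)) \<and> (b <\<^sub>O c \<longrightarrow> h b <\<^sub>O h c)" for a b c
  proof (rule kleene_O_kleene_less.induct[of "\<lambda>a. kleene_O a \<and> kleene_O (h a)" "\<lambda>b c. h b <\<^sub>O h c", THEN conj_forward], goal_cases)
    case 1
    then show ?case using O_zero a0 h1 by simp
  next
    case (2 a)
    then show ?case using plus_omega_O[of "CompP p (const_prog a)" "h a"]
      by (simp add: h2 kleene_O_not_0 run O_succ)
  next
    case (3 e s)
    then show ?case using plus_omega_O[OF run_const_prog lim(1)[of e s]]
      by (auto simp: h3 intro: O_lim)
  next
    case (4 a)
    then show ?case using plus_omega_less[of "CompP p (const_prog a)" "h a"]
      by (simp add: h2 kleene_O_not_0 run)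
  next
    case (5 e s m)
    then show ?case using plus_omega_less[OF run_const_prog lim(1)[of e s]] lim(2)[of e s m] kless_trans
      by (auto simp: h3)
  next
    case (6 a b c)
    then show ?case using kless_trans by blast
  qed auto
  with run h1 h2 h3 show ?thesis using that by blast
qed

text \<open>By the recursion theorem one program computes, for every notation \<open>a\<close>, a
  many-one reduction of the iterate at \<open>a\<close> to the H-set at \<open>h a\<close>. A step
  costs \<open>kO\<close> or \<open>kL\<close> jumps; the H-set at the next stretched notation joins
  all finite jumps, and the second component of the reduction selects the right one.\<close>

theorem iter_set_HYP:
  assumes B: "B \<in> HYP" and Op: "arp (\<lambda>A x. x \<in> Op A)" and Lp: "arp (\<lambda>A x. x \<in> Lp A)"
    and a: "kleene_O a" "iter_set B Op Lp a M"
  shows "M \<in> HYP"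
proof -
  obtain a0 H0 cB where a0: "kleene_O a0" "H_set a0 H0" "cf cB" "B = {x. cB x \<in> H0}"
    using B unfolding HYP_iff_many_one by blast
  obtain qO kO where qO: "cf qO" "\<And>u f A x. (\<And>A y. run A u y = Some (f y)) \<Longrightarrow>
     x \<in> Op {y. f y \<in> A} \<longleftrightarrow> qO (pp (prog_code u) x) \<in> jumps kO A"
    using arithmetical_reduction[OF Op] by metis
  obtain qL kL where qL: "cf qL" "\<And>u f A x. (\<And>A y. run A u y = Some (f y)) \<Longrightarrow>
     x \<in> Lp {y. f y \<in> A} \<longleftrightarrow> qL (pp (prog_code u) x) \<in> jumps kL A"
    using arithmetical_reduction[OF Lp] by metis
  obtain h ph where h: "\<And>A a. run A ph a = Some (h a)"
    "h 1 = a0" "\<And>a. a \<noteq> 0 \<Longrightarrow> h (2 ^ a) = plus_omega (CompP ph (const_prog a))"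
    "\<And>e. h (3 * 5 ^ e) = plus_omega (const_prog (3 * 5 ^ comp_code (prog_code ph) e))"
    "\<And>a. kleene_O a \<Longrightarrow> kleene_O (h a)" "\<And>a b. a <\<^sub>O b \<Longrightarrow> h a <\<^sub>O h b"
    using notation_stretch[OF a0(1)] by metis
  \<comment> \<open>The reduction for the join at a limit: it sends \<open>pp m n\<close> to
    \<open>pp (g (pp (s n) m)) n\<close>. Since \<open>e\<close> computes \<open>s\<close> with the
    empty oracle but is to run with any oracle, its queries are replaced by the answer 0.\<close>
  define uc where "uc c e = pair_code (comp_code c (pair_code (comp_code (subst_code (prog_code Zero) e)
      (prog_code RightP)) (prog_code LeftP))) (prog_code RightP)" for c e
  define G where "G z = (let c = p1 z; b = p1 (p2 z); x = p2 (p2 z) in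
     if b = 1 then cB x else if even b then pp (qO (pp (fix_code c (log2 b)) x)) kO
     else pp (qL (pp (uc c (log35 b)) x)) kL)" for z
  have "rc 0 (\<lambda>A z. if p1 (p2 z) = 1 then cB (p2 (p2 z)) else if even (p1 (p2 z))
      then pp (qO (pp (fix_code (p1 z) (log2 (p1 (p2 z)))) (p2 (p2 z)))) kO
      else pp (qL (pp (uc (p1 z) (log35 (p1 (p2 z)))) (p2 (p2 z)))) kL)"
    unfolding uc_def
    by (intro rc_if rc_eq rc_even rc_cf[OF a0(3)] rc_cf[OF qO(1)] rc_cf[OF qL(1)] rc_pair rc_comp_code
        rc_pair_code rc_subst_code rc_fix_code rc_log2 rc_log35 rc_p1 rc_p2 rc_id rc_const)
  then have "cf G" by (simp add: cf_rc0 G_def[abs_def] Let_def)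
  then obtain pg where pg: "\<And>A x. run A pg x = Some (G (pp (prog_code pg) x))"
    using recursion_theorem by blast
  define g where "g z = G (pp (prog_code pg) z)" for z
  have run: "run A pg z = Some (g z)" for A z by (simp add: pg g_def)
  have "\<exists>H. H_set (h a) H \<and> M = {x. g (pp a x) \<in> H}" if "kleene_O a" "iter_set B Op Lp a M" for a M
    using that
  proof (induction a arbitrary: M rule: kleene_O_induct)
    case zero
    then have "M = B" by (simp add: iter_set_1D)
    then show ?case using a0 h(2) by (auto simp: g_def G_def simp del: One_nat_def)
  next
    case (succ a)
    obtain N where N: "M = Op N" "iter_set B Op Lp a N"
      using iter_set_succD[OF succ.prems kleene_O_not_0[OF succ.hyps(1)]] by blast
    with succ.IH obtain H where H: "H_set (h a) H" "N = {x. g (pp a x) \<in> H}" by blast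
    have Hh: "H_set (h (2 ^ a)) (join_seq (\<lambda>n. jumps n H))"
      unfolding h(3)[OF kleene_O_not_0[OF succ.hyps(1)]]
      by (rule plus_omega_H[OF _ h(5)[OF succ.hyps(1)] H(1)]) (simp add: h(1))
    have "x \<in> Op {y. g (pp a y) \<in> H} \<longleftrightarrow> qO (pp (prog_code (fix_prog pg a)) x) \<in> jumps kO H" for x
      by (rule qO(2)) (simp add: run)
    moreover have "g (pp (2 ^ a) x) = pp (qO (pp (prog_code (fix_prog pg a)) x)) kO" for x
      using kleene_O_not_0[OF succ.hyps(1)] by (simp add: g_def G_def Let_def prog_code_eq_codes)
    ultimately have "M = {x. g (pp (2 ^ a) x) \<in> join_seq (\<lambda>n. jumps n H)}"
      unfolding N(1) H(2) by auto
    with Hh show ?case by blast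
  next
    case (lim e s)
    obtain s' Y where *: "\<forall>n. phi {} e n = Some (s' n)" "\<And>n. iter_set B Op Lp (s' n) (Y n)"
      "M = Lp (join_seq Y)" using iter_set_limD[OF lim.prems] by blast
    have "s' = s" using lim.hyps(1) *(1) by (simp add: fun_eq_iff)
    with * lim.IH have "\<forall>n. \<exists>H. H_set (h (s n)) H \<and> Y n = {x. g (pp (s n) x) \<in> H}" by blast
    then obtain H where H: "\<And>n. H_set (h (s n)) (H n)" "\<And>n. Y n = {x. g (pp (s n) x) \<in> H n}" by metis
    obtain q where eq: "e = prog_code q" using phi_SomeE[OF lim.hyps(1)] by blast
    then have q: "e = prog_code q" "run {} q n = Some (s n)" for n
      using lim.hyps(1)[of n] by simp_all
    define l :: nat where "l = 3 * 5 ^ comp_code (prog_code ph) e"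
    have e': "phi {} (comp_code (prog_code ph) e) n = Some (h (s n))" for n
      by (simp add: q prog_code_eq_codes h(1))
    have l: "kleene_O l" unfolding l_def
      using e' h(5)[OF lim.hyps(2)] h(6)[OF lim.hyps(3)] by (rule O_lim)
    have Hl: "H_set l (join_seq H)" unfolding l_def join_seq_def
      using l[unfolded l_def] e' H(1) by (rule H_lim)
    have Hh: "H_set (h (3 * 5 ^ e)) (join_seq (\<lambda>n. jumps n (join_seq H)))"
      unfolding h(4) l_def[symmetric] using run_const_prog l Hl by (rule plus_omega_H)
    define u where "u = PairP (CompP pg (PairP (CompP (subst_query Zero q) RightP) LeftP)) RightP"
    have "run A (subst_query Zero q) n = Some (s n)" for A n
      using run_subst_query[of A Zero "{}" q n] q by simp
    then have u: "run A u y = Some (pp (g (pp (s (p2 y)) (p1 y))) (p2 y))" for A y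
      by (simp add: u_def run)
    have uc: "uc (prog_code pg) e = prog_code u"
      by (simp add: uc_def u_def q subst_code prog_code_eq_codes)
    have "join_seq Y = {y. pp (g (pp (s (p2 y)) (p1 y))) (p2 y) \<in> join_seq H}"
      by (auto simp: join_seq_iff H(2))
    then have "x \<in> M \<longleftrightarrow> qL (pp (prog_code u) x) \<in> jumps kL (join_seq H)" for x
      unfolding *(3) using qL(2)[OF u] by (simp only:)
    moreover have "g (pp (3 * 5 ^ e) x) = pp (qL (pp (prog_code u) x)) kL" for x
      by (simp add: g_def G_def Let_def uc)
    ultimately have "M = {x. g (pp (3 * 5 ^ e) x) \<in> join_seq (\<lambda>n. jumps n (join_seq H))}"
      by auto
    with Hh show ?case by blast
  qed
  from this[OF a] obtain H where H: "H_set (h a) H" "M = {x. g (pp a x) \<in> H}" by blast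
  have "cf g" using run unfolding cf_def by blast
  then have "rc 0 (\<lambda>A x. g (pp a x))" by (rule rc_cf) (intro rc_pair rc_const rc_id)
  then have "cf (\<lambda>x. g (pp a x))" by (simp add: cf_rc0)
  with H h(5)[OF a(1)] show ?thesis unfolding HYP_iff_many_one by blast
qed

lemma HYP_arithmetical:
  assumes "Z \<in> HYP" "arp P"
  shows "{x. P Z x} \<in> HYP"
proof -
  obtain a H c where a: "kleene_O a" "H_set a H" "cf c" "Z = {x. c x \<in> H}"
    using assms(1) unfolding HYP_iff_many_one by blast
  obtain u where u: "\<And>A y. run A u y = Some (c y)" using a(3) unfolding cf_def by blast
  obtain q k where q: "cf q" "\<And>u f A x. (\<And>A y. run A u y = Some (f y)) \<Longrightarrow>
     P {y. f y \<in> A} x \<longleftrightarrow> q (pp (prog_code u) x) \<in> jumps k A"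
    using arithmetical_reduction[OF assms(2)] by metis
  have "{x. P Z x} = {x. q (pp (prog_code u) x) \<in> jumps k H}"
    using q(2)[OF u] a(4) by auto
  moreover have "cf (\<lambda>x. q (pp (prog_code u) x))"
    unfolding cf_rc0 by (intro rc_cf[OF q(1)] rc_pair rc_const rc_id)
  ultimately show ?thesis using tower_O[OF a(1)] tower_H[OF a(2)] unfolding HYP_iff_many_one by blast
qed

lemma empty_HYP: "{} \<in> HYP"
proof -
  have "cf (\<lambda>x. x)" unfolding cf_rc0 by (rule rc_id)
  then show ?thesis unfolding HYP_iff_many_one
    by (intro exI[of _ 1] exI[of _ "{}"] exI[of _ "\<lambda>x. x"]) (auto intro: O_zero H_zero simp del: One_nat_def)
qed

lemma HYP_static: "arp (\<lambda>A. c) \<Longrightarrow> {x. c x} \<in> HYP"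
  using HYP_arithmetical[OF empty_HYP, of "\<lambda>A. c"] by simp

section \<open>Closure of HYP under joins\<close>

definition join :: "nat set \<Rightarrow> nat set \<Rightarrow> nat set" where
  "join X Y = {z. if even z then z div 2 \<in> X else z div 2 \<in> Y}"

lemma join_simps [simp]: "2 * x \<in> join X Y \<longleftrightarrow> x \<in> X" "Suc (2 * x) \<in> join X Y \<longleftrightarrow> x \<in> Y"
  by (auto simp: join_def)

text \<open>The notations belonging to \<open>X\<close> and \<open>Y\<close> need not be comparable.
  Instead the hierarchy along the notation for \<open>Y\<close> is rebuilt starting from
  \<open>join X {}\<close>, with \<open>X\<close> carried along in the even half.\<close>

lemma HYP_join:
  assumes "X \<in> HYP" "Y \<in> HYP"
  shows "join X Y \<in> HYP"
proof -
  obtain b H c where b: "kleene_O b" "H_set b H" "cf c" "Y = {x. c x \<in> H}"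
    using assms(2) unfolding HYP_iff_many_one by blast
  define Op where "Op M = join {x. 2 * x \<in> M} (turing_jump {q. 2 * q + 1 \<in> M})" for M
  \<comment> \<open>Every column of the join contains \<open>X\<close>, so it is recovered from
    column 0; the odd halves are joined.\<close>
  define Lp where "Lp N = join {x. pp (2 * x) 0 \<in> N} {z. pp (2 * p1 z + 1) (p2 z) \<in> N}" for N
  have Op: "arp (\<lambda>A x. x \<in> Op A)" unfolding Op_def join_def mem_Collect_eq
    by (intro ar_intros arp_mem)
  have Lp: "arp (\<lambda>A x. x \<in> Lp A)" unfolding Lp_def join_def mem_Collect_eq
    by (intro ar_intros arp_mem)
  have "M = join X H'" if "iter_set {} turing_jump (\<lambda>N. N) b H'" "iter_set (join X {}) Op Lp b M" for b H' M
    using that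
  proof (induction arbitrary: M rule: iter_set.induct)
    case iter_zero
    then show ?case by (simp add: iter_set_1D)
  next
    case (iter_succ a H')
    then have "a \<noteq> 0" by (metis iter_set_not_0)
    then obtain M' where "M = Op M'" "iter_set (join X {}) Op Lp a M'" using iter_set_succD iter_succ.prems by blast
    then have "M = Op (join X H')" using iter_succ.IH by blast
    then show ?case by (simp add: Op_def)
  next
    case (iter_lim e s Y)
    then obtain s' Y' where *: "\<forall>n. phi {} e n = Some (s' n)" "\<And>n. iter_set (join X {}) Op Lp (s' n) (Y' n)"
      "M = Lp (join_seq Y')" using iter_set_limD by meson
    have "s' = s" using iter_lim.hyps(1) *(1) by (simp add: fun_eq_iff)
    then have "Y' n = join X (Y n)" for n using iter_lim.IH *(2) by blast
    then show ?case using *(3) by (auto simp: Lp_def join_def join_seq_iff)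
  qed
  moreover have "join X {} \<in> HYP"
  proof -
    have "arp (\<lambda>A x. even x \<and> x div 2 \<in> A)" by (intro ar_intros arp_mem)
    moreover have "join X {} = {x. even x \<and> x div 2 \<in> X}" by (auto simp: join_def)
    ultimately show ?thesis using HYP_arithmetical[OF assms(1)] by simp
  qed
  ultimately have J: "join X H \<in> HYP"
    using iter_set_HYP[OF _ Op Lp b(1)] iter_set_exists[OF b(1)] H_set_imp_iter_set[OF b(2)] by metis
  have "arp (\<lambda>A x. x \<in> join {y. 2 * y \<in> A} {y. 2 * c y + 1 \<in> A})"
    unfolding join_def mem_Collect_eq by (intro ar_intros arp_mem ar_cf[OF b(3)])
  from HYP_arithmetical[OF J this] show ?thesis by (simp add: b(4))
qed


section \<open>A tree with an infinite path but no hyperarithmetic path\<close>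

abbreviation H_iter :: "nat \<Rightarrow> nat set \<Rightarrow> bool" where
  "H_iter \<equiv> iter_set {} turing_jump (\<lambda>N. N)"

text \<open>One set \<open>K\<close> codes a partial hierarchy: tag 0 lists the notations present,
  tag 1 their sets. Tag 2 is reserved for the families that the stages store.\<close>

definition dom_of :: "nat set \<Rightarrow> nat set" where "dom_of K = {a. pp 0 a \<in> K}"
definition col :: "nat set \<Rightarrow> nat \<Rightarrow> nat set" where "col K a = {m. pp 1 (pp a m) \<in> K}"

definition new_dom :: "nat set \<Rightarrow> nat set" where
  "new_dom K = {b. b = 1 \<or> (\<exists>c. c \<noteq> 0 \<and> b = 2 ^ c \<and> c \<in> dom_of K) \<or>
     (\<exists>e. b = 3 * 5 ^ e \<and> (\<forall>n. \<exists>y. phi {} e n = Some y \<and> y \<in> dom_of K))}"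

definition new_col :: "nat set \<Rightarrow> nat \<Rightarrow> nat set" where
  "new_col K b = {m. (\<exists>c. c \<noteq> 0 \<and> b = 2 ^ c \<and> m \<in> turing_jump (col K c)) \<or>
     (\<exists>e y. b = 3 * 5 ^ e \<and> phi {} e (p2 m) = Some y \<and> p1 m \<in> col K y)}"

text \<open>Only closure under one step is required, no minimality; this keeps the condition
  arithmetical, and still every closed \<open>Z\<close> contains all true iterates.\<close>

definition hier_closed :: "nat set \<Rightarrow> bool" where
  "hier_closed Z \<longleftrightarrow> (\<forall>b. b \<in> new_dom Z \<longrightarrow> b \<in> dom_of Z \<and> (\<forall>m. m \<in> col Z b \<longleftrightarrow> m \<in> new_col Z b))"

lemma arp_phi_empty:
  "ar e \<Longrightarrow> ar f \<Longrightarrow> ar g \<Longrightarrow> arp (\<lambda>A x. phi {} (e A x) (f A x) = Some (g A x))"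
  unfolding empty_def by (intro arp_phi ar_const)

lemma arp_new_dom:
  assumes "ar2 Q" "ar f"
  shows "arp (\<lambda>A x. f A x \<in> new_dom {y. Q A x y})"
proof -
  have "arp (\<lambda>A z. p2 z \<in> new_dom {y. Q A (p1 z) y})"
    unfolding new_dom_def dom_of_def mem_Collect_eq
    by (intro ar_intros ar2_app[OF assms(1)] arp_phi_empty)
  from ar_comp[OF this ar_pair[OF ar_id assms(2)]] show ?thesis by simp
qed

lemma arp_new_col:
  assumes "ar2 Q" "ar f" "ar g"
  shows "arp (\<lambda>A x. f A x \<in> new_col {y. Q A x y} (g A x))"
proof -
  have "arp (\<lambda>A z. p1 (p2 z) \<in> new_col {y. Q A (p1 z) y} (p2 (p2 z)))"
    unfolding new_col_def col_def mem_Collect_eq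
    by (intro ar_intros ar2_app[OF assms(1)] arp_phi_empty)
  from ar_comp[OF this ar_pair[OF ar_id ar_pair[OF assms(2,3)]]] show ?thesis by simp
qed

lemma arp_hier_closed: "arp (\<lambda>A x. hier_closed A)"
proof -
  have Q: "ar2 (\<lambda>A x y. y \<in> A)" unfolding ar2_def by (intro arp_mem ar_intros)
  have "arp (\<lambda>A x. hier_closed {y. y \<in> A})"
    unfolding hier_closed_def dom_of_def col_def mem_Collect_eq
    by (intro ar_intros arp_mem arp_new_dom[OF Q] arp_new_col[OF Q])
  then show ?thesis by simp
qed

lemma hier_closed_H:
  assumes "hier_closed Z" "H_iter a X"
  shows "a \<in> dom_of Z \<and> col Z a = X"
  using assms(2)
proof (induction rule: iter_set.induct)
  case iter_zero
  have "1 \<in> new_dom Z" by (simp add: new_dom_def)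
  moreover have "new_col Z 1 = {}" by (auto simp: new_col_def dest: sym)
  ultimately show ?case using assms(1) unfolding hier_closed_def by blast
next
  case (iter_succ a M)
  then have "a \<noteq> 0" by (metis iter_set_not_0)
  with iter_succ.IH have "2 ^ a \<in> new_dom Z" by (auto simp: new_dom_def)
  moreover have "new_col Z (2 ^ a) = turing_jump M"
    using \<open>a \<noteq> 0\<close> iter_succ.IH by (auto simp: new_col_def)
  ultimately show ?case using assms(1) unfolding hier_closed_def by blast
next
  case (iter_lim e s Y)
  then have "3 * 5 ^ e \<in> new_dom Z" by (auto simp: new_dom_def)
  moreover have "new_col Z (3 * 5 ^ e) = join_seq Y"
    using iter_lim by (auto simp: new_col_def join_seq_iff)
  ultimately show ?case using assms(1) unfolding hier_closed_def by blast
qed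

text \<open>All iterates are collected at once; they do not clash because the iterate at a number is
  unique.\<close>

lemma hier_closed_exists: "\<exists>Z. hier_closed Z"
proof
  define Z where "Z = {z. (p1 z = 0 \<and> (\<exists>X. H_iter (p2 z) X)) \<or>
     (p1 z = 1 \<and> (\<exists>X. H_iter (p1 (p2 z)) X \<and> p2 (p2 z) \<in> X))}"
  have dom: "a \<in> dom_of Z \<longleftrightarrow> (\<exists>X. H_iter a X)" for a by (simp add: Z_def dom_of_def)
  have col: "col Z a = X" if "H_iter a X" for a X
  proof -
    have "m \<in> col Z a \<longleftrightarrow> (\<exists>X'. H_iter a X' \<and> m \<in> X')" for m by (simp add: Z_def col_def)
    then show ?thesis using that iter_set_unique by blast
  qed
  show "hier_closed Z" unfolding hier_closed_def
  proof (intro allI impI)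
    fix b assume "b \<in> new_dom Z"
    then consider "b = 1" | c where "c \<noteq> 0" "b = 2 ^ c" "c \<in> dom_of Z"
      | e where "b = 3 * 5 ^ e" "\<forall>n. \<exists>y. phi {} e n = Some y \<and> y \<in> dom_of Z"
      by (auto simp: new_dom_def)
    then have "\<exists>X. H_iter b X \<and> new_col Z b = X"
    proof cases
      case 1
      have "new_col Z 1 = {}" by (auto simp: new_col_def dest: sym)
      then show ?thesis using iter_zero 1 by metis
    next
      case 2
      then obtain X where X: "H_iter c X" using dom by blast
      have "new_col Z b = turing_jump X" using 2 col[OF X] by (auto simp: new_col_def)
      then show ?thesis using iter_succ[OF X] 2 by simp
    next
      case 3
      then obtain s where s: "\<And>n. phi {} e n = Some (s n)" "\<And>n. s n \<in> dom_of Z" by metis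
      then have "\<forall>n. \<exists>X. H_iter (s n) X" using dom by blast
      then obtain Y where Y: "\<And>n. H_iter (s n) (Y n)" by metis
      have "new_col Z b = join_seq Y" using 3 col[OF Y] s by (auto simp: new_col_def join_seq_iff)
      then show ?thesis using iter_lim[OF s(1) Y] 3 by simp
    qed
    then show "b \<in> dom_of Z \<and> (\<forall>m. (m \<in> col Z b) = (m \<in> new_col Z b))"
      using dom col by blast
  qed
qed

text \<open>The diagonal set of pairs \<open>pp e a\<close> for which program \<open>e\<close> with
  oracle \<open>col Z a\<close> does not answer 1 on that very pair is arithmetical in
  \<open>Z\<close>. If \<open>Z\<close> were in HYP, some H-set would decide it, and that H-set is a
  column of \<open>Z\<close>.\<close>

lemma hier_closed_not_HYP:
  assumes "hier_closed Z"
  shows "Z \<notin> HYP"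
proof
  assume "Z \<in> HYP"
  moreover have "arp (\<lambda>A x. \<not> phi (col A (p2 x)) (p1 x) x = Some 1)"
    unfolding col_def by (intro ar_intros arp_mem)
  ultimately have "{x. \<not> phi (col Z (p2 x)) (p1 x) x = Some 1} \<in> HYP" (is "?G \<in> _")
    by (rule HYP_arithmetical)
  then obtain a H e where a: "kleene_O a" "H_set a H" "\<And>n. phi H e n = Some (of_bool (n \<in> ?G))"
    unfolding HYP_def turing_le_def by blast
  have "col Z a = H" using hier_closed_H[OF assms H_set_imp_iter_set[OF a(2)]] by blast
  with a(3)[of "pp e a"] show False by (cases "phi H e (pp e a) = Some 1") auto
qed

text \<open>\<open>E i v\<close> reads "value \<open>v\<close> at \<open>i\<close>". At
  \<open>pp j x\<close> with \<open>j\<close> at most \<open>k\<close> the value 0 means that the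
  subformula fails, and \<open>Suc w\<close> at a positive \<open>j\<close> that it holds with
  Skolem witness \<open>w\<close>; at \<open>pp (Suc k) q\<close> a nonzero value puts
  \<open>q\<close> into \<open>Z\<close>. The clauses refute wrong constants, wrong literals, wrong
  witnesses, overlooked witnesses and a failing root.\<close>

definition conflict :: "(nat \<Rightarrow> nat) \<Rightarrow> nat \<Rightarrow> (nat \<Rightarrow> nat \<Rightarrow> bool) \<Rightarrow> bool" where
  "conflict l k E \<longleftrightarrow>
     (\<exists>x v. E (pp 0 x) v \<and> (l x = 0 \<and> v \<noteq> 0 \<or> l x = 1 \<and> v = 0)) \<or>
     (\<exists>x v v'. 2 \<le> l x \<and> E (pp 0 x) v \<and> E (pp (Suc k) (l x div 2 - 1)) v' \<and>
        (v = 0 \<longleftrightarrow> (if even (l x) then v' \<noteq> 0 else v' = 0))) \<or>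
     (\<exists>j x w v. j < k \<and> E (pp (Suc j) x) (Suc w) \<and> E (pp j (pp x w)) v \<and> v \<noteq> 0) \<or>
     (\<exists>j x n. j < k \<and> E (pp (Suc j) x) 0 \<and> E (pp j (pp x n)) 0) \<or>
     E (pp k 0) 0"

lemma conflictI:
  "E (pp 0 x) v \<Longrightarrow> l x = 0 \<Longrightarrow> v \<noteq> 0 \<Longrightarrow> conflict l k E"
  "E (pp 0 x) 0 \<Longrightarrow> l x = 1 \<Longrightarrow> conflict l k E"
  "2 \<le> l x \<Longrightarrow> E (pp 0 x) v \<Longrightarrow> E (pp (Suc k) (l x div 2 - 1)) v' \<Longrightarrow>
     (v = 0 \<longleftrightarrow> (if even (l x) then v' \<noteq> 0 else v' = 0)) \<Longrightarrow> conflict l k E"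
  "j < k \<Longrightarrow> E (pp (Suc j) x) (Suc w) \<Longrightarrow> E (pp j (pp x w)) v \<Longrightarrow> v \<noteq> 0 \<Longrightarrow> conflict l k E"
  "j < k \<Longrightarrow> E (pp (Suc j) x) 0 \<Longrightarrow> E (pp j (pp x n)) 0 \<Longrightarrow> conflict l k E"
  "E (pp k 0) 0 \<Longrightarrow> conflict l k E"
  unfolding conflict_def by blast+

text \<open>Each clause inspects at most two values. Being free of conflicts is thus a closed
  condition, the one that defines the tree.\<close>

lemma conflict_finite:
  assumes "conflict l k E"
  shows "\<exists>n. \<forall>E'. (\<forall>i v. i < n \<longrightarrow> E i v \<longrightarrow> E' i v) \<longrightarrow> conflict l k E'"
proof -
  have "\<exists>i i'. \<forall>E'. (\<forall>v. E i v \<longrightarrow> E' i v) \<longrightarrow> (\<forall>v. E i' v \<longrightarrow> E' i' v) \<longrightarrow> conflict l k E'"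
    using assms unfolding conflict_def[of l k E]
  proof (elim disjE exE conjE)
    fix x v assume "E (pp 0 x) v" "l x = 0" "v \<noteq> 0"
    then show ?thesis
      by (intro exI[of _ "pp 0 x"] exI[of _ "pp 0 x"]) (unfold conflict_def, blast)
  next
    fix x v assume "E (pp 0 x) v" "l x = 1" "v = 0"
    then show ?thesis
      by (intro exI[of _ "pp 0 x"] exI[of _ "pp 0 x"]) (unfold conflict_def, blast)
  next
    fix x v v' assume "2 \<le> l x" "E (pp 0 x) v" "E (pp (Suc k) (l x div 2 - 1)) v'"
      "v = 0 \<longleftrightarrow> (if even (l x) then v' \<noteq> 0 else v' = 0)"
    then show ?thesis
      by (intro exI[of _ "pp 0 x"] exI[of _ "pp (Suc k) (l x div 2 - 1)"]) (unfold conflict_def, blast)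
  next
    fix j x w v assume "j < k" "E (pp (Suc j) x) (Suc w)" "E (pp j (pp x w)) v" "v \<noteq> 0"
    then show ?thesis
      by (intro exI[of _ "pp (Suc j) x"] exI[of _ "pp j (pp x w)"]) (unfold conflict_def, blast)
  next
    fix j x n assume "j < k" "E (pp (Suc j) x) 0" "E (pp j (pp x n)) 0"
    then show ?thesis
      by (intro exI[of _ "pp (Suc j) x"] exI[of _ "pp j (pp x n)"]) (unfold conflict_def, blast)
  next
    assume "E (pp k 0) 0"
    then show ?thesis by (intro exI[of _ "pp k 0"] exI[of _ "pp k 0"]) (unfold conflict_def, blast)
  qed
  then obtain i i' where *: "\<forall>E'. (\<forall>v. E i v \<longrightarrow> E' i v) \<longrightarrow> (\<forall>v. E i' v \<longrightarrow> E' i' v) \<longrightarrow> conflict l k E'"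
    by (elim exE)
  show ?thesis
  proof (rule exI[of _ "Suc (max i i')"], intro allI impI)
    fix E' assume "\<forall>j v. j < Suc (max i i') \<longrightarrow> E j v \<longrightarrow> E' j v"
    then show "conflict l k E'" by (intro *[rule_format]) auto
  qed
qed

lemma no_conflict_sat:
  assumes "\<not> conflict l k (\<lambda>i v. f i = v)"
  shows "sat {w. f (pp (Suc k) w) \<noteq> 0} l k 0"
proof -
  let ?Z = "{w. f (pp (Suc k) w) \<noteq> 0}"
  have "f (pp j x) \<noteq> 0 \<longleftrightarrow> sat ?Z l j x" if "j \<le> k" for j x
    using that
  proof (induction j arbitrary: x)
    case 0
    have c: "l x = 0 \<Longrightarrow> f (pp 0 x) = 0" "l x = 1 \<Longrightarrow> f (pp 0 x) \<noteq> 0"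
      "2 \<le> l x \<Longrightarrow> f (pp 0 x) \<noteq> 0 \<longleftrightarrow> (if even (l x) then f (pp (Suc k) (l x div 2 - 1)) \<noteq> 0
         else f (pp (Suc k) (l x div 2 - 1)) = 0)"
      using assms conflictI(1-3)[where E="\<lambda>i v. f i = v"] by (metis, metis, metis)
    consider "l x = 0" | "l x = 1" | "2 \<le> l x" by linarith
    then show ?case using c by cases (auto simp: lit_def)
  next
    case (Suc j)
    show ?case
    proof (cases "f (pp (Suc j) x)")
      case 0
      then have "f (pp j (pp x n)) \<noteq> 0" for n
        using assms Suc.prems conflictI(5)[where E="\<lambda>i v. f i = v"] by (metis Suc_le_eq)
      then show ?thesis using 0 Suc by auto
    next
      case (Suc w)
      then have "f (pp j (pp x w)) = 0"
        using assms Suc.prems conflictI(4)[where E="\<lambda>i v. f i = v"] by (metis Suc_le_eq)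
      then have "\<not> sat ?Z l j (pp x w)" using Suc.IH[of "pp x w"] Suc.prems by simp
      then show ?thesis using Suc by auto
    qed
  qed
  moreover have "f (pp k 0) \<noteq> 0" using assms conflictI(6)[where E="\<lambda>i v. f i = v"] by blast
  ultimately show ?thesis by blast
qed

lemma sat_no_conflict:
  assumes "sat Z l k 0"
  shows "\<exists>f. \<not> conflict l k (\<lambda>i v. f i = v)"
proof -
  define f where "f i = (let j = p1 i; x = p2 i in
     if j = Suc k then of_bool (x \<in> Z) else if j = 0 then of_bool (lit Z (l x))
     else if sat Z l j x then Suc (SOME n. \<not> sat Z l (j - 1) (pp x n)) else 0)" for i
  have f0: "f (pp 0 x) = of_bool (lit Z (l x))" and fk: "f (pp (Suc k) x) = of_bool (x \<in> Z)" for x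
    by (simp_all add: f_def)
  have fS: "f (pp (Suc j) x) = (if sat Z l (Suc j) x then Suc (SOME n. \<not> sat Z l j (pp x n)) else 0)" if "j < k" for j x
    using that by (simp add: f_def)
  have f: "f (pp j x) \<noteq> 0 \<longleftrightarrow> sat Z l j x" if "j \<le> k" for j x
    using that by (cases j) (auto simp: f0 fS)
  have "f (pp j (pp x w)) = 0" if "j < k" "f (pp (Suc j) x) = Suc w" for j x w
  proof -
    have "\<exists>n. \<not> sat Z l j (pp x n)" and w: "w = (SOME n. \<not> sat Z l j (pp x n))"
      using that fS by (auto split: if_splits)
    then have "\<not> sat Z l j (pp x w)" using someI_ex by metis
    then show ?thesis using f[of j "pp x w"] that by auto
  qed
  moreover have "f (pp j (pp x n)) \<noteq> 0" if "j < k" "f (pp (Suc j) x) = 0" for j x n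
    using that f[of "Suc j" x] f[of j "pp x n"] by auto
  moreover have "f (pp k 0) \<noteq> 0" using f assms by blast
  ultimately have "\<not> conflict l k (\<lambda>i v. f i = v)"
    unfolding conflict_def by (auto simp: f0 fk lit_def split: if_splits)
  then show ?thesis by blast
qed

text \<open>Nodes are codes of finite value lists that grow by one entry per step. A conflict in the
  limit would already appear in some list, so a path yields a conflict-free assignment and from it a
  closed \<open>Z\<close> arithmetical in the path.\<close>

lemma clock_exists:
  obtains child where "ar2 (\<lambda>A. child)"
    "\<exists>c. c 0 = 0 \<and> (\<forall>n. child (c n) (c (Suc n)))"
    "\<And>c. (\<And>n. child (c n) (c (Suc n))) \<Longrightarrow> {pp n (c n) | n. True} \<notin> HYP"
proof -
  obtain l k where l: "ar (\<lambda>A. l)" and lk: "\<And>A x. hier_closed A \<longleftrightarrow> sat A l k x"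
    using ar_imp_sat[OF arp_hier_closed] by metis
  define good where "good t \<longleftrightarrow> \<not> conflict l k (\<lambda>i v. i < len_code t \<and> nth_code t i = v)" for t
  define child where "child t s \<longleftrightarrow> good s \<and> len_code s = Suc (len_code t) \<and>
      (\<forall>i. i < len_code t \<longrightarrow> nth_code s i = nth_code t i)" for t s
  have "arp (\<lambda>A z. child (p1 z) (p2 z))"
    unfolding child_def good_def conflict_def
    by (intro ar_intros ar_comp[OF l])
  then have "ar2 (\<lambda>A. child)" by (simp add: ar2_def)
  moreover have "\<exists>c. c 0 = 0 \<and> (\<forall>n. child (c n) (c (Suc n)))"
  proof -
    obtain f where f: "\<not> conflict l k (\<lambda>i v. f i = v)"
      using sat_no_conflict hier_closed_exists lk by metis
    define c where "c n = list_encode (map f [0..<n])" for n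
    have c: "len_code (c n) = n" "\<And>i. i < n \<Longrightarrow> nth_code (c n) i = f i" for n
      by (simp_all add: c_def)
    have "good (c n)" for n
    proof (rule ccontr)
      assume "\<not> good (c n)"
      then have "conflict l k (\<lambda>i v. i < len_code (c n) \<and> nth_code (c n) i = v)" by (simp add: good_def)
      from conflict_finite[OF this] obtain m
        where *: "\<forall>E'. (\<forall>i v. i < m \<longrightarrow> i < len_code (c n) \<and> nth_code (c n) i = v \<longrightarrow> E' i v) \<longrightarrow> conflict l k E'"
        by (elim exE)
      from *[rule_format, of "\<lambda>i v. f i = v"] f c show False by auto
    qed
    then have "child (c n) (c (Suc n))" for n by (simp add: child_def c)
    moreover have "c 0 = 0" by (simp add: c_def)
    ultimately show ?thesis by blast
  qed
  moreover have "{pp n (c n) | n. True} \<notin> HYP" if ch: "\<And>n. child (c n) (c (Suc n))" for c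
  proof
    assume G: "{pp n (c n) | n. True} \<in> HYP" (is "?G \<in> _")
    \<comment> \<open>The path may start at any list; after \<open>Suc i\<close> steps the list has
      length at least \<open>Suc i\<close>, and entry \<open>i\<close> no longer changes.\<close>
    define f where "f i = nth_code (c (Suc i)) i" for i
    have len: "len_code (c n) = len_code (c 0) + n" for n
      using ch by (induction n) (auto simp: child_def)
    have nth: "nth_code (c (n + d)) i = nth_code (c n) i" if "i < len_code (c n)" for n d i
    proof (induction d)
      case (Suc d)
      have "i < len_code (c (n + d))" using that len[of n] len[of "n + d"] by simp
      then show ?case using ch[of "n + d"] Suc by (simp add: child_def)
    qed simp
    have f: "nth_code (c n) i = f i" if "i < n" for n i
      using nth[of i "Suc i" "n - Suc i"] that len[of "Suc i"] by (simp add: f_def)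
    have "\<not> conflict l k (\<lambda>i v. f i = v)"
    proof
      assume "conflict l k (\<lambda>i v. f i = v)"
      from conflict_finite[OF this] obtain n
        where *: "\<forall>E'. (\<forall>i v. i < n \<longrightarrow> f i = v \<longrightarrow> E' i v) \<longrightarrow> conflict l k E'" by (elim exE)
      have "conflict l k (\<lambda>i v. i < len_code (c (Suc n)) \<and> nth_code (c (Suc n)) i = v)"
        by (rule *[rule_format]) (auto simp: f len[of "Suc n"])
      then show False using ch[of n] by (simp add: child_def good_def)
    qed
    from no_conflict_sat[OF this] lk have "hier_closed {w. f (pp (Suc k) w) \<noteq> 0}" (is "hier_closed ?Z") by blast
    moreover have "arp (\<lambda>A w. \<exists>t. pp (Suc (pp (Suc k) w)) t \<in> A \<and> nth_code t (pp (Suc k) w) \<noteq> 0)"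
      by (intro ar_intros arp_mem)
    from HYP_arithmetical[OF G this] have "?Z \<in> HYP"
      by (simp add: f_def prod_encode_eq)
    ultimately show False using hier_closed_not_HYP by blast
  qed
  ultimately show ?thesis using that by blast
qed


section \<open>Diagonal coarsenings\<close>

definition is_col :: "nat set \<Rightarrow> nat set \<Rightarrow> bool" where
  "is_col X U \<longleftrightarrow> (\<exists>i. \<forall>x. x \<in> X \<longleftrightarrow> pp i x \<in> U)"

text \<open>A block is represented by its least element, and blocks are numbered in the order of
  these elements.\<close>

definition is_rep :: "nat set \<Rightarrow> nat \<Rightarrow> bool" where
  "is_rep p r \<longleftrightarrow> (\<forall>q. q < r \<longrightarrow> pp q r \<notin> p)"

definition rep_rank :: "nat set \<Rightarrow> nat \<Rightarrow> nat" where
  "rep_rank p r = card {q. q < r \<and> is_rep p q}"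

text \<open>The block of rank 0 contains the number 0, the block of rank 1 is always on the other side, and
  the block of rank \<open>i + 2\<close> makes the partition differ from column \<open>i\<close> of \<open>U\<close>.\<close>

definition diag_side :: "nat set \<Rightarrow> nat set \<Rightarrow> nat set" where
  "diag_side p U = {x. \<exists>r. is_rep p r \<and> pp r x \<in> p \<and>
     (rep_rank p r = 1 \<or> 2 \<le> rep_rank p r \<and> pp (rep_rank p r - 2) (pp 0 r) \<in> U)}"

definition diag :: "nat set \<Rightarrow> nat set \<Rightarrow> nat set" where
  "diag p U = {z. p1 z \<in> diag_side p U \<longleftrightarrow> p2 z \<in> diag_side p U}"

text \<open>An arithmetical description of \<open>partitions 2\<close>: the block of 0 determines
  the relation and is not everything.\<close>

definition two_blocks :: "nat set \<Rightarrow> bool" where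
  "two_blocks X \<longleftrightarrow> (\<exists>y. pp 0 y \<notin> X) \<and> (\<forall>x y. pp x y \<in> X \<longleftrightarrow> (pp 0 x \<in> X \<longleftrightarrow> pp 0 y \<in> X))"

lemma pp_in_partition_code [simp]: "pp x y \<in> partition_code P \<longleftrightarrow> (\<exists>B\<in>P. x \<in> B \<and> y \<in> B)"
  by (auto simp: partition_code_def prod_encode_eq)

lemma set_eq_pp: "X = Y \<longleftrightarrow> (\<forall>x y. pp x y \<in> X \<longleftrightarrow> pp x y \<in> Y)" for X Y :: "nat set"
  by (metis pp_p1_p2 subsetI subset_antisym)

lemma complement_partition:
  assumes "A \<noteq> {}" "A \<noteq> UNIV"
  shows "partition_on UNIV {A, - A}" "block_count {A, - A} = 2"
    "partition_code {A, - A} = {z. p1 z \<in> A \<longleftrightarrow> p2 z \<in> A}"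
proof -
  show "partition_on UNIV {A, - A}" using assms by (auto simp: partition_on_def disjoint_def)
  have "A \<noteq> - A" using assms by blast
  then show "block_count {A, - A} = 2" by (simp add: block_count_def numeral_eq_enat)
  show "partition_code {A, - A} = {z. p1 z \<in> A \<longleftrightarrow> p2 z \<in> A}"
    by (subst set_eq_pp) auto
qed

lemma two_blocks_iff: "two_blocks X \<longleftrightarrow> X \<in> partitions 2"
proof
  assume X: "two_blocks X"
  define A where "A = {x. pp 0 x \<in> X}"
  have iff: "pp x y \<in> X \<longleftrightarrow> (x \<in> A \<longleftrightarrow> y \<in> A)" for x y
    using X unfolding two_blocks_def A_def by blast
  have "0 \<in> A" using iff[of 0 0] by (simp add: A_def)
  moreover have "A \<noteq> UNIV" using X unfolding two_blocks_def A_def by blast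
  moreover have "X = {z. p1 z \<in> A \<longleftrightarrow> p2 z \<in> A}" by (subst set_eq_pp) (simp add: iff)
  ultimately have "X = partition_code {A, - A}" "partition_on UNIV {A, - A}" "block_count {A, - A} = 2"
    using complement_partition[of A] by (auto simp only:)
  then show "X \<in> partitions 2" unfolding partitions_def by blast
next
  assume "X \<in> partitions 2"
  then obtain P where P: "X = partition_code P" "partition_on UNIV P" "block_count P = 2"
    unfolding partitions_def by blast
  then have "card P = 2" by (auto simp: block_count_def numeral_eq_enat split: if_splits)
  then obtain B C where BC: "P = {B, C}" "B \<noteq> C" by (auto simp: card_2_iff)
  have u: "B \<union> C = UNIV" "B \<inter> C = {}" "B \<noteq> {}" "C \<noteq> {}"
    using P(2) BC by (auto simp: partition_on_def disjoint_def)
  have C: "C = - B" using u by blast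
  show "two_blocks X"
    using u(3,4) unfolding two_blocks_def P(1) BC(1) C by (cases "0 \<in> B") auto
qed

lemma rank_surj:
  fixes R :: "nat \<Rightarrow> bool"
  assumes "infinite {r. R r}"
  shows "\<exists>r. R r \<and> card {q. q < r \<and> R q} = n"
proof (induction n)
  case 0
  have "\<exists>r. R r" using assms by (metis Collect_empty_eq finite.emptyI)
  then have "R (LEAST r. R r)" "{q. q < (LEAST r. R r) \<and> R q} = {}"
    by (auto intro: LeastI_ex dest: not_less_Least)
  then show ?case by (metis card.empty)
next
  case (Suc n)
  then obtain r where r: "R r" "card {q. q < r \<and> R q} = n" by blast
  have ex: "\<exists>t. r < t \<and> R t" using assms by (auto simp: infinite_nat_iff_unbounded)
  define t where "t = (LEAST t. r < t \<and> R t)"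
  have t: "r < t" "R t" using LeastI_ex[OF ex] by (auto simp: t_def)
  have "\<not> (r < q \<and> R q)" if "q < t" for q using that not_less_Least unfolding t_def by blast
  then have "{q. q < t \<and> R q} = insert r {q. q < r \<and> R q}" using t r by (auto simp: not_less le_less)
  then show ?case using t r by (intro exI[of _ t]) simp
qed

lemma diag_coarsening:
  assumes "p \<in> partitions \<infinity>"
  shows "diag p U \<in> coarsenings p 2" "diag p U \<in> partitions 2" "\<not> is_col (diag p U) U"
proof -
  obtain P where P: "p = partition_code P" "partition_on UNIV P" "infinite P"
    using assms by (auto simp: partitions_def block_count_def split: if_splits)
  have refl: "pp x x \<in> p" for x using P(2) by (auto simp: P(1) partition_on_def)
  have sym: "pp x y \<in> p \<Longrightarrow> pp y x \<in> p" for x y by (auto simp: P(1))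
  have trans: "pp x y \<in> p \<Longrightarrow> pp y z \<in> p \<Longrightarrow> pp x z \<in> p" for x y z
  proof -
    assume "pp x y \<in> p" "pp y z \<in> p"
    then obtain B C where "B \<in> P" "x \<in> B" "y \<in> B" "C \<in> P" "y \<in> C" "z \<in> C" by (auto simp: P(1))
    moreover from this have "B = C" using P(2) unfolding partition_on_def disjoint_def by blast
    ultimately show "pp x z \<in> p" by (auto simp: P(1))
  qed
  have rep_unique: "r = r'" if "is_rep p r" "is_rep p r'" "pp r r' \<in> p" for r r'
    using that sym unfolding is_rep_def by (metis linorder_neqE_nat)
  have rep_ex: "\<exists>r. is_rep p r \<and> pp r x \<in> p" for x
  proof -
    have "pp (LEAST r. pp r x \<in> p) x \<in> p" using refl by (rule LeastI)
    moreover have "is_rep p (LEAST r. pp r x \<in> p)"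
      unfolding is_rep_def using calculation trans not_less_Least by blast
    ultimately show ?thesis by blast
  qed
  have inf: "infinite {r. is_rep p r}"
  proof
    assume fin: "finite {r. is_rep p r}"
    have "P \<subseteq> (\<lambda>r. {x. pp r x \<in> p}) ` {r. is_rep p r}"
    proof
      fix B assume B: "B \<in> P"
      then have "B \<noteq> {}" using P(2) unfolding partition_on_def by blast
      then obtain x where x: "x \<in> B" by blast
      obtain r where r: "is_rep p r" "pp r x \<in> p" using rep_ex by blast
      have C: "C = B" if "C \<in> P" "y \<in> C" "y \<in> B" for C y
        using that B P(2) unfolding partition_on_def disjoint_def by blast
      have "r \<in> B" using r(2) x C by (auto simp: P(1))
      then have "B = {x. pp r x \<in> p}" using B C by (auto simp: P(1))
      then show "B \<in> (\<lambda>r. {x. pp r x \<in> p}) ` {r. is_rep p r}" using r by blast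
    qed
    then show False using fin P(3) finite_subset by blast
  qed
  have rank: "\<exists>r. is_rep p r \<and> rep_rank p r = n" for n
    unfolding rep_rank_def using rank_surj[OF inf] .
  let ?A = "diag_side p U"
  have A: "r \<in> ?A \<longleftrightarrow> rep_rank p r = 1 \<or> 2 \<le> rep_rank p r \<and> pp (rep_rank p r - 2) (pp 0 r) \<in> U"
    if "is_rep p r" for r
    unfolding diag_side_def using that refl rep_unique by auto
  have closed: "y \<in> ?A" if "x \<in> ?A" "pp x y \<in> p" for x y
    using that trans unfolding diag_side_def by blast
  have "is_rep p 0" "rep_rank p 0 = 0" by (auto simp: is_rep_def rep_rank_def)
  then have 0: "0 \<notin> ?A" using A[of 0] by simp
  obtain r1 where "r1 \<in> ?A" using A rank[of 1] by blast
  then have ne: "?A \<noteq> {}" "?A \<noteq> UNIV" using 0 by auto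
  note Q = complement_partition[OF ne]
  have d: "diag p U = partition_code {?A, - ?A}" unfolding Q(3) diag_def ..
  have "\<exists>Y\<in>{?A, - ?A}. B \<subseteq> Y" if "B \<in> P" for B
  proof -
    have B: "pp x y \<in> p" if "x \<in> B" "y \<in> B" for x y using that \<open>B \<in> P\<close> by (auto simp: P(1))
    show ?thesis
    proof (cases "B \<inter> ?A = {}")
      case False
      then obtain x where "x \<in> B" "x \<in> ?A" by blast
      then have "B \<subseteq> ?A" using closed B by blast
      then show ?thesis by blast
    qed blast
  qed
  then have "refines UNIV P {?A, - ?A}" using P(2) Q(1) by (auto simp: refines_def)
  then show "diag p U \<in> coarsenings p 2" unfolding coarsenings_def d using P(1) Q(2) by blast
  show "diag p U \<in> partitions 2" unfolding partitions_def d using Q by blast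
  show "\<not> is_col (diag p U) U"
  proof
    assume "is_col (diag p U) U"
    then obtain i where i: "\<And>x. x \<in> diag p U \<longleftrightarrow> pp i x \<in> U" unfolding is_col_def by blast
    obtain r where r: "is_rep p r" "rep_rank p r = i + 2" using rank by blast
    \<comment> \<open>The number 0 lies off \<open>diag_side\<close>, so \<open>pp 0 r\<close>
      belongs to the coarsening iff \<open>r\<close> is off it too; by the choice of rank this is
      the opposite of what column \<open>i\<close> says about \<open>pp 0 r\<close>.\<close>
    have "pp 0 r \<in> diag p U \<longleftrightarrow> r \<notin> ?A" using 0 by (simp add: diag_def)
    then show False using A[OF r(1)] r(2) i by simp
  qed
qed

section \<open>The stages of the hierarchy\<close>

text \<open>The even columns of \<open>U0 K\<close> are the sets decided by programs with an oracle \<open>col K a\<close>, the odd ones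
  the columns of \<open>U2 L\<close> for the stages \<open>L\<close> before \<open>K\<close>.\<close>

definition U0 :: "nat set \<Rightarrow> nat set" where
  "U0 K = {z. if even (p1 z) then phi (col K (p2 (p1 z div 2))) (p1 (p1 z div 2)) (p2 z) = Some 1
     else pp 2 (pp (p1 (p1 z div 2)) (pp (p2 (p1 z div 2)) (p2 z))) \<in> K}"

text \<open>Even columns copy the columns of \<open>U\<close>; column \<open>2 * i + 1\<close> is
  column \<open>i\<close> of \<open>U\<close>, taken as a partition, diagonalized against all of
  \<open>U\<close>.\<close>

definition add_diags :: "nat set \<Rightarrow> nat set" where
  "add_diags U = {z. if even (p1 z) then pp (p1 z div 2) (p2 z) \<in> U
     else p2 z \<in> diag {x. pp (p1 z div 2) x \<in> U} U}"

definition U1 :: "nat set \<Rightarrow> nat set" where "U1 K = add_diags (U0 K)"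
definition U2 :: "nat set \<Rightarrow> nat set" where "U2 K = add_diags (U1 K)"

lemma is_col_add_diags: "is_col X U \<Longrightarrow> is_col X (add_diags U)"
  unfolding is_col_def add_diags_def
  by (elim exE, rule_tac x = "2 * i" in exI) simp

lemma is_col_diag: 
  assumes "is_col p U"
  shows "is_col (diag p U) (add_diags U)"
proof -
  obtain i where "\<And>x. x \<in> p \<longleftrightarrow> pp i x \<in> U" using assms unfolding is_col_def by blast
  then have "p = {x. pp i x \<in> U}" by blast
  then show ?thesis unfolding is_col_def add_diags_def by (intro exI[of _ "2 * i + 1"]) simp
qed

text \<open>The data of a notation are written once, when it enters. With them a copy of
  \<open>U2 K\<close> is stored under the new notation, which later serves as an index for finding
  this family again.\<close>

definition Next :: "nat set \<Rightarrow> nat set" where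
  "Next K = {z. z \<in> K \<or>
     p1 z = 0 \<and> p2 z \<in> new_dom K \<and> pp 0 (p2 z) \<notin> K \<or>
     p1 z = 1 \<and> p1 (p2 z) \<in> new_dom K \<and> pp 0 (p1 (p2 z)) \<notin> K \<and> p2 (p2 z) \<in> new_col K (p1 (p2 z)) \<or>
     p1 z = 2 \<and> p1 (p2 z) \<in> new_dom K \<and> pp 0 (p1 (p2 z)) \<notin> K \<and> p2 (p2 z) \<in> U2 K}"

lemma ar2_U0:
  assumes "ar2 Q"
  shows "ar2 (\<lambda>A x y. y \<in> U0 {w. Q A x w})"
  unfolding ar2_def U0_def col_def mem_Collect_eq
  by (intro ar_intros ar2_app[OF assms])

lemma ar2_add_diags:
  assumes "ar2 Q"
  shows "ar2 (\<lambda>A x y. y \<in> add_diags {w. Q A x w})"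
  unfolding ar2_def add_diags_def diag_def diag_side_def rep_rank_def is_rep_def mem_Collect_eq
  by (intro ar_intros ar2_app[OF assms])

lemma ar2_U1: "ar2 Q \<Longrightarrow> ar2 (\<lambda>A x y. y \<in> U1 {w. Q A x w})"
  using ar2_add_diags[OF ar2_U0] by (simp add: U1_def)

lemma ar2_U2: "ar2 Q \<Longrightarrow> ar2 (\<lambda>A x y. y \<in> U2 {w. Q A x w})"
  using ar2_add_diags[OF ar2_U1] by (simp add: U2_def)

lemma ar2_Next:
  assumes "ar2 Q"
  shows "ar2 (\<lambda>A x y. y \<in> Next {w. Q A x w})"
proof -
  have "ar2 (\<lambda>A x y. y \<in> new_dom {w. Q A x w})" 
    using ar2_app[OF assms ar_p1[OF ar_p1[OF ar_id]] ar_p2[OF ar_id]]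
    unfolding ar2_def by (intro arp_new_dom ar_p2 ar_id) (simp add: ar2_def)
  note nd = ar2_app[OF this]
  have nc: "arp (\<lambda>A z. p2 (p2 (p2 z)) \<in> new_col {w. Q A (p1 z) w} (p1 (p2 (p2 z))))"
    using ar2_app[OF assms ar_p1[OF ar_p1[OF ar_id]] ar_p2[OF ar_id]]
    by (intro arp_new_col ar_p1 ar_p2 ar_id) (simp add: ar2_def)
  show ?thesis
    unfolding ar2_def Next_def mem_Collect_eq
    by (intro ar_intros nd nc ar2_app[OF ar2_U2[OF assms]] ar2_app[OF assms])
qed

lemma Next_increasing: "K \<subseteq> Next K" by (auto simp: Next_def)

lemma dom_Next: "dom_of (Next K) = dom_of K \<union> new_dom K"
  by (auto simp: dom_of_def Next_def)

text \<open>A tower in the sense of Zermelo and Bourbaki: transfinite iteration of an inflationary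
  map without ordinals. The empty union starts it. It reaches beyond the stages indexed by
  \<open>kleene_O\<close>, as the ill-founded clock nodes demand.\<close>

inductive stage :: "nat set \<Rightarrow> bool" where
  stage_Next: "stage K \<Longrightarrow> stage (Next K)"
| stage_Union: "(\<And>K. K \<in> M \<Longrightarrow> stage K) \<Longrightarrow> stage (\<Union>M)"

text \<open>The classical double induction for towers: with \<open>K\<close> fixed and no smaller
  stage jumping over it, every stage is comparable with \<open>K\<close>. The next lemma then
  discharges the hypothesis by induction on \<open>K\<close>.\<close>

lemma stage_trichotomy_aux:
  assumes "\<And>L. stage L \<Longrightarrow> L \<subset> K \<Longrightarrow> Next L \<subseteq> K" "stage L"
  shows "L \<subseteq> K \<or> Next K \<subseteq> L"
  using assms(2)
proof (induction rule: stage.induct)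
  case (stage_Next L)
  then show ?case using assms(1)[of L] Next_increasing by blast
next
  case (stage_Union M)
  then show ?case by blast
qed

lemma stage_Next_subset: "stage K \<Longrightarrow> stage L \<Longrightarrow> L \<subset> K \<Longrightarrow> Next L \<subseteq> K"
proof (induction arbitrary: L rule: stage.induct)
  case (stage_Next K)
  then have "L \<subseteq> K \<or> Next K \<subseteq> L" by (intro stage_trichotomy_aux) auto
  then show ?case using stage_Next Next_increasing by blast
next
  case (stage_Union M)
  obtain z K' where z: "z \<in> K'" "z \<notin> L" "K' \<in> M" using stage_Union.prems by blast
  have "L \<subseteq> K' \<or> Next K' \<subseteq> L"
    using stage_Union.IH[OF z(3)] stage_Union.prems by (intro stage_trichotomy_aux) auto
  then have "L \<subseteq> K'" using z Next_increasing by blast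
  with z have "L \<subset> K'" by blast
  then show ?case using stage_Union.IH[OF z(3)] stage_Union.prems z by blast
qed

lemma stage_trichotomy: "stage K \<Longrightarrow> stage L \<Longrightarrow> L \<subseteq> K \<or> Next K \<subseteq> L"
  using stage_trichotomy_aux stage_Next_subset by metis

lemma stage_linear: "stage K \<Longrightarrow> stage L \<Longrightarrow> K \<subseteq> L \<or> L \<subseteq> K"
  using stage_trichotomy Next_increasing by blast

lemma Next_mono: "stage K \<Longrightarrow> stage L \<Longrightarrow> K \<subseteq> L \<Longrightarrow> Next K \<subseteq> Next L"
  using stage_Next_subset Next_increasing by blast

lemma Next_Int: "stage K \<Longrightarrow> stage L \<Longrightarrow> Next (K \<inter> L) = Next K \<inter> Next L"
  using stage_linear Next_mono by (metis inf.absorb1 inf.absorb2)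

lemma stage_empty: "stage {}"
  using stage_Union[of "{}"] by simp

text \<open>Inclusion is well-founded on stages. \<open>K\<close> carries the induction; the use
  made of it takes \<open>K\<close> equal to \<open>L\<close>.\<close>

lemma stage_least:
  assumes "stage K" "stage L" "L \<subseteq> K" "P L"
  shows "\<exists>L. stage L \<and> P L \<and> (\<forall>L'. stage L' \<longrightarrow> L' \<subset> L \<longrightarrow> \<not> P L')"
  using assms
proof (induction arbitrary: L rule: stage.induct)
  case (stage_Next K)
  show ?case
  proof (cases "\<exists>L'. stage L' \<and> P L' \<and> L' \<subseteq> K")
    case True
    then show ?thesis using stage_Next.IH by blast
  next
    case False
    have "L' \<subseteq> K" if "stage L'" "L' \<subset> L" for L'
      using stage_trichotomy[OF stage_Next.hyps(1) that(1)] that stage_Next.prems by blast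
    then show ?thesis using False stage_Next.prems by (intro exI[of _ L]) metis
  qed
next
  case (stage_Union M)
  show ?case
  proof (cases "\<exists>K L'. K \<in> M \<and> stage L' \<and> P L' \<and> L' \<subseteq> K")
    case True
    then show ?thesis using stage_Union.IH by blast
  next
    case False
    have "\<exists>K\<in>M. L' \<subseteq> K" if "stage L'" "L' \<subset> L" for L'
    proof (rule ccontr)
      assume "\<not> (\<exists>K\<in>M. L' \<subseteq> K)"
      then have "K \<subseteq> L'" if "K \<in> M" for K
        using stage_linear[OF stage_Union.hyps[OF that] \<open>stage L'\<close>] that by blast
      then show False using that(2) stage_Union.prems by blast
    qed
    then show ?thesis using False stage_Union.prems by (intro exI[of _ L]) metis
  qed
qed

lemma stage_fixpoint:
  assumes "stage L" "Next L = L" "stage K"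
  shows "K \<subseteq> L"
  using assms(3)
proof (induction rule: stage.induct)
  case (stage_Next K)
  then show ?case using Next_mono[OF stage_Next.hyps assms(1)] assms(2) by simp
qed blast

section \<open>What a stage stores about a notation is correct and never revised\<close>

lemma new_col_H:
  assumes "H_iter a X" "a \<in> new_dom K" "\<And>b Y. H_iter b Y \<Longrightarrow> b \<in> dom_of K \<Longrightarrow> col K b = Y"
  shows "new_col K a = X"
  using assms(1)
proof (cases rule: iter_set.cases)
  case iter_zero
  then show ?thesis by (auto simp: new_col_def dest: sym)
next
  case (iter_succ c M)
  then have "c \<noteq> 0" by (metis iter_set_not_0)
  then have "c \<in> dom_of K" using assms(2) iter_succ(1) by (auto simp: new_dom_def)
  then show ?thesis using \<open>c \<noteq> 0\<close> assms(3)[OF iter_succ(3)] iter_succ by (auto simp: new_col_def)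
next
  case (iter_lim e s Y)
  have d: "s n \<in> dom_of K" for n using assms(2) iter_lim by (auto simp: new_dom_def dest: sym)
  show ?thesis using assms(3)[OF iter_lim(4) d] iter_lim by (auto simp: new_col_def join_seq_iff)
qed

lemma stage_support: "stage K \<Longrightarrow> a \<notin> dom_of K \<Longrightarrow> pp 1 (pp a m) \<notin> K \<and> pp 2 (pp a y) \<notin> K"
  by (induction rule: stage.induct) (auto simp: Next_def dom_of_def prod_encode_eq)

lemma stage_col_H: "stage K \<Longrightarrow> H_iter a X \<Longrightarrow> a \<in> dom_of K \<Longrightarrow> col K a = X"
proof (induction arbitrary: a X rule: stage.induct)
  case (stage_Next K)
  show ?case
  proof (cases "a \<in> dom_of K")
    case True
    then have "col (Next K) a = col K a" by (auto simp: col_def Next_def dom_of_def)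
    then show ?thesis using stage_Next True by simp
  next
    case False
    then have new: "a \<in> new_dom K" using stage_Next.prems dom_Next by blast
    have "col (Next K) a = new_col K a"
      using False new stage_support[OF stage_Next.hyps False] by (auto simp: col_def Next_def dom_of_def)
    then show ?thesis using new_col_H[OF stage_Next.prems(1) new] stage_Next.IH by blast
  qed
next
  case (stage_Union M)
  then obtain K where K: "K \<in> M" "a \<in> dom_of K" by (auto simp: dom_of_def)
  have "m \<in> col K' a \<longleftrightarrow> m \<in> X" if "K' \<in> M" "a \<in> dom_of K'" for K' m
    using stage_Union.IH[OF that(1) stage_Union.prems(1) that(2)] by simp
  moreover have "a \<in> dom_of K'" if "K' \<in> M" "m \<in> col K' a" for K' m
    using stage_support[OF stage_Union.hyps[OF that(1)]] that by (auto simp: col_def)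
  moreover have "col (\<Union>M) a = (\<Union>K\<in>M. col K a)" by (auto simp: col_def)
  ultimately show ?case using K by blast
qed

text \<open>By linearity of the stages \<open>K\<close> is the only stage at which \<open>b\<close>
  is new, so the stored copy can come from no other family.\<close>

lemma stage_old_levels:
  assumes "stage K'" "stage K" "b \<in> new_dom K" "b \<notin> dom_of K" "b \<in> dom_of K'"
  shows "pp 2 (pp b y) \<in> K' \<longleftrightarrow> y \<in> U2 K"
  using assms(1,5)
proof (induction rule: stage.induct)
  case (stage_Next L)
  show ?case
  proof (cases "b \<in> dom_of L")
    case True
    then show ?thesis using stage_Next by (auto simp: Next_def dom_of_def)
  next
    case False
    then have new: "b \<in> new_dom L" using stage_Next.prems dom_Next by blast
    have "\<not> L \<subset> K" using stage_Next_subset[OF assms(2) stage_Next.hyps] assms(4) new dom_Next[of L]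
      by (auto simp: dom_of_def)
    moreover have "\<not> K \<subset> L" using stage_Next_subset[OF stage_Next.hyps assms(2)] False assms(3) dom_Next[of K]
      by (auto simp: dom_of_def)
    ultimately have "L = K" using stage_linear[OF stage_Next.hyps assms(2)] by blast
    then show ?thesis using stage_support[OF assms(2,4)] assms(3,4) by (auto simp: Next_def dom_of_def)
  qed
next
  case (stage_Union M)
  then obtain K where K: "K \<in> M" "b \<in> dom_of K" by (auto simp: dom_of_def)
  have "b \<in> dom_of K'" if "K' \<in> M" "pp 2 (pp b y) \<in> K'" for K'
    using stage_support[OF stage_Union.hyps[OF that(1)]] that by blast
  then show ?case using stage_Union.IH K by blast
qed

text \<open>A stage properly below another is no fixed point of \<open>Next\<close>, so some
  notation \<open>b\<close> enters just after \<open>L\<close>; under this index \<open>U2 L\<close>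
  is stored in \<open>K\<close> and read by the odd columns of \<open>U0 K\<close>.\<close>

lemma stage_captures_earlier:
  assumes "stage L" "stage K" "L \<subset> K" "is_col X (U2 L)"
  shows "is_col X (U0 K)"
proof -
  have "Next L \<noteq> L" using stage_fixpoint[OF assms(1) _ assms(2)] assms(3) by blast
  then obtain b where b: "b \<in> new_dom L" "b \<notin> dom_of L"
    by (auto simp: Next_def dom_of_def)
  have "Next L \<subseteq> K" using stage_Next_subset assms by blast
  then have "b \<in> dom_of K" using b dom_Next[of L] by (auto simp: dom_of_def)
  note old = stage_old_levels[OF assms(2,1) b this]
  obtain i where "\<And>x. x \<in> X \<longleftrightarrow> pp i x \<in> U2 L" using assms(4) unfolding is_col_def by blast
  then show ?thesis unfolding is_col_def U0_def
    by (intro exI[of _ "2 * pp b i + 1"]) (simp add: old)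
qed

text \<open>At limits \<open>Next\<close> is applied before the union: this makes each
  \<open>s n\<close> itself enter the domain, so that the limit notation is ready to enter at the
  next stage.\<close>

abbreviation S_iter :: "nat \<Rightarrow> nat set \<Rightarrow> bool" where
  "S_iter \<equiv> iter_set {} Next (\<lambda>N. \<Union>n. Next {m. pp m n \<in> N})"

lemma S_iter_stage: "S_iter a S \<Longrightarrow> stage S"
  by (induction rule: iter_set.induct) (auto intro!: stage_Union stage_Next stage_empty)

lemma S_iter_new_dom: "S_iter a S \<Longrightarrow> a \<in> new_dom S"
proof (induction rule: iter_set.induct)
  case iter_zero
  then show ?case by (simp add: new_dom_def)
next
  case (iter_succ a M)
  then have "a \<noteq> 0" by (metis iter_set_not_0)
  then show ?case using iter_succ dom_Next[of M] by (auto simp: new_dom_def)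
next
  case (iter_lim e s Y)
  have "s n \<in> dom_of (\<Union>n. Next {m. pp m n \<in> join_seq Y})" for n
    using iter_lim.IH[of n] dom_Next[of "Y n"] by (auto simp: dom_of_def)
  then show ?case using iter_lim.hyps(1) by (auto simp: new_dom_def)
qed

lemma HYP_captured:
  assumes "p \<in> HYP"
  obtains a S where "kleene_O a" "S_iter a S" "is_col p (U0 S)"
proof -
  obtain a H e where a: "kleene_O a" "H_set a H" "\<And>n. phi H e n = Some (of_bool (n \<in> p))"
    using assms unfolding HYP_def turing_le_def by blast
  obtain S where S: "S_iter a S" using iter_set_exists[OF a(1)] by blast
  have S': "S_iter (2 ^ a) (Next S)" using S by (rule iter_succ)
  have "a \<in> dom_of (Next S)" using S_iter_new_dom[OF S] dom_Next by blast
  then have "col (Next S) a = H"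
    using stage_col_H[OF S_iter_stage[OF S'] H_set_imp_iter_set[OF a(2)]] by blast
  then have "is_col p (U0 (Next S))" unfolding is_col_def U0_def
    by (intro exI[of _ "2 * pp e a"]) (simp add: a(3))
  then show ?thesis using that O_succ[OF a(1)] S' by blast
qed

text \<open>Stages indexed by notations form an initial segment of all stages. Hence the level of a
  hyperarithmetic set, defined by minimality among all stages, has a notation.\<close>

lemma S_iter_initial:
  assumes "kleene_O a" "S_iter a S" "stage L" "L \<subseteq> S"
  shows "\<exists>b. kleene_O b \<and> S_iter b L"
  using assms
proof (induction a arbitrary: S rule: kleene_O_induct)
  case zero
  then have "L = {}" using iter_set_1D by fastforce
  then show ?case using O_zero iter_zero by blast
next
  case (succ a)
  obtain S' where S': "S = Next S'" "S_iter a S'"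
    using iter_set_succD[OF succ.prems(1) kleene_O_not_0[OF succ.hyps(1)]] by blast
  show ?case
  proof (cases "L \<subseteq> S'")
    case True
    then show ?thesis using succ.IH[OF S'(2) assms(3)] by blast
  next
    case False
    then have "L = S" using stage_trichotomy[OF S_iter_stage[OF S'(2)] assms(3)] S' succ.prems by blast
    then show ?thesis using succ O_succ by blast
  qed
next
  case (lim e s)
  obtain s' Y where *: "\<forall>n. phi {} e n = Some (s' n)" "\<forall>n. S_iter (s' n) (Y n)"
    "S = (\<Union>n. Next {m. pp m n \<in> join_seq Y})" using iter_set_limD[OF lim.prems(1)] by blast
  have "s' = s" using lim.hyps(1) *(1) by (simp add: fun_eq_iff)
  with * have Y: "\<And>n. S_iter (s n) (Y n)" and S: "S = (\<Union>n. Next (Y n))" by auto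
  show ?case
  proof (cases "\<exists>n. L \<subseteq> Next (Y n)")
    case True
    then obtain n where n: "L \<subseteq> Next (Y n)" by blast
    show ?thesis
    proof (cases "L \<subseteq> Y n")
      case True
      then show ?thesis using lim.IH[OF Y assms(3)] by blast
    next
      case False
      then have "L = Next (Y n)" using stage_trichotomy[OF S_iter_stage[OF Y] assms(3)] n by blast
      then show ?thesis using O_succ[OF lim.hyps(2)] iter_succ[OF Y] by blast
    qed
  next
    case False
    have "Next (Y n) \<subseteq> L" for n
      using stage_linear[OF stage_Next[OF S_iter_stage[OF Y]] assms(3)] False by blast
    then have "L = S" using S lim.prems by blast
    then show ?thesis using lim.prems O_lim[OF lim.hyps(1-3)] by blast
  qed
qed


section \<open>Levels\<close>

definition captured :: "nat set \<Rightarrow> nat set \<Rightarrow> bool" where "captured X K \<longleftrightarrow> is_col X (U2 K)"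

definition level :: "nat set \<Rightarrow> nat set \<Rightarrow> bool" where
  "level X S \<longleftrightarrow> stage S \<and> captured X S \<and> (\<forall>L. stage L \<longrightarrow> L \<subset> S \<longrightarrow> \<not> captured X L)"

lemma level_unique: "level X S \<Longrightarrow> level X S' \<Longrightarrow> S = S'"
  unfolding level_def using stage_linear by blast

lemma is_col_U0_captured: "is_col X (U0 K) \<Longrightarrow> captured X K"
  by (simp add: captured_def U2_def U1_def is_col_add_diags)

lemma level_exists:
  assumes "X \<in> HYP"
  obtains b S where "kleene_O b" "S_iter b S" "level X S"
proof -
  obtain a S where a: "kleene_O a" "S_iter a S" "is_col X (U0 S)" using HYP_captured[OF assms] .
  have S: "stage S" "captured X S" using S_iter_stage[OF a(2)] is_col_U0_captured[OF a(3)] by auto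
  obtain L where L: "stage L" "captured X L" "\<forall>L'. stage L' \<longrightarrow> L' \<subset> L \<longrightarrow> \<not> captured X L'"
    using stage_least[of S S "captured X"] S by blast
  then have "L \<subseteq> S" using stage_linear[OF L(1) S(1)] S by blast
  then obtain b where "kleene_O b" "S_iter b L" using S_iter_initial[OF a(1,2) L(1)] by blast
  then show ?thesis using that L unfolding level_def by blast
qed

lemma S_iter_HYP:
  assumes "kleene_O a" "S_iter a S"
  shows "S \<in> HYP"
proof (rule iter_set_HYP[OF empty_HYP _ _ assms])
  have "ar2 (\<lambda>A (x::nat) y. y \<in> A)" unfolding ar2_def by (intro arp_mem ar_intros)
  from ar2_app[OF ar2_Next[OF this] ar_const[of 0] ar_id] show "arp (\<lambda>A x. x \<in> Next A)" by simp
  have "ar2 (\<lambda>A n m. pp m n \<in> A)" unfolding ar2_def by (intro arp_mem ar_intros)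
  from ar2_app[OF ar2_Next[OF this] ar_p2[OF ar_id] ar_p1[OF ar_id]]
  have "arp (\<lambda>A z. p1 z \<in> Next {m. pp m (p2 z) \<in> A})" .
  from arp_ex[OF this] show "arp (\<lambda>A x. x \<in> (\<Union>n. Next {m. pp m n \<in> A}))" by simp
qed

lemma diag_level:
  assumes "p \<in> partitions \<infinity>" "stage S" "is_col p (U0 S)"
  shows "level (diag p (U0 S)) S" "is_col (diag p (U0 S)) (U1 S)"
    "level (diag p (U1 S)) S" "\<not> is_col (diag p (U1 S)) (U1 S)" "is_col (diag p (U1 S)) (U2 S)"
proof -
  show 1: "is_col (diag p (U0 S)) (U1 S)" using is_col_diag[OF assms(3)] by (simp add: U1_def)
  have "is_col p (U1 S)" using is_col_add_diags[OF assms(3)] by (simp add: U1_def)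
  from is_col_diag[OF this] show 2: "is_col (diag p (U1 S)) (U2 S)" by (simp add: U2_def)
  \<comment> \<open>Capture at an earlier stage would make \<open>X\<close> a column of
    \<open>U0 S\<close>.\<close>
  have lev: "level X S" if "\<not> is_col X (U0 S)" "is_col X (U2 S)" for X
    unfolding level_def captured_def
    using that assms(2) stage_captures_earlier[OF _ assms(2)] by blast
  show "level (diag p (U0 S)) S"
    using diag_coarsening(3)[OF assms(1)] is_col_add_diags[OF 1] by (intro lev) (auto simp: U2_def)
  show n: "\<not> is_col (diag p (U1 S)) (U1 S)" using diag_coarsening(3)[OF assms(1)] .
  then show "level (diag p (U1 S)) S"
    using 2 is_col_add_diags[of "diag p (U1 S)" "U0 S"] by (intro lev) (auto simp: U1_def)
qed

lemma is_col_HYP: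
  assumes "S \<in> HYP" "is_col X (U2 S)"
  shows "X \<in> HYP"
proof -
  obtain i where i: "\<And>x. x \<in> X \<longleftrightarrow> pp i x \<in> U2 S" using assms(2) unfolding is_col_def by blast
  have "ar2 (\<lambda>A (x::nat) y. y \<in> A)" unfolding ar2_def by (intro arp_mem ar_intros)
  from ar2_app[OF ar2_U2[OF this] ar_const[of 0] ar_pair[OF ar_const[of i] ar_id]]
  have "arp (\<lambda>A x. pp i x \<in> U2 A)" by simp
  from HYP_arithmetical[OF assms(1) this] show ?thesis by (simp add: i[symmetric])
qed

section \<open>Uniqueness of hyperarithmetic evaluation maps\<close>

lemma set_code: "{prod_encode (list_encode \<sigma>, h \<sigma>) | \<sigma>. \<sigma> \<in> T} = {z. list_decode (p1 z) \<in> T \<and> p2 z = h (list_decode (p1 z))}"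
proof (intro set_eqI iffI)
  fix z assume "z \<in> {z. list_decode (p1 z) \<in> T \<and> p2 z = h (list_decode (p1 z))}"
  then have "z = pp (list_encode (list_decode (p1 z))) (h (list_decode (p1 z)))" "list_decode (p1 z) \<in> T"
    by (simp_all, metis pp_p1_p2)
  then show "z \<in> {prod_encode (list_encode \<sigma>, h \<sigma>) | \<sigma>. \<sigma> \<in> T}" by blast
qed auto

lemma pair_graph: "{pp x (g x) | x. True} = {z. p2 z = g (p1 z)}"
  by (auto, metis pp_p1_p2)

lemma hyp_fun_iff: "hyp_fun_on UNIV id id g \<longleftrightarrow> {z. p2 z = g (p1 z)} \<in> HYP"
  by (simp add: hyp_fun_on_def pair_graph[symmetric])

lemma eval_map_unique:
  assumes code: "borel_code_HYP T L" and f: "hyp_eval_map T L X f" and f': "hyp_eval_map T L X f'"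
  shows "f [] = f' []"
proof (rule ccontr)
  assume ne: "f [] \<noteq> f' []"
  have T: "is_tree T" using code by (simp add: borel_code_HYP_def)
  define F where "F h = {prod_encode (list_encode \<sigma>, of_bool (h \<sigma>)) | \<sigma>. \<sigma> \<in> T}" for h :: "nat list \<Rightarrow> bool"
  have F: "pp (list_encode \<sigma>) v \<in> F h \<longleftrightarrow> \<sigma> \<in> T \<and> v = of_bool (h \<sigma>)" for \<sigma> v h
    unfolding F_def set_code by simp
  have J: "join (F f) (F f') \<in> HYP"
    using f f' by (intro HYP_join) (auto simp: hyp_eval_map_def hyp_fun_on_def F_def)
  define dis where "dis A c \<longleftrightarrow> (\<exists>v w. 2 * pp c v \<in> A \<and> 2 * pp c w + 1 \<in> A \<and> v \<noteq> w)" for A c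
  have dis: "dis (join (F f) (F f')) (list_encode \<sigma>) \<longleftrightarrow> \<sigma> \<in> T \<and> f \<sigma> \<noteq> f' \<sigma>" for \<sigma>
    by (auto simp: dis_def F)
  define ext where "ext A c d \<longleftrightarrow> len_code d = Suc (len_code c) \<and> (\<forall>i. i < len_code c \<longrightarrow> nth_code d i = nth_code c i) \<and> dis A d" for A c d
  define nxt where "nxt A c = (if \<exists>d. ext A c d then LEAST d. ext A c d else 0)" for A c
  define C where "C A n = rec_nat 0 (\<lambda>i v. nxt A v) n" for A n
  let ?J = "join (F f) (F f')"
  have "arp (\<lambda>A z. ext A (p1 z) (p2 z))" unfolding ext_def dis_def by (intro ar_intros arp_mem)
  then have nxt: "ar nxt" unfolding nxt_def[abs_def] by (rule ar_Least)
  have arC: "ar (\<lambda>A x. C A (h A x))" if "ar h" for h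
    unfolding C_def by (intro ar_rec ar_const ar_comp[OF nxt] ar_p2 ar_id that)
  have step: "\<exists>n. \<sigma> @ [n] \<in> T \<and> f (\<sigma> @ [n]) \<noteq> f' (\<sigma> @ [n])" if "\<sigma> \<in> T" "f \<sigma> \<noteq> f' \<sigma>" for \<sigma>
  proof -
    have "h \<sigma> \<longleftrightarrow> (case L \<sigma> of Clopen ss \<Rightarrow> X \<in> clopen_of ss
         | Cup \<Rightarrow> (\<exists>n. \<sigma> @ [n] \<in> T \<and> h (\<sigma> @ [n])) | Cap \<Rightarrow> (\<forall>n. \<sigma> @ [n] \<in> T \<longrightarrow> h (\<sigma> @ [n])))"
      if "hyp_eval_map T L X h" for h
      using that \<open>\<sigma> \<in> T\<close> unfolding hyp_eval_map_def eval_map_def by blast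
    from this[OF f] this[OF f'] that(2) show ?thesis by (cases "L \<sigma>") auto
  qed
  have ext: "\<exists>n. list_decode (nxt ?J c) = list_decode c @ [n] \<and> dis ?J (nxt ?J c)" if dc: "dis ?J c" for c
  proof -
    obtain n where n: "list_decode c @ [n] \<in> T" "f (list_decode c @ [n]) \<noteq> f' (list_decode c @ [n])"
      using step[of "list_decode c"] dc dis[of "list_decode c"] by auto
    have "ext ?J c (list_encode (list_decode c @ [n]))"
      unfolding ext_def using n dis len_code[of "list_decode c"] nth_code[of _ "list_decode c"]
      by (auto simp: nth_append)
    then have e: "ext ?J c (nxt ?J c)" unfolding nxt_def by (auto intro: LeastI)
    define d where "d = list_decode (nxt ?J c)"
    have "length d = Suc (length (list_decode c))" "\<And>i. i < length (list_decode c) \<Longrightarrow> d ! i = list_decode c ! i"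
      using e len_code[of d] len_code[of "list_decode c"] nth_code[of _ d] nth_code[of _ "list_decode c"]
      unfolding ext_def d_def by auto
    then have "d = list_decode c @ [d ! length (list_decode c)]"
      by (auto intro!: nth_equalityI simp: nth_append less_Suc_eq)
    then show ?thesis using e unfolding d_def ext_def by blast
  qed
  have C: "dis ?J (C ?J n)" for n
  proof (induction n)
    case 0
    have "[] \<in> T" using T by (simp add: is_tree_def)
    then show ?case using dis[of "[]"] ne by (simp add: C_def)
  next
    case (Suc n)
    then show ?case using ext by (simp add: C_def)
  qed
  define g where "g n = nth_code (C ?J (Suc n)) n" for n
  have map: "list_decode (C ?J n) = map g [0..<n]" for n
  proof (induction n)
    case (Suc n)
    obtain m where m: "list_decode (C ?J (Suc n)) = list_decode (C ?J n) @ [m]"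
      using ext[OF C[of n]] by (auto simp: C_def)
    have "C ?J (Suc n) = list_encode (map g [0..<n] @ [m])" by (metis list_decode_inverse m Suc)
    then have "g n = m" unfolding g_def by (simp add: nth_append)
    then show ?case using m Suc by simp
  qed (simp add: C_def)
  have "is_path T g" unfolding is_path_def
    using map C dis by (metis list_decode_inverse)
  moreover have "arp (\<lambda>A z. p2 z = nth_code (C A (Suc (p1 z))) (p1 z))"
    by (intro ar_intros arC)
  from HYP_arithmetical[OF J this] have "{z. p2 z = g (p1 z)} \<in> HYP" by (simp add: g_def)
  then have "hyp_fun_on UNIV id id g"
    by (simp add: hyp_fun_iff)
  ultimately show False using code unfolding borel_code_HYP_def by blast
qed


section \<open>The Borel codes\<close>

definition next_unless :: "nat set \<Rightarrow> nat set \<Rightarrow> nat set" where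
  "next_unless X K = (if captured X K then K else Next K)"

lemma in_next_unless: "y \<in> next_unless X K \<longleftrightarrow> (if captured X K then y \<in> K else y \<in> Next K)"
  by (simp add: next_unless_def)

text \<open>The oracle is the join of a stage \<open>K\<close> and the real \<open>X\<close>.\<close>

definition query :: "nat set \<Rightarrow> nat \<Rightarrow> bool" where
  "query A z \<longleftrightarrow> (let K = {y. 2 * y \<in> A}; X = {y. 2 * y + 1 \<in> A} in
     if p1 z = 0 then p2 z \<in> next_unless X K
     else two_blocks X \<and> (is_col X (U1 K) \<longleftrightarrow> p1 z = 1))"

lemma arp_query: "arp query"
proof -
  have Q: "ar2 (\<lambda>A (x::nat) y. 2 * y \<in> A)" unfolding ar2_def by (intro arp_mem ar_intros)
  show ?thesis
    unfolding query_def[abs_def] Let_def in_next_unless two_blocks_def captured_def is_col_def mem_Collect_eq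
    by (intro ar_intros arp_mem ar2_app[OF ar2_U2[OF Q] ar_const[of 0]]
        ar2_app[OF ar2_U1[OF Q] ar_const[of 0]] ar2_app[OF ar2_Next[OF Q] ar_const[of 0]])
qed

lemma query_join [simp]:
  "query (join K X) (pp 0 y) \<longleftrightarrow> y \<in> next_unless X K"
  "i \<noteq> 0 \<Longrightarrow> query (join K X) (pp i y) \<longleftrightarrow> two_blocks X \<and> (is_col X (U1 K) \<longleftrightarrow> i = 1)"
  by (auto simp: query_def)

definition flip :: "nat \<Rightarrow> nat" where "flip b = (if b = 1 then 0 else 1)"

text \<open>Leaves carry only 0-1 lists, so that the code of the string in the label is the number
  \<open>n\<close> itself.\<close>

definition binary :: "nat \<Rightarrow> bool" where "binary n \<longleftrightarrow> (\<forall>i. i < len_code n \<longrightarrow> nth_code n i \<le> 1)"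

definition string_of :: "nat \<Rightarrow> bool list" where "string_of n = map (\<lambda>x. x \<noteq> 0) (list_decode n)"

lemma list_encode_string_of:
  assumes "binary n"
  shows "list_encode (map of_bool (string_of n)) = n"
proof -
  have "map of_bool (string_of n) = list_decode n"
    unfolding string_of_def
  proof (rule nth_equalityI)
    fix i assume "i < length (map of_bool (map (\<lambda>x. x \<noteq> 0) (list_decode n)) :: nat list)"
    then have i: "i < length (list_decode n)" by simp
    then have "nth_code n i \<le> 1"
      using assms len_code[of "list_decode n"] by (simp add: binary_def)
    then have "list_decode n ! i \<le> 1" using nth_code[OF i] by simp
    then show "(map of_bool (map (\<lambda>x. x \<noteq> 0) (list_decode n)) :: nat list) ! i = list_decode n ! i"
      using i by auto
  qed simp
  then show ?thesis by simp
qed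

lemma in_cone_string_of:
  "X \<in> cone (string_of n) \<longleftrightarrow> (\<forall>i. i < len_code n \<longrightarrow> (nth_code n i \<noteq> 0 \<longleftrightarrow> i \<in> X))"
  using len_code[of "list_decode n"] nth_code[of _ "list_decode n"]
  by (auto simp: cone_def string_of_def)

section \<open>Stages on the nodes of the clock\<close>

locale hyp_clock =
  fixes child :: "nat \<Rightarrow> nat \<Rightarrow> bool" and l :: "nat \<Rightarrow> nat" and k :: nat
  assumes child_ar: "ar2 (\<lambda>A. child)"
    and child_path: "\<exists>c. c 0 = 0 \<and> (\<forall>n. child (c n) (c (Suc n)))"
    and child_no_HYP_path: "\<And>c. (\<And>n. child (c n) (c (Suc n))) \<Longrightarrow> {pp n (c n) | n. True} \<notin> HYP"
    and l_ar: "ar (\<lambda>A. l)"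
    and sat_query: "\<And>A x. query A x \<longleftrightarrow> sat A l k x"
begin

text \<open>\<open>Next\<close> is known to be monotone only on stages, whereas a fixed point needs
  a monotone operator on all sets; this extension agrees with \<open>Next\<close> on stages.\<close>

definition Next_up :: "nat set \<Rightarrow> nat set" where "Next_up K = \<Union>{Next L | L. stage L \<and> L \<subseteq> K}"

text \<open>The greatest solution is taken so that nodes on an infinite path are not left with too
  few stages.\<close>

definition kappa :: "nat \<Rightarrow> nat set" where
  "kappa = gfp (\<lambda>f t. \<Union>s\<in>{s. child t s}. Next_up (f s))"

lemma stage_Next_up: "stage (Next_up K)"
  unfolding Next_up_def by (rule stage_Union) (auto intro: stage_Next)

lemma Next_up_stage: "stage K \<Longrightarrow> Next_up K = Next K"
  unfolding Next_up_def using Next_mono by blast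

lemma kappa_mono: "mono (\<lambda>f t. \<Union>s\<in>{s. child t s}. Next_up (f s))"
  unfolding mono_def le_fun_def Next_up_def by fast

lemma kappa_unfold_up: "kappa t = (\<Union>s\<in>{s. child t s}. Next_up (kappa s))"
  unfolding kappa_def by (subst gfp_unfold[OF kappa_mono]) simp

lemma stage_kappa: "stage (kappa t)"
  unfolding kappa_unfold_up[of t] by (rule stage_Union) (auto intro: stage_Next_up)

lemma kappa_unfold: "kappa t = (\<Union>s\<in>{s. child t s}. Next (kappa s))"
  using kappa_unfold_up[of t] by (simp add: Next_up_stage stage_kappa)

text \<open>Coinduction: the union \<open>W\<close> of all stages is again a stage, and the
  assignment of \<open>W\<close> to the nodes of one infinite path, and of the empty set elsewhere,
  is a post-fixed point.\<close>

lemma kappa_0: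
  assumes "stage K"
  shows "K \<subseteq> kappa 0"
proof -
  obtain c where c: "c 0 = 0" "\<And>n. child (c n) (c (Suc n))" using child_path by blast
  define W where "W = \<Union>{K. stage K}"
  have W: "stage W" unfolding W_def by (rule stage_Union) simp
  define g where "g t = (if t \<in> range c then W else {})" for t
  have "g \<le> (\<lambda>t. \<Union>s\<in>{s. child t s}. Next_up (g s))"
  proof (rule le_funI)
    fix t
    show "g t \<le> (\<Union>s\<in>{s. child t s}. Next_up (g s))"
    proof (cases "t \<in> range c")
      case True
      then obtain n where n: "t = c n" by blast
      have "g t \<subseteq> Next_up (g (c (Suc n)))"
        using Next_increasing[of W] by (simp add: g_def Next_up_stage[OF W])
      then show ?thesis using c(2)[of n] n by blast
    qed (simp add: g_def)
  qed
  then have "g \<le> kappa" unfolding kappa_def by (rule gfp_upperbound)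
  then have "g 0 \<subseteq> kappa 0" by (rule le_funD)
  moreover have "g 0 = W" using c(1) unfolding g_def by (metis rangeI)
  moreover have "K \<subseteq> W" using assms W_def by blast
  ultimately show ?thesis by simp
qed

text \<open>A child that has reached \<open>S\<close> is held at \<open>S\<close> because
  \<open>X\<close> is captured there; a child below \<open>S\<close> has not captured
  \<open>X\<close>, and its \<open>Next\<close> still lies inside \<open>S\<close>. So the cut
  stages satisfy the equation that the code can express without knowing \<open>S\<close>.\<close>

lemma kappa_cut:
  assumes "level X S"
  shows "kappa t \<inter> S = (\<Union>s\<in>{s. child t s}. next_unless X (kappa s \<inter> S))"
proof -
  have S: "stage S" "captured X S" "\<And>L. stage L \<Longrightarrow> L \<subset> S \<Longrightarrow> \<not> captured X L"
    using assms by (auto simp: level_def)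
  have "Next (kappa s) \<inter> S = next_unless X (kappa s \<inter> S)" for s
  proof (cases "S \<subseteq> kappa s")
    case True
    then have "kappa s \<inter> S = S" by blast
    then show ?thesis using S(2) True Next_increasing[of "kappa s"] by (auto simp: next_unless_def)
  next
    case False
    then have sub: "kappa s \<subset> S" using stage_linear[OF stage_kappa S(1)] by blast
    then have "kappa s \<inter> S = kappa s" "Next (kappa s) \<subseteq> S"
      using stage_Next_subset[OF S(1) stage_kappa] by blast+
    then show ?thesis using S(3)[OF stage_kappa sub] by (auto simp: next_unless_def)
  qed
  moreover have "kappa t \<inter> S = (\<Union>s\<in>{s. child t s}. Next (kappa s) \<inter> S)"
    by (subst kappa_unfold) blast
  ultimately show ?thesis by simp
qed

text \<open>Since \<open>Next\<close> commutes with intersections of stages, the cut of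
  \<open>kappa\<close> at \<open>Next S\<close> is obtained from the cuts at \<open>S\<close> by one
  arithmetical step, for all clock nodes simultaneously. This is iterated along \<open>b\<close>,
  with \<open>X\<close> carried along.\<close>

lemma kappa_cut_HYP:
  assumes X: "X \<in> HYP" and b: "kleene_O b" "S_iter b S"
  shows "join X {z. p2 z \<in> kappa (p1 z) \<inter> S} \<in> HYP"
proof -
  define Op where "Op A = join {x. 2 * x \<in> A}
    {z. \<exists>s. child (p1 z) s \<and> p2 z \<in> Next {y. 2 * pp s y + 1 \<in> A}}" for A
  define Lp where "Lp N = join {x. pp (2 * x) 0 \<in> N}
    {z. \<exists>n s. child (p1 z) s \<and> p2 z \<in> Next {y. pp (2 * pp s y + 1) n \<in> N}}" for N
  have Q: "ar2 (\<lambda>A s y. 2 * pp s y + 1 \<in> A)" unfolding ar2_def by (intro arp_mem ar_intros)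
  have Op: "arp (\<lambda>A x. x \<in> Op A)" unfolding Op_def join_def mem_Collect_eq
    by (intro ar_intros arp_mem ar2_app[OF child_ar] ar2_app[OF ar2_Next[OF Q]])
  have Q: "ar2 (\<lambda>A v y. pp (2 * pp (p1 v) y + 1) (p2 v) \<in> A)" unfolding ar2_def by (intro arp_mem ar_intros)
  have N: "arp (\<lambda>A x. g A x \<in> Next {y. pp (2 * pp (f A x) y + 1) (h A x) \<in> A})"
    if "ar g" "ar f" "ar h" for g f h
    using ar2_app[OF ar2_Next[OF Q] ar_pair[OF that(2,3)] that(1)] by simp
  have Lp: "arp (\<lambda>A x. x \<in> Lp A)" unfolding Lp_def join_def mem_Collect_eq
    by (intro ar_intros arp_mem ar2_app[OF child_ar] N)
  have K: "(\<exists>s. child t s \<and> y \<in> Next (kappa s \<inter> S)) \<longleftrightarrow> y \<in> kappa t \<and> y \<in> Next S" if "stage S" for t y S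
    using kappa_unfold[of t] by (auto simp: Next_Int[OF stage_kappa that])
  have eq: "M = join X {z. p2 z \<in> kappa (p1 z) \<inter> S}"
    if "S_iter b S" "iter_set (join X {}) Op Lp b M" for b S M
    using that
  proof (induction arbitrary: M rule: iter_set.induct)
    case iter_zero
    then show ?case by (simp add: iter_set_1D)
  next
    case (iter_succ a S)
    then have "a \<noteq> 0" by (metis iter_set_not_0)
    then obtain M' where "M = Op M'" "iter_set (join X {}) Op Lp a M'" using iter_set_succD iter_succ.prems by blast
    then have M: "M = Op (join X {z. p2 z \<in> kappa (p1 z) \<inter> S})" using iter_succ.IH by blast
    have "{y. y \<in> kappa s \<and> y \<in> S} = kappa s \<inter> S" for s by blast
    then show ?case unfolding M using K[OF S_iter_stage[OF iter_succ.hyps]] by (simp add: Op_def)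
  next
    case (iter_lim e s Y)
    obtain s' Y' where *: "\<forall>n. phi {} e n = Some (s' n)" "\<forall>n. iter_set (join X {}) Op Lp (s' n) (Y' n)"
      "M = Lp (join_seq Y')" using iter_set_limD[OF iter_lim.prems] by blast
    have "s' = s" using iter_lim.hyps(1) *(1) by (simp add: fun_eq_iff)
    then have Y': "Y' n = join X {z. p2 z \<in> kappa (p1 z) \<inter> Y n}" for n using iter_lim.IH *(2) by blast
    have "{y. y \<in> kappa s \<and> y \<in> Y n} = kappa s \<inter> Y n" for s n by blast
    then have "M = join X {z. \<exists>n. p2 z \<in> kappa (p1 z) \<and> p2 z \<in> Next (Y n)}"
      unfolding *(3) using K[OF S_iter_stage[OF iter_lim.hyps(2)]] by (simp add: Lp_def Y')
    then show ?case by simp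
  qed
  obtain M where M: "iter_set (join X {}) Op Lp b M" using iter_set_exists[OF b(1)] by blast
  have "join X {} \<in> HYP" by (intro HYP_join X empty_HYP)
  from iter_set_HYP[OF this Op Lp b(1) M] show ?thesis unfolding eq[OF b(2) M] .
qed

section \<open>States of the code and their truth values\<close>

abbreviation "sb st \<equiv> p1 (p2 st)"
abbreviation "sj st \<equiv> p1 (p2 (p2 st))"
abbreviation "sc st \<equiv> p1 (p2 (p2 (p2 st)))"
abbreviation "sz st \<equiv> p2 (p2 (p2 (p2 st)))"
abbreviation "qs b j s z \<equiv> pp 0 (pp b (pp j (pp s z)))"

text \<open>The position of the joined oracle that the literal asks about: even positions belong to
  the stage, odd ones to \<open>X\<close>.\<close>

abbreviation "lnum st \<equiv> l (sz st) div 2 - 1"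

text \<open>The sign of the state combined with the sign of its literal.\<close>

definition lb :: "nat \<Rightarrow> nat" where "lb st = (if even (l (sz st)) then sb st else flip (sb st))"

text \<open>The state \<open>qs b j s z\<close> stands for the formula \<open>sat (join (K\<^sub>s) X) l j z\<close>, negated unless
  \<open>b = 1\<close>; the state \<open>pp 1 n\<close> is a leaf for the cone of \<open>string_of n\<close>, any other state a leaf
  for the empty set.\<close>

definition step :: "nat \<Rightarrow> nat \<Rightarrow> nat" where
  "step st n =
     (if p1 st \<noteq> 0 then pp 2 0
      else if sj st \<noteq> 0 then qs (flip (sb st)) (sj st - 1) (sc st) (pp (sz st) n)
      else if l (sz st) < 2 then (if l (sz st) = 1 \<longleftrightarrow> sb st = 1 then pp 1 0 else pp 2 0)
      else if odd (lnum st) then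
        (if binary n \<and> lnum st div 2 < len_code n \<and> (nth_code n (lnum st div 2) \<noteq> 0 \<longleftrightarrow> lb st = 1)
         then pp 1 n else pp 2 0)
      else if child (sc st) n then qs (lb st) k n (pp 0 (lnum st div 2))
      else if lb st = 1 then pp 2 0 else pp 1 0)"

definition is_cap :: "nat \<Rightarrow> bool" where
  "is_cap st \<longleftrightarrow> (if sj st \<noteq> 0 then sb st \<noteq> 1 else 2 \<le> l (sz st) \<and> even (lnum st) \<and> lb st \<noteq> 1)"

definition label :: "nat \<Rightarrow> node_label" where
  "label st = (if p1 st = 0 then if is_cap st then Cap else Cup
     else if p1 st = 1 then Clopen [string_of (p2 st)] else Clopen [])"

definition label_num :: "nat \<Rightarrow> nat" where
  "label_num st = (if p1 st = 0 then if is_cap st then 1 else 0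
     else if p1 st = 1 then 3 + pp (p2 st) 0 else 2)"

lemma ar_step:
  assumes "ar f" "ar g"
  shows "ar (\<lambda>A x. step (f A x) (g A x))"
proof -
  have "ar (\<lambda>A z. step (p1 z) (p2 z))"
    unfolding step_def lb_def flip_def binary_def
    by (intro ar_intros ar_comp[OF l_ar] ar2_app[OF child_ar])
  from ar_comp[OF this ar_pair[OF assms]] show ?thesis by simp
qed

lemma ar_label_num: "ar f \<Longrightarrow> ar (\<lambda>A x. label_num (f A x))"
  unfolding label_num_def is_cap_def lb_def flip_def by (intro ar_intros ar_comp[OF l_ar])

text \<open>The intended evaluation map for an assignment \<open>K\<close> of stages to clock
  nodes.\<close>

definition tv :: "(nat \<Rightarrow> nat set) \<Rightarrow> nat set \<Rightarrow> nat \<Rightarrow> bool" where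
  "tv K X st \<longleftrightarrow> (if p1 st = 0 then sb st = 1 \<longleftrightarrow> sat (join (K (sc st)) X) l (sj st) (sz st)
     else p1 st = 1 \<and> (\<forall>i. i < len_code (p2 st) \<longrightarrow> (nth_code (p2 st) i \<noteq> 0 \<longleftrightarrow> i \<in> X)))"

lemma len_code_0 [simp]: "len_code 0 = 0"
  using len_code[of "[]"] by simp

lemma tv_simps [simp]: "\<not> tv K X (pp 2 y)" "tv K X (pp (Suc 0) 0)"
  by (auto simp: tv_def)

text \<open>Positive depth unfolds one quantifier of \<open>sat\<close>. At depth 0 a literal about
  the stage is where the equation for \<open>K\<close> is used: it moves to the clock children and
  asks \<open>query\<close> again there.\<close>

lemma tv_step:
  assumes K: "\<And>t. K t = (\<Union>s\<in>{s. child t s}. next_unless X (K s))" and st: "p1 st = 0"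
  shows "tv K X st \<longleftrightarrow> (if is_cap st then \<forall>n. tv K X (step st n) else \<exists>n. tv K X (step st n))"
proof (cases "sj st")
  case (Suc j)
  have "tv K X (step st n) \<longleftrightarrow> (sb st \<noteq> 1 \<longleftrightarrow> sat (join (K (sc st)) X) l j (pp (sz st) n))" for n
    using Suc st by (simp add: step_def tv_def flip_def)
  then show ?thesis using Suc st by (auto simp: tv_def is_cap_def)
next
  case 0
  have tv: "tv K X st \<longleftrightarrow> (sb st = 1 \<longleftrightarrow> lit (join (K (sc st)) X) (l (sz st)))"
    using 0 st by (simp add: tv_def)
  consider (const) "l (sz st) < 2" | (real) "2 \<le> l (sz st)" "odd (lnum st)" | (clock) "2 \<le> l (sz st)" "even (lnum st)"
    by linarith
  then show ?thesis
  proof cases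
    case const
    have "step st n = (if l (sz st) = 1 \<longleftrightarrow> sb st = 1 then pp 1 0 else pp 2 0)" for n
      using 0 st const by (simp add: step_def)
    moreover have "lit A (l (sz st)) \<longleftrightarrow> l (sz st) = 1" for A
      using const by (simp add: lit_def)
    ultimately have "tv K X (step st n) \<longleftrightarrow> tv K X st" for n
      unfolding tv by (cases "l (sz st) = 1"; cases "sb st = 1") simp_all
    moreover have "\<not> is_cap st" using 0 const by (simp add: is_cap_def)
    ultimately show ?thesis by simp
  next
    case real
    let ?w = "lnum st div 2"
    have "tv K X st \<longleftrightarrow> (lb st = 1 \<longleftrightarrow> ?w \<in> X)"
      unfolding tv using real by (auto simp: lit_def join_def lb_def flip_def)
    moreover have "(\<exists>n. tv K X (step st n)) \<longleftrightarrow> (lb st = 1 \<longleftrightarrow> ?w \<in> X)"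
    proof
      assume "\<exists>n. tv K X (step st n)"
      then obtain n where n: "tv K X (step st n)" by blast
      then have "?w < len_code n" "nth_code n ?w \<noteq> 0 \<longleftrightarrow> lb st = 1" "tv K X (pp 1 n)"
        using 0 st real by (auto simp: step_def split: if_splits)
      then show "lb st = 1 \<longleftrightarrow> ?w \<in> X" by (auto simp: tv_def)
    next
      assume w: "lb st = 1 \<longleftrightarrow> ?w \<in> X"
      \<comment> \<open>An initial segment of \<open>X\<close> just long enough to decide the
        literal labels a leaf that contains \<open>X\<close>.\<close>
      define n where "n = list_encode (map (\<lambda>i. of_bool (i \<in> X)) [0..<Suc ?w])"
      have len: "len_code n = Suc ?w" unfolding n_def by (subst len_code) simp
      have nth: "nth_code n i = of_bool (i \<in> X)" if "i < Suc ?w" for i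
        unfolding n_def using that by (subst nth_code) (auto simp del: upt_Suc)
      have "step st n = pp 1 n"
        using 0 st real w by (simp add: step_def binary_def len nth)
      moreover have "tv K X (pp 1 n)" using len nth by (simp add: tv_def)
      ultimately show "\<exists>n. tv K X (step st n)" by metis
    qed
    moreover have "\<not> is_cap st" using 0 real by (simp add: is_cap_def)
    ultimately show ?thesis by simp
  next
    case clock
    let ?v = "lnum st div 2"
    have *: "tv K X st \<longleftrightarrow> (lb st = 1 \<longleftrightarrow> ?v \<in> K (sc st))"
      unfolding tv using clock by (auto simp: lit_def join_def lb_def flip_def)
    \<comment> \<open>Numbers that are no clock children get a neutral leaf: the empty set below a
      union, the whole space below an intersection.\<close>
    have step: "tv K X (step st n) \<longleftrightarrow>
        (if child (sc st) n then lb st = 1 \<longleftrightarrow> ?v \<in> next_unless X (K n) else lb st \<noteq> 1)" for n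
      using 0 st clock sat_query[of "join (K n) X" "pp 0 ?v"] by (auto simp: step_def tv_def)
    have "?v \<in> K (sc st) \<longleftrightarrow> (\<exists>n. child (sc st) n \<and> ?v \<in> next_unless X (K n))"
      using K[of "sc st"] by blast
    moreover have "is_cap st \<longleftrightarrow> lb st \<noteq> 1" using 0 clock by (simp add: is_cap_def)
    ultimately show ?thesis unfolding * step by auto
  qed
qed

text \<open>The colour question of \<open>query\<close>, put to the stage at the clock root 0. Tag 0
  is taken by questions about stages, so colour \<open>i\<close> uses
  \<open>root (Suc i)\<close>.\<close>

definition root :: "nat \<Rightarrow> nat" where "root i = qs 1 k 0 (pp i 0)"

section \<open>The labeled trees and their hyperarithmetic evaluation maps\<close>

definition state :: "nat \<Rightarrow> nat list \<Rightarrow> nat" where "state i \<sigma> = foldl step (root i) \<sigma>"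

definition tree :: "nat \<Rightarrow> nat list set" where
  "tree i = {\<sigma>. \<forall>m<length \<sigma>. p1 (state i (take m \<sigma>)) = 0}"

definition state_num :: "nat \<Rightarrow> nat \<Rightarrow> nat \<Rightarrow> nat" where
  "state_num i c m = rec_nat (root i) (\<lambda>n v. step v (nth_code c n)) m"

lemma state_simps [simp]: "state i [] = root i" "state i (\<sigma> @ [n]) = step (state i \<sigma>) n"
  by (simp_all add: state_def)

lemma state_num: "m \<le> len_code c \<Longrightarrow> state_num i c m = state i (take m (list_decode c))"
proof (induction m)
  case 0
  then show ?case by (simp add: state_num_def)
next
  case (Suc m)
  have m: "m < length (list_decode c)" using Suc.prems len_code[of "list_decode c"] by simp
  have "nth_code c m = list_decode c ! m" using nth_code[OF m] by simp
  then show ?case using Suc by (simp add: state_num_def take_Suc_conv_app_nth[OF m])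
qed

lemma state_num_len: "state_num i c (len_code c) = state i (list_decode c)"
  using state_num[of "len_code c" c i] len_code[of "list_decode c"] by simp

lemma ar_state_num:
  assumes "ar f" "ar g"
  shows "ar (\<lambda>A x. state_num i (f A x) (g A x))"
proof -
  have "ar (\<lambda>A z. state_num i (p1 z) (p2 z))"
    unfolding state_num_def by (intro ar_rec ar_step ar_intros)
  from ar_comp[OF this ar_pair[OF assms]] show ?thesis by simp
qed

lemma tree_num: "list_decode c \<in> tree i \<longleftrightarrow> (\<forall>m. m < len_code c \<longrightarrow> p1 (state_num i c m) = 0)"
  using len_code[of "list_decode c"] by (auto simp: tree_def state_num)

lemma arp_tree: "ar f \<Longrightarrow> arp (\<lambda>A x. list_decode (f A x) \<in> tree i)"
proof -
  assume f: "ar f"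
  have "arp (\<lambda>A c. list_decode c \<in> tree i)"
    unfolding tree_num by (intro ar_intros ar_state_num)
  from ar_comp[OF this f] show ?thesis .
qed

lemma tree_snoc: "\<sigma> @ [n] \<in> tree i \<longleftrightarrow> \<sigma> \<in> tree i \<and> p1 (state i \<sigma>) = 0"
  by (auto simp: tree_def less_Suc_eq)

lemma is_tree_tree: "is_tree (tree i)"
proof -
  have "\<tau> \<in> tree i" if \<sigma>: "\<sigma> \<in> tree i" "prefix \<tau> \<sigma>" for \<sigma> \<tau>
    unfolding tree_def
  proof (intro CollectI allI impI)
    fix m assume m: "m < length \<tau>"
    obtain zs where "\<sigma> = \<tau> @ zs" using \<sigma>(2) by (auto simp: prefix_def)
    with m have "take m \<sigma> = take m \<tau>" "m < length \<sigma>" by simp_all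
    with \<sigma>(1) show "p1 (state i (take m \<tau>)) = 0" unfolding tree_def by fastforce
  qed
  moreover have "[] \<in> tree i" by (simp add: tree_def)
  ultimately show ?thesis by (auto simp: is_tree_def)
qed

lemma is_leaf_tree: "\<sigma> \<in> tree i \<Longrightarrow> is_leaf (tree i) \<sigma> \<longleftrightarrow> p1 (state i \<sigma>) \<noteq> 0"
  by (auto simp: is_leaf_def tree_snoc)

text \<open>The bound on the depth makes truth at a state arithmetical; binary leaves make
  \<open>label_num\<close> the code of the label.\<close>

lemma state_invariant: 
  "(p1 (state i \<sigma>) = 0 \<longrightarrow> sj (state i \<sigma>) \<le> k) \<and> (p1 (state i \<sigma>) = 1 \<longrightarrow> binary (p2 (state i \<sigma>)))"
proof (induction \<sigma> rule: rev_induct)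
  case Nil
  then show ?case by (simp add: root_def)
next
  case (snoc n \<sigma>)
  have "binary 0" by (simp add: binary_def)
  with snoc show ?case by (auto simp: step_def)
qed

lemma label_code_label: "label_code (label (state i \<sigma>)) = label_num (state i \<sigma>)"
  using state_invariant[of i \<sigma>] by (auto simp: label_def label_num_def list_encode_string_of)

text \<open>An infinite path never meets a leaf, so its depth falls from \<open>k\<close> to 0,
  after which the clock must move to a child and the depth is reset. Every \<open>Suc k\<close>
  steps thus advance the clock, and a hyperarithmetic path would give a hyperarithmetic clock
  path.\<close>

lemma no_HYP_path: "\<nexists>g. is_path (tree i) g \<and> hyp_fun_on UNIV id id g"
proof
  assume "\<exists>g. is_path (tree i) g \<and> hyp_fun_on UNIV id id g"
  then obtain g where g: "\<And>n. map g [0..<n] \<in> tree i" and G: "{z. p2 z = g (p1 z)} \<in> HYP"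
    by (auto simp: is_path_def hyp_fun_iff)
  define st where "st n = state i (map g [0..<n])" for n
  have 0: "p1 (st n) = 0" for n
    using g[of "Suc n"] by (simp add: tree_snoc st_def)
  have Suc: "st (Suc n) = step (st n) (g n)" for n by (simp add: st_def)
  have pos: "sj (step s n) = sj s - 1 \<and> sc (step s n) = sc s" if "p1 s = 0" "sj s \<noteq> 0" for s n
    using that by (simp add: step_def)
  have zero: "child (sc s) (sc (step s n)) \<and> sj (step s n) = k"
    if s: "p1 s = 0" "sj s = 0" "p1 (step s n) = 0" for s n
  proof -
    have ne: "p1 (if b then pp 1 x else pp 2 y) \<noteq> 0" "p1 (if b then pp 2 y else pp 1 x) \<noteq> 0" for b x y
      by simp_all
    have "\<not> l (sz s) < 2"
    proof
      assume "l (sz s) < 2"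
      with s show False using ne by (simp only: step_def if_True if_False not_True_eq_False simp_thms)
    qed
    moreover have "\<not> odd (lnum s)"
    proof
      assume "odd (lnum s)"
      with s \<open>\<not> l (sz s) < 2\<close> show False using ne by (simp only: step_def if_True if_False simp_thms)
    qed
    moreover have "child (sc s) n"
    proof (rule ccontr)
      assume "\<not> child (sc s) n"
      with s calculation show False using ne by (simp only: step_def if_True if_False simp_thms)
    qed
    ultimately have "step s n = qs (lb s) k n (pp 0 (lnum s div 2))"
      using s by (simp only: step_def if_True if_False simp_thms)
    with \<open>child (sc s) n\<close> show ?thesis by simp
  qed
  define c where "c n = sc (st (n * Suc k))" for n
  have run: "sj (st (m + d)) = k - d \<and> sc (st (m + d)) = sc (st m)" if "sj (st m) = k" "d \<le> k" for m d
    using that(2)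
  proof (induction d)
    case (Suc d)
    then show ?case using pos[OF 0, of "m + d" "g (m + d)"] by (simp add: \<open>\<And>n. st (Suc n) = step (st n) (g n)\<close>)
  qed (use that in simp)
  have jump: "child (sc (st m)) (sc (st (m + Suc k))) \<and> sj (st (m + Suc k)) = k" if "sj (st m) = k" for m
    using run[OF that, of k] zero[OF 0, of "m + k" "g (m + k)"] 0[of "m + Suc k"] by (simp add: Suc)
  have j: "sj (st (n * Suc k)) = k" for n
  proof (induction n)
    case 0
    then show ?case by (simp add: st_def root_def)
  next
    case (Suc n)
    then show ?case using jump[of "n * Suc k"] by (simp add: ac_simps)
  qed
  have "child (c n) (c (Suc n))" for n
    using jump[OF j[of n]] by (simp add: c_def ac_simps)
  then have "{pp n (c n) | n. True} \<notin> HYP" by (rule child_no_HYP_path)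
  moreover have "{pp n (c n) | n. True} \<in> HYP"
  proof -
    define gA where "gA A x = (if \<exists>y. pp x y \<in> A then LEAST y. pp x y \<in> A else 0)" for A x
    have "arp (\<lambda>A z. pp (p1 z) (p2 z) \<in> A)" by (intro arp_mem ar_intros)
    then have gA: "ar gA" unfolding gA_def[abs_def] by (rule ar_Least)
    have g: "gA {z. p2 z = g (p1 z)} = g" by (auto simp: gA_def intro!: Least_equality)
    define sA where "sA A n = rec_nat (root i) (\<lambda>m v. step v (gA A m)) n" for A n
    have "sA {z. p2 z = g (p1 z)} n = st n" for n
      by (induction n) (simp_all add: sA_def g Suc, simp add: st_def)
    moreover have "arp (\<lambda>A z. p2 z = sc (sA A (p1 z * Suc k)))"
      unfolding sA_def by (intro ar_intros ar_rec ar_step ar_comp[OF gA])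
    from HYP_arithmetical[OF G this] have "{z. p2 z = sc (sA {z. p2 z = g (p1 z)} (p1 z * Suc k))} \<in> HYP" .
    ultimately show ?thesis unfolding pair_graph c_def by simp
  qed
  ultimately show False by blast
qed

lemma borel_code_tree: "borel_code_HYP (tree i) (\<lambda>\<sigma>. label (state i \<sigma>))"
proof -
  have "list_encode ` tree i = {c. list_decode c \<in> tree i}"
    by (auto simp: image_iff) (metis list_decode_inverse)
  also have "\<dots> \<in> HYP" by (intro HYP_static arp_tree ar_id)
  finally have "list_encode ` tree i \<in> HYP" .
  moreover have "hyp_fun_on (tree i) list_encode label_code (\<lambda>\<sigma>. label (state i \<sigma>))"
  proof -
    have "arp (\<lambda>A z. list_decode (p1 z) \<in> tree i \<and> p2 z = label_num (state_num i (p1 z) (len_code (p1 z))))"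
      by (intro ar_intros arp_tree ar_label_num ar_state_num)
    from HYP_static[OF this] show ?thesis
      unfolding hyp_fun_on_def label_code_label set_code[where h="\<lambda>\<sigma>. label_num (state i \<sigma>)"] by (simp add: state_num_len)
  qed
  ultimately show ?thesis
    using is_tree_tree no_HYP_path[of i] by (auto simp: borel_code_HYP_def is_leaf_tree label_def)
qed

lemma arp_sat:
  assumes "ar2 Q"
  shows "ar2 (\<lambda>A s z. sat {w. Q A s w} l j z)"
proof (induction j)
  case 0
  show ?case unfolding ar2_def sat.simps lit_def mem_Collect_eq
    by (intro ar_intros ar_comp[OF l_ar] ar2_app[OF assms])
next
  case (Suc j)
  show ?case unfolding ar2_def sat.simps
    by (intro ar_intros ar2_app[OF Suc])
qed

text \<open>Here the prefix length is data. Each length needs its own number of jumps, so truth is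
  uniformly arithmetical only below a fixed bound.\<close>

lemma arp_sat_le:
  assumes "ar2 Q" "ar s" "ar j" "ar z"
  shows "arp (\<lambda>A x. j A x \<le> m \<and> sat {w. Q A (s A x) w} l (j A x) (z A x))"
proof (induction m)
  case 0
  have "arp (\<lambda>A x. j A x = 0 \<and> sat {w. Q A (s A x) w} l 0 (z A x))"
    by (intro arp_conj arp_eq ar_const assms ar2_app[OF arp_sat[OF assms(1)]])
  moreover have "(j A x = 0 \<and> sat {w. Q A (s A x) w} l 0 (z A x)) \<longleftrightarrow>
      (j A x \<le> 0 \<and> sat {w. Q A (s A x) w} l (j A x) (z A x))" for A x
    by auto
  ultimately show ?case by (simp only:)
next
  case (Suc m)
  have "arp (\<lambda>A x. (j A x \<le> m \<and> sat {w. Q A (s A x) w} l (j A x) (z A x)) \<or>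
     (j A x = Suc m \<and> sat {w. Q A (s A x) w} l (Suc m) (z A x)))"
    by (intro arp_disj arp_conj arp_eq ar_const assms Suc ar2_app[OF arp_sat[OF assms(1)]])
  moreover have "(j A x \<le> m \<and> sat {w. Q A (s A x) w} l (j A x) (z A x)) \<or>
     (j A x = Suc m \<and> sat {w. Q A (s A x) w} l (Suc m) (z A x)) \<longleftrightarrow>
     (j A x \<le> Suc m \<and> sat {w. Q A (s A x) w} l (j A x) (z A x))" for A x
    using le_Suc_eq by metis
  ultimately show ?case by (simp only:)
qed

lemma hyp_eval_map_tree:
  assumes X: "X \<in> HYP" and b: "kleene_O b" "S_iter b S" and S: "level X S"
  shows "hyp_eval_map (tree i) (\<lambda>\<sigma>. label (state i \<sigma>)) X (\<lambda>\<sigma>. tv (\<lambda>t. kappa t \<inter> S) X (state i \<sigma>))"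
proof -
  let ?K = "\<lambda>t. kappa t \<inter> S"
  let ?f = "\<lambda>\<sigma>. tv ?K X (state i \<sigma>)"
  have "eval_map (tree i) (\<lambda>\<sigma>. label (state i \<sigma>)) X ?f" unfolding eval_map_def
  proof
    fix \<sigma> assume \<sigma>: "\<sigma> \<in> tree i"
    show "?f \<sigma> \<longleftrightarrow> (case label (state i \<sigma>) of
           Clopen ss \<Rightarrow> X \<in> clopen_of ss
         | Cup \<Rightarrow> (\<exists>n. \<sigma> @ [n] \<in> tree i \<and> ?f (\<sigma> @ [n]))
         | Cap \<Rightarrow> (\<forall>n. \<sigma> @ [n] \<in> tree i \<longrightarrow> ?f (\<sigma> @ [n])))"
    proof (cases "p1 (state i \<sigma>) = 0")
      case True
      then show ?thesis using tv_step[OF kappa_cut[OF S] True] \<sigma> by (simp add: label_def tree_snoc)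
    next
      case False
      then show ?thesis by (auto simp: label_def tv_def clopen_of_def in_cone_string_of)
    qed
  qed
  moreover have "hyp_fun_on (tree i) list_encode of_bool ?f"
  proof -
    define Q where "Q A s w \<longleftrightarrow> w \<in> join {y. 2 * pp s y + 1 \<in> A} {x. 2 * x \<in> A}" for A s w
    have Q: "ar2 Q" unfolding ar2_def Q_def join_def mem_Collect_eq by (intro ar_intros arp_mem)
    define tA where "tA A st \<longleftrightarrow> (if p1 st = 0 then sb st = 1 \<longleftrightarrow> (sj st \<le> k \<and> sat {w. Q A (sc st) w} l (sj st) (sz st))
     else p1 st = 1 \<and> (\<forall>i. i < len_code (p2 st) \<longrightarrow> (nth_code (p2 st) i \<noteq> 0 \<longleftrightarrow> 2 * i \<in> A)))" for A st
    let ?A = "join X {z. p2 z \<in> kappa (p1 z) \<inter> S}"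
    have "{w. Q ?A s w} = join (?K s) X" for s
      unfolding Q_def by (simp add: Int_def)
    then have tA: "tA ?A (state i \<sigma>) \<longleftrightarrow> ?f \<sigma>" for \<sigma>
      using state_invariant[of i \<sigma>] by (auto simp: tA_def tv_def)
    have tA_ar: "arp tA" unfolding tA_def[abs_def]
      by (intro ar_intros arp_mem arp_sat_le[OF Q])
    have "arp (\<lambda>A z. list_decode (p1 z) \<in> tree i \<and> p2 z = of_bool (tA A (state_num i (p1 z) (len_code (p1 z)))))"
      by (intro ar_intros arp_tree ar_comp[OF tA_ar] ar_state_num)
    from HYP_arithmetical[OF kappa_cut_HYP[OF X b] this] show ?thesis
      unfolding hyp_fun_on_def set_code[where h="\<lambda>\<sigma>. of_bool (?f \<sigma>)"] by (simp only: state_num_len tA)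
  qed
  ultimately show ?thesis by (simp add: hyp_eval_map_def)
qed

section \<open>The two colours\<close>

definition colour :: "nat \<Rightarrow> nat set set" where
  "colour i = {X \<in> HYP. two_blocks X \<and> (\<exists>S. level X S \<and> (is_col X (U1 S) \<longleftrightarrow> i = 0))}"

lemma borel_colour: "borel_in_HYP (colour i)"
proof -
  let ?T = "tree (Suc i)" and ?L = "\<lambda>\<sigma>. label (state (Suc i) \<sigma>)"
  have root: "(\<exists>f. hyp_eval_map ?T ?L X f \<and> f []) \<longleftrightarrow> X \<in> colour i" "\<exists>f. hyp_eval_map ?T ?L X f" if X: "X \<in> HYP" for X
  proof -
    obtain b S where b: "kleene_O b" "S_iter b S" "level X S" using level_exists[OF X] .
    note f = hyp_eval_map_tree[OF X b, of "Suc i"]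
    show "\<exists>f. hyp_eval_map ?T ?L X f" using f by blast
    \<comment> \<open>The clock root carries all stages, so its cut is the level itself and the root
      is evaluated at exactly the stage that defines the colour.\<close>
    have "kappa 0 \<inter> S = S" using kappa_0[of S] b(3) by (auto simp: level_def)
    then have "tv (\<lambda>t. kappa t \<inter> S) X (state (Suc i) []) \<longleftrightarrow> query (join S X) (pp (Suc i) 0)"
      by (simp add: tv_def root_def sat_query)
    also have "\<dots> \<longleftrightarrow> two_blocks X \<and> (is_col X (U1 S) \<longleftrightarrow> i = 0)" by simp
    also have "\<dots> \<longleftrightarrow> X \<in> colour i"
      unfolding colour_def using X b(3) level_unique by blast
    finally have "tv (\<lambda>t. kappa t \<inter> S) X (state (Suc i) []) \<longleftrightarrow> X \<in> colour i" .
    then show "(\<exists>f. hyp_eval_map ?T ?L X f \<and> f []) \<longleftrightarrow> X \<in> colour i"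
      using f eval_map_unique[OF borel_code_tree _ f] by blast
  qed
  have "colour i = {X \<in> HYP. \<exists>f. hyp_eval_map ?T ?L X f \<and> f []}"
    using root(1) by (auto simp: colour_def)
  moreover have "completely_determined_HYP ?T ?L"
    unfolding completely_determined_HYP_def using root(2) by blast
  ultimately show ?thesis using borel_code_tree unfolding borel_in_HYP_def by blast
qed

lemma colour_cover: "partitions 2 \<inter> HYP = colour 0 \<union> colour 1"
proof -
  have "X \<in> colour 0 \<union> colour 1" if X: "X \<in> HYP" "two_blocks X" for X
  proof -
    obtain S where "level X S" using level_exists[OF X(1)] by blast
    then show ?thesis using X by (auto simp: colour_def)
  qed
  moreover have "colour i \<subseteq> partitions 2 \<inter> HYP" for i
    by (auto simp: colour_def two_blocks_iff)
  ultimately show ?thesis unfolding two_blocks_iff by blast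
qed

lemma colour_not_homogeneous:
  assumes "p \<in> partitions \<infinity> \<inter> HYP"
  shows "\<not> coarsenings p 2 \<inter> HYP \<subseteq> colour 0" "\<not> coarsenings p 2 \<inter> HYP \<subseteq> colour 1"
proof -
  have p: "p \<in> partitions \<infinity>" "p \<in> HYP" using assms by auto
  obtain a S where a: "kleene_O a" "S_iter a S" "is_col p (U0 S)" using HYP_captured[OF p(2)] .
  note d = diag_level[OF p(1) S_iter_stage[OF a(2)] a(3)]
  have "is_col (diag p (U0 S)) (U2 S)" using is_col_add_diags[OF d(2)] by (simp add: U2_def)
  then have HYP: "diag p (U0 S) \<in> HYP" "diag p (U1 S) \<in> HYP"
    using d(5) is_col_HYP[OF S_iter_HYP[OF a(1,2)]] by blast+
  have "diag p (U1 S) \<notin> colour 0" "diag p (U0 S) \<notin> colour 1"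
    unfolding colour_def using d(1-4) level_unique by fastforce+
  then show "\<not> coarsenings p 2 \<inter> HYP \<subseteq> colour 0" "\<not> coarsenings p 2 \<inter> HYP \<subseteq> colour 1"
    using HYP diag_coarsening(1)[OF p(1)] by blast+
qed

end

theorem theorem5p13:
  shows "\<not> Borel_Dual_Ramsey_in_HYP \<and>
    (\<exists>C :: nat \<Rightarrow> nat set set.
       borel_in_HYP (C 0) \<and> borel_in_HYP (C 1) \<and>
       partitions 2 \<inter> HYP = C 0 \<union> C 1 \<and>
       \<not> (\<exists>p \<in> partitions \<infinity> \<inter> HYP. \<exists>i<2. coarsenings p 2 \<inter> HYP \<subseteq> C i))"
proof -
  obtain child where child: "ar2 (\<lambda>A. child)" "\<exists>c. c 0 = 0 \<and> (\<forall>n. child (c n) (c (Suc n)))"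
    "\<And>c. (\<And>n. child (c n) (c (Suc n))) \<Longrightarrow> {pp n (c n) | n. True} \<notin> HYP"
    by (rule clock_exists) blast
  obtain l k where l: "ar (\<lambda>A. l)" "\<And>A x. query A x \<longleftrightarrow> sat A l k x"
    by (rule ar_imp_sat[OF arp_query]) blast
  interpret hyp_clock child l k
    by unfold_locales (fact child(1), fact child(2), rule child(3), assumption, fact l(1), fact l(2))
  have no: "\<not> (\<exists>p \<in> partitions \<infinity> \<inter> HYP. \<exists>i<2. coarsenings p 2 \<inter> HYP \<subseteq> colour i)"
    using colour_not_homogeneous less_2_cases by (metis One_nat_def)
  have 2: "enat 2 = 2" by (simp add: numeral_eq_enat)
  have "\<not> Borel_Dual_Ramsey_in_HYP"
  proof
    assume "Borel_Dual_Ramsey_in_HYP"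
    moreover have "partitions (enat 2) \<inter> HYP = (\<Union>i<2. colour i)"
      unfolding 2 colour_cover by (auto simp: less_2_cases_iff)
    ultimately have "\<exists>p \<in> partitions \<infinity> \<inter> HYP. \<exists>i<2. coarsenings p (enat 2) \<inter> HYP \<subseteq> colour i"
      using borel_colour unfolding Borel_Dual_Ramsey_in_HYP_def
      by (elim allE[of _ 2] allE[of _ colour]) simp
    then show False using no unfolding 2 by blast
  qed
  then show ?thesis using borel_colour colour_cover no by blast
qed

end
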